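(* Let $L=\partial_t+\sum_{l=1}^dA_l\partial_l$ define a strongly well posed Cauchy problem and let $\widetilde L$ be the Bérenger split operator with absorptions $\sigma_l(x_l)$. Suppose $(\tau,\xi)\in\mathrm{Char}(L)$, $\tau\ne0$, satisfies the smooth variety hypothesis with parametrization $\tau=\tau(\xi)$, and let $$\beta(x)=\sum_{l=1}^d\frac{\sigma_l(x_l)\,\xi_l}{\tau(\xi)}\,\frac{\partial\tau(\xi)}{\partial\xi_l}.$$ Suppose in addition that there is an interval on a ray $$\Gamma:=\{(0,\underline x)+t\,(1,-\partial_\xi\tau(\xi)),\ 0\le t\le t_0\}\quad\text{so that}\quad\int_0^{t_0}\beta\big(\underline x-t\,\partial_\xi\tau(\xi)\big)\,dt<0.$$ Then the corresponding WKB solution grows in the layer.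
   Context: Symbol $L_1(\tau,\xi)=\tau I+\sum_l\xi_lA_l$; $\mathrm{Char}(L)=\{(\tau,\xi)\ne0:\det L_1(\tau,\xi)=0\}$. Strongly well posed: there are $K,\alpha$ such that each initial value in $L^2(\mathbb R^d)$ yields a unique solution $U\in C([0,\infty[;L^2)$ of $LU=0$ with $\|U(t)\|_{L^2}\le Ke^{\alpha t}\|U(0)\|_{L^2}$ for $t\geq 0$. Smooth variety hypothesis at $(\underline\tau,\underline\xi)$: there is a $C^\infty$ function $\xi\mapsto\tau(\xi)$ on a conic neighborhood of $\underline\xi\in\mathbb R^d\setminus\{0\}$ such that near $(\underline\tau,\underline\xi)$ the characteristic variety has equation $\tau=\tau(\xi)$. The group velocity is $\mathbf v=-\partial_\xi\tau(\xi)$; rays are the space-time lines with velocity $\mathbf v$. Split operator: for $\widetilde U=(U^1,\dots,U^d)$ with $U^l$ valued in $\mathbb C^N$, $(\widetilde L\widetilde U)_l=\partial_tU^l+A_l\partial_l(\sum_jU^j)+\sigma_l(x_l)U^l$. The layer is the region where the absorptions are active. WKB solution: a short wavelength ($\varepsilon\to0$) asymptotic solution $\widetilde U^\varepsilon\sim e^{i(t\tau+x\cdot\xi)/\varepsilon}\sum_{j\ge0}\varepsilon^j\tilde a_j(t,x)$ of $\widetilde L\widetilde U=0$. Its leading amplitude $\tilde a_0$ takes values in $\ker\widetilde L_1(\tau,\xi)$ (the $dN\times dN$ matrix with $(l,k)$ block $\xi_lA_l+\tau\delta_{lk}I$) and satisfies the transport equation $\partial_t\tilde a_0+\mathbf v\cdot\partial_x\tilde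 a_0+\beta(x)\tilde a_0=0$. The corresponding WKB solution is one with this phase whose leading amplitude is carried along $\Gamma$; growth refers to the size of this leading amplitude along $\Gamma$, from its start at $t=0$ to its end at $t=t_0$. *)

theory Defs
  imports "HOL-Analysis.Analysis"
begin

text \<open>
  Space is \<open>real ^ 'd\<close>, the unknown takes values in \<open>complex ^ 'n\<close>, the split unknown in
  \<open>complex ^ 'n ^ 'd\<close> (component \<open>U $ l\<close> is the vector \<open>U^l\<close>), and space-time is
  \<open>real \<times> (real ^ 'd)\<close> with points \<open>(t, x)\<close>.
\<close>

subsection \<open>Functions of class \<open>C^k\<close>\<close>

text \<open>Meant for open \<open>S\<close>.\<close>

fun Ck_on :: "nat \<Rightarrow> 'a::euclidean_space set \<Rightarrow> ('a \<Rightarrow> 'b::real_normed_vector) \<Rightarrow> bool" where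
  "Ck_on 0 S f \<longleftrightarrow> continuous_on S f"
| "Ck_on (Suc k) S f \<longleftrightarrow>
     (\<forall>x\<in>S. f differentiable (at x)) \<and>
     (\<forall>b\<in>Basis. Ck_on k S (\<lambda>x. frechet_derivative f (at x) b))"

definition smooth_on :: "'a::euclidean_space set \<Rightarrow> ('a \<Rightarrow> 'b::real_normed_vector) \<Rightarrow> bool" where
  "smooth_on S f \<longleftrightarrow> (\<forall>k. Ck_on k S f)"

definition deriv_t :: "(real \<times> (real ^ 'd) \<Rightarrow> 'b::real_normed_vector) \<Rightarrow> real \<times> (real ^ 'd) \<Rightarrow> 'b" where
  "deriv_t f p = frechet_derivative f (at p) (1, 0)"

definition deriv_x ::
  "'d \<Rightarrow> (real \<times> (real ^ 'd) \<Rightarrow> 'b::real_normed_vector) \<Rightarrow> real \<times> (real ^ 'd) \<Rightarrow> 'b" where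
  "deriv_x l f p = frechet_derivative f (at p) (0, axis l 1)"

definition grad :: "(real ^ 'd \<Rightarrow> real) \<Rightarrow> real ^ 'd \<Rightarrow> real ^ 'd" where
  "grad f \<xi> = (\<chi> l. frechet_derivative f (at \<xi>) (axis l 1))"

subsection \<open>Strong well-posedness\<close>

definition L2 :: "(real ^ 'd \<Rightarrow> complex ^ 'n) set" where
  "L2 = {f. f \<in> borel_measurable lborel \<and> integrable lborel (\<lambda>x. (norm (f x))\<^sup>2)}"

definition L2_norm :: "(real ^ 'd \<Rightarrow> complex ^ 'n) \<Rightarrow> real" where
  "L2_norm f = sqrt (\<integral>x. (norm (f x))\<^sup>2 \<partial>lborel)"

definition continuous_into_L2 :: "(real \<Rightarrow> real ^ 'd \<Rightarrow> complex ^ 'n) \<Rightarrow> bool" where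
  "continuous_into_L2 U \<longleftrightarrow>
     (\<forall>t\<ge>0. U t \<in> L2 \<and> ((\<lambda>s. L2_norm (\<lambda>x. U s x - U t x)) \<longlongrightarrow> 0) (at t within {0..}))"

definition test_function :: "(real \<times> (real ^ 'd) \<Rightarrow> real) \<Rightarrow> bool" where
  "test_function \<psi> \<longleftrightarrow> smooth_on UNIV \<psi> \<and> compact (closure {p. \<psi> p \<noteq> 0}) \<and>
     closure {p. \<psi> p \<noteq> 0} \<subseteq> {0<..} \<times> UNIV"

text \<open>
  \<open>L U = 0\<close> on \<open>t > 0\<close> in the sense of distributions.  Real scalar test functions suffice for
  the system because the integral is vector valued.
\<close>

definition weak_solution ::
  "('d \<Rightarrow> complex ^ 'n ^ 'n) \<Rightarrow> (real \<Rightarrow> real ^ 'd \<Rightarrow> complex ^ 'n) \<Rightarrow> bool" where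
  "weak_solution A U \<longleftrightarrow> (\<forall>\<psi>. test_function \<psi> \<longrightarrow>
     (LBINT t:{0<..}. (\<integral>x. deriv_t \<psi> (t, x) *\<^sub>R U t x +
        (\<Sum>l\<in>UNIV. deriv_x l \<psi> (t, x) *\<^sub>R (A l *v U t x)) \<partial>lborel)) = 0)"

definition cauchy_solution ::
  "('d \<Rightarrow> complex ^ 'n ^ 'n) \<Rightarrow> (real ^ 'd \<Rightarrow> complex ^ 'n) \<Rightarrow>
   (real \<Rightarrow> real ^ 'd \<Rightarrow> complex ^ 'n) \<Rightarrow> bool" where
  "cauchy_solution A f U \<longleftrightarrow>
     continuous_into_L2 U \<and> weak_solution A U \<and> (AE x in lborel. U 0 x = f x)"

definition strongly_well_posed :: "('d::finite \<Rightarrow> complex ^ 'n ^ 'n) \<Rightarrow> bool" where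
  "strongly_well_posed A \<longleftrightarrow> (\<exists>K \<alpha>. \<forall>f\<in>L2.
     (\<exists>U. cauchy_solution A f U \<and>
        (\<forall>t\<ge>0. L2_norm (U t) \<le> K * exp (\<alpha> * t) * L2_norm (U 0))) \<and>
     (\<forall>U V. cauchy_solution A f U \<longrightarrow> cauchy_solution A f V \<longrightarrow>
        (\<forall>t\<ge>0. AE x in lborel. U t x = V t x)))"

subsection \<open>Characteristic variety\<close>

definition L_symbol :: "('d \<Rightarrow> complex ^ 'n ^ 'n) \<Rightarrow> real \<Rightarrow> real ^ 'd \<Rightarrow> complex ^ 'n ^ 'n" where
  "L_symbol A \<tau> \<xi> = mat (complex_of_real \<tau>) + (\<Sum>l\<in>UNIV. (\<xi> $ l) *\<^sub>R A l)"

definition char_variety :: "('d \<Rightarrow> complex ^ 'n ^ 'n) \<Rightarrow> (real \<times> (real ^ 'd)) set" where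
  "char_variety A = {(\<tau>, \<xi>). (\<tau>, \<xi>) \<noteq> 0 \<and> det (L_symbol A \<tau> \<xi>) = 0}"

definition conic :: "(real ^ 'd) set \<Rightarrow> bool" where
  "conic V \<longleftrightarrow> (\<forall>\<eta>\<in>V. \<forall>c>0. c *\<^sub>R \<eta> \<in> V)"

text \<open>Here \<open>\<tau>\<^sub>0\<close> is the number and \<open>\<tau>f\<close> the function that parametrizes the variety.\<close>

definition smooth_variety ::
  "('d \<Rightarrow> complex ^ 'n ^ 'n) \<Rightarrow> real \<Rightarrow> real ^ 'd \<Rightarrow> (real ^ 'd \<Rightarrow> real) \<Rightarrow> bool" where
  "smooth_variety A \<tau>\<^sub>0 \<xi>\<^sub>0 \<tau>f \<longleftrightarrow> \<xi>\<^sub>0 \<noteq> 0 \<and>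
     (\<exists>V W. open V \<and> conic V \<and> \<xi>\<^sub>0 \<in> V \<and> smooth_on V \<tau>f \<and>
        open W \<and> (\<tau>\<^sub>0, \<xi>\<^sub>0) \<in> W \<and> W \<subseteq> UNIV \<times> V \<and>
        (\<forall>(\<tau>, \<xi>)\<in>W. (\<tau>, \<xi>) \<in> char_variety A \<longleftrightarrow> \<tau> = \<tau>f \<xi>))"

definition group_velocity :: "(real ^ 'd \<Rightarrow> real) \<Rightarrow> real ^ 'd \<Rightarrow> real ^ 'd" where
  "group_velocity \<tau>f \<xi> = - grad \<tau>f \<xi>"

definition ray_segment ::
  "(real ^ 'd \<Rightarrow> real) \<Rightarrow> real ^ 'd \<Rightarrow> real ^ 'd \<Rightarrow> real \<Rightarrow> (real \<times> (real ^ 'd)) set" where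
  "ray_segment \<tau>f \<xi> x t\<^sub>0 = (\<lambda>t. (0, x) + t *\<^sub>R (1, group_velocity \<tau>f \<xi>)) ` {0..t\<^sub>0}"

subsection \<open>The split operator and its WKB solutions\<close>

definition split_op ::
  "('d \<Rightarrow> complex ^ 'n ^ 'n) \<Rightarrow> ('d \<Rightarrow> real \<Rightarrow> real) \<Rightarrow>
   (real \<times> (real ^ 'd) \<Rightarrow> complex ^ 'n ^ 'd) \<Rightarrow> real \<times> (real ^ 'd) \<Rightarrow> complex ^ 'n ^ 'd" where
  "split_op A \<sigma> U p = (\<chi> l.
     deriv_t (\<lambda>q. U q $ l) p + A l *v deriv_x l (\<lambda>q. \<Sum>j\<in>UNIV. U q $ j) p +
     \<sigma> l (snd p $ l) *\<^sub>R (U p $ l))"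

definition layer :: "('d \<Rightarrow> real \<Rightarrow> real) \<Rightarrow> (real ^ 'd) set" where
  "layer \<sigma> = {x. \<exists>l. \<sigma> l (x $ l) \<noteq> 0}"

definition beta ::
  "('d \<Rightarrow> real \<Rightarrow> real) \<Rightarrow> (real ^ 'd \<Rightarrow> real) \<Rightarrow> real ^ 'd \<Rightarrow> real ^ 'd \<Rightarrow> real" where
  "beta \<sigma> \<tau>f \<xi> x = (\<Sum>l\<in>UNIV. \<sigma> l (x $ l) * (\<xi> $ l) / \<tau>f \<xi> * (grad \<tau>f \<xi> $ l))"

text \<open>The first \<open>n\<close> terms of \<open>exp (i (t \<tau> + x \<cdot> \<xi>) / \<epsilon>) \<Sum>\<^sub>j \<epsilon>^j a\<^sub>j\<close>.\<close>

definition wkb_partial_sum ::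
  "real \<Rightarrow> real ^ 'd \<Rightarrow> (nat \<Rightarrow> real \<times> (real ^ 'd) \<Rightarrow> complex ^ 'n ^ 'd) \<Rightarrow>
   nat \<Rightarrow> real \<Rightarrow> real \<times> (real ^ 'd) \<Rightarrow> complex ^ 'n ^ 'd" where
  "wkb_partial_sum \<tau> \<xi> a n \<epsilon> p = (\<chi> l.
     exp (\<i> * complex_of_real ((fst p * \<tau> + snd p \<bullet> \<xi>) / \<epsilon>)) *s
       ((\<Sum>j<n. \<epsilon> ^ j *\<^sub>R a j p) $ l))"

text \<open>\<open>F \<epsilon> = O(\<epsilon>^n)\<close> as \<open>\<epsilon> \<rightarrow> 0+\<close>, uniformly on the compact subsets of \<open>\<Omega>\<close>.\<close>

definition locally_bigo ::
  "'p::topological_space set \<Rightarrow> nat \<Rightarrow> (real \<Rightarrow> 'p \<Rightarrow> 'b::real_normed_vector) \<Rightarrow> bool" where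
  "locally_bigo \<Omega> n F \<longleftrightarrow> (\<forall>K. compact K \<and> K \<subseteq> \<Omega> \<longrightarrow>
     (\<exists>C. \<forall>\<^sub>F \<epsilon> in at_right 0. \<forall>p\<in>K. norm (F \<epsilon> p) \<le> C * \<epsilon> ^ n))"

text \<open>
  The family \<open>U \<epsilon>\<close> solves the split system up to \<open>O(\<epsilon>^\<infinity>)\<close> and is asymptotic to the
  expansion.  As the operator has order one, the asymptotics are required for \<open>U \<epsilon>\<close> and for its
  derivatives \<open>\<epsilon> \<partial>\<close>, where the factor \<open>\<epsilon>\<close> is the scale of the oscillations, and \<open>C^1\<close>
  regularity is enough.  That the leading amplitude lies in the kernel of the symbol and obeys the
  transport equation is a consequence and not part of the definition.
\<close>

definition wkb_solution ::
  "(real \<times> (real ^ 'd)) set \<Rightarrow> ('d \<Rightarrow> complex ^ 'n ^ 'n) \<Rightarrow> ('d \<Rightarrow> real \<Rightarrow> real) \<Rightarrow>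
   real \<Rightarrow> real ^ 'd \<Rightarrow> (real \<Rightarrow> real \<times> (real ^ 'd) \<Rightarrow> complex ^ 'n ^ 'd) \<Rightarrow>
   (nat \<Rightarrow> real \<times> (real ^ 'd) \<Rightarrow> complex ^ 'n ^ 'd) \<Rightarrow> bool" where
  "wkb_solution \<Omega> A \<sigma> \<tau> \<xi> U a \<longleftrightarrow>
     (\<forall>j. Ck_on 1 \<Omega> (a j)) \<and> (\<forall>\<epsilon>>0. Ck_on 1 \<Omega> (U \<epsilon>)) \<and>
     (\<forall>n. locally_bigo \<Omega> n (\<lambda>\<epsilon> p. U \<epsilon> p - wkb_partial_sum \<tau> \<xi> a n \<epsilon> p)) \<and>
     (\<forall>n. \<forall>b\<in>Basis. locally_bigo \<Omega> n (\<lambda>\<epsilon> p.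
        \<epsilon> *\<^sub>R frechet_derivative (\<lambda>q. U \<epsilon> q - wkb_partial_sum \<tau> \<xi> a n \<epsilon> q) (at p) b)) \<and>
     (\<forall>n. locally_bigo \<Omega> n (\<lambda>\<epsilon>. split_op A \<sigma> (U \<epsilon>)))"

text \<open>
  The leading amplitude \<open>a\<^sub>0\<close> is larger at the end of the segment of the ray with velocity \<open>v\<close>
  than at its start, and the segment runs through the layer.
\<close>

definition grows_in_layer ::
  "('d \<Rightarrow> real \<Rightarrow> real) \<Rightarrow> real ^ 'd \<Rightarrow> real ^ 'd \<Rightarrow> real \<Rightarrow>
   (real \<times> (real ^ 'd) \<Rightarrow> complex ^ 'n ^ 'd) \<Rightarrow> bool" where
  "grows_in_layer \<sigma> v x t\<^sub>0 a\<^sub>0 \<longleftrightarrow>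
     norm (a\<^sub>0 (0, x)) < norm (a\<^sub>0 (t\<^sub>0, x + t\<^sub>0 *\<^sub>R v)) \<and>
     (\<exists>t\<in>{0..t\<^sub>0}. x + t *\<^sub>R v \<in> layer \<sigma>)"

end

theory Submission
  imports Defs "HOL-Computational_Algebra.Fundamental_Theorem_Algebra"
begin

text \<open>
  The solution with initial datum \<open>\<phi>(x) exp (i \<eta> \<cdot> x) r\<close>, \<open>\<phi>\<close> a bump, is paired with \<open>\<phi>(x) exp (- i \<eta> \<cdot> x)\<close>.
  The resulting amplitude solves \<open>w' = - i A(\<eta>) w\<close>, where \<open>A(\<eta>) = \<Sum>\<^sub>l \<eta>\<^sub>l A\<^sub>l\<close>, up to an error bounded independently
  of \<open>\<eta>\<close>, and its Laplace transform at \<open>\<zeta>\<close> inherits the energy estimate.  For \<open>\<eta> = s \<xi>\<close>, \<open>\<zeta> = s z\<close> and \<open>s \<rightarrow> \<infinity>\<close>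
  both the error and the exponential growth rate drop out by homogeneity.  This gives the Kreiss bound
  \<open>|Im \<mu>| |v| \<le> K |(A(\<xi>) - \<mu>) v|\<close> with \<open>K\<close> independent of \<open>\<xi>\<close>, hence real semisimple
  eigenvalues and uniformly bounded spectral projections.  These let a kernel vector of \<open>L\<^sub>1(\<tau>, \<xi>)\<close> be continued to nearby
  points of the smooth variety, so that \<open>\<partial>\<^sub>l\<tau> + A\<^sub>l\<close> maps the kernel of \<open>L\<^sub>1(\<tau>, \<xi>)\<close> into its range.
  Summing the order \<open>\<epsilon>\<^sup>0\<close> WKB equations over the \<open>d\<close> blocks and using that kernel and range meet only in \<open>0\<close>
  yields the transport equation, and along the ray it integrates to the factor \<open>exp (- \<integral> \<beta>)\<close>.
\<close>

subsection \<open>Smooth functions\<close>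

text \<open>A solution is only continuous in time with values in L2, and its equation is tested with
  real functions of compact support. No Fourier transform in x is therefore taken: a window of fixed
  size is kept, whose derivatives cost a bounded error, while each derivative of the oscillation
  contributes a factor of the size of the frequency. Well-posedness is used for L alone; nothing is
  known about the Cauchy problem of the split operator. The two are linked by the sum
  \<open>s\<close> of the blocks. As \<tau> \<noteq> 0, the equations of order 1/\<epsilon> express
  block l of the leading amplitude as -(\<xi>_l/\<tau>) A_l s, with \<open>s\<close> in the kernel
  of L_1. After summation over the blocks, the next amplitude enters the following equations only
  through the range of L_1. Both the space derivatives and the absorption terms then contain A_l
  applied to kernel vectors, and replacing A_l by -\<partial>_l\<tau> modulo that range produces the
  group velocity in the first case and \<beta> in the second. The smooth variety hypothesis says
  where the determinant vanishes but does not mention the size of the kernel at nearby points, hence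
  the quantitative continuation of kernel vectors.\<close>

lemma Ck_on_UNIV_Suc_D: "Ck_on (Suc k) UNIV f \<Longrightarrow> Ck_on k UNIV f"
proof (induction k arbitrary: f)
  case 0
  then show ?case
    by (auto intro!: continuous_at_imp_continuous_on differentiable_imp_continuous_within)
next
  case (Suc k)
  then show ?case by (metis Ck_on.simps(2))
qed

lemma Ck_on_UNIV_SucI:
  assumes "\<And>x. (f has_derivative f' x) (at x)" "\<And>b. b \<in> Basis \<Longrightarrow> Ck_on k UNIV (\<lambda>x. f' x b)"
  shows "Ck_on (Suc k) UNIV f"
proof -
  have "frechet_derivative f (at x) = f' x" for x
    using assms(1) frechet_derivative_at by metis
  then show ?thesis using assms by (auto simp: differentiable_def)
qed

lemma Ck_on_UNIV_SucE:
  assumes "Ck_on (Suc k) UNIV f"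
  obtains f' where "\<And>x. (f has_derivative f' x) (at x)" "\<And>b. b \<in> Basis \<Longrightarrow> Ck_on k UNIV (\<lambda>x. f' x b)"
proof (rule that)
  show "(f has_derivative frechet_derivative f (at x)) (at x)" for x
    using assms frechet_derivative_works by auto
qed (use assms in auto)

lemma Ck_on_const: "Ck_on k UNIV (\<lambda>x. c)"
proof (induction k arbitrary: c)
  case (Suc k)
  show ?case by (rule Ck_on_UNIV_SucI[where f' = "\<lambda>x h. 0"]) (use Suc in auto)
qed auto

lemma Ck_on_add:
  assumes "Ck_on k UNIV f" "Ck_on k UNIV g" shows "Ck_on k UNIV (\<lambda>x. f x + g x)"
  using assms
proof (induction k arbitrary: f g)
  case 0 then show ?case by (auto intro: continuous_intros)
next
  case (Suc k)
  from Suc.prems(1) obtain f' where f: "\<And>x. (f has_derivative f' x) (at x)"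
    "\<And>b. b \<in> Basis \<Longrightarrow> Ck_on k UNIV (\<lambda>x. f' x b)" by (rule Ck_on_UNIV_SucE) blast
  from Suc.prems(2) obtain g' where g: "\<And>x. (g has_derivative g' x) (at x)"
    "\<And>b. b \<in> Basis \<Longrightarrow> Ck_on k UNIV (\<lambda>x. g' x b)" by (rule Ck_on_UNIV_SucE) blast
  show ?case
    by (rule Ck_on_UNIV_SucI[where f' = "\<lambda>x h. f' x h + g' x h"])
       (intro has_derivative_add f g Suc.IH; assumption)+
qed

lemma Ck_on_sum: "(\<And>i. i \<in> I \<Longrightarrow> Ck_on k UNIV (f i)) \<Longrightarrow> Ck_on k UNIV (\<lambda>x. \<Sum>i\<in>I. f i x)"
  by (induction I rule: infinite_finite_induct) (auto intro: Ck_on_const Ck_on_add)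

lemma Ck_on_mult:
  fixes f g :: "'a::euclidean_space \<Rightarrow> real"
  assumes "Ck_on k UNIV f" "Ck_on k UNIV g" shows "Ck_on k UNIV (\<lambda>x. f x * g x)"
  using assms
proof (induction k arbitrary: f g)
  case 0 then show ?case by (auto intro: continuous_intros)
next
  case (Suc k)
  from Suc.prems(1) obtain f' where f: "\<And>x. (f has_derivative f' x) (at x)"
    "\<And>b. b \<in> Basis \<Longrightarrow> Ck_on k UNIV (\<lambda>x. f' x b)" by (rule Ck_on_UNIV_SucE) blast
  from Suc.prems(2) obtain g' where g: "\<And>x. (g has_derivative g' x) (at x)"
    "\<And>b. b \<in> Basis \<Longrightarrow> Ck_on k UNIV (\<lambda>x. g' x b)" by (rule Ck_on_UNIV_SucE) blast
  have "Ck_on k UNIV f" "Ck_on k UNIV g" using Suc.prems by (blast intro: Ck_on_UNIV_Suc_D)+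
  then show ?case
    by (intro Ck_on_UNIV_SucI[where f' = "\<lambda>x h. f x * g' x h + f' x h * g x"]
        has_derivative_mult f g Suc.IH Ck_on_add) assumption+
qed

lemma Ck_on_linear:
  assumes "bounded_linear f" shows "Ck_on k UNIV f"
proof (cases k)
  case 0
  then show ?thesis using assms by (simp add: linear_continuous_on)
next
  case (Suc j)
  show ?thesis unfolding Suc
    by (rule Ck_on_UNIV_SucI[where f' = "\<lambda>x h. f h"])
       (intro Ck_on_const bounded_linear_imp_has_derivative assms)+
qed

lemma Ck_on_compose_linear:
  fixes f :: "'b::euclidean_space \<Rightarrow> real" and L :: "'a::euclidean_space \<Rightarrow> 'b"
  assumes "bounded_linear L" "Ck_on k UNIV f" shows "Ck_on k UNIV (\<lambda>x. f (L x))"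
  using assms(2)
proof (induction k arbitrary: f)
  case 0
  then have "continuous_on (range L) f" by (auto intro: continuous_on_subset)
  then show ?case
    using continuous_on_compose[OF linear_continuous_on[OF assms(1), of UNIV]] by (simp add: o_def)
next
  case (Suc k)
  from Suc.prems(1) obtain f' where f: "\<And>x. (f has_derivative f' x) (at x)"
    "\<And>b. b \<in> Basis \<Longrightarrow> Ck_on k UNIV (\<lambda>x. f' x b)" by (rule Ck_on_UNIV_SucE) blast
  have lin: "linear (f' x)" for x using f(1) has_derivative_linear by blast
  \<comment> \<open>\<open>L b\<close> is in general no basis vector, whereas \<open>Ck_on\<close>
    controls derivatives in basis directions only; the expansion reduces the former to the
    latter.\<close>
  have *: "f' y h = (\<Sum>c\<in>Basis. (h \<bullet> c) * f' y c)" for y h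
  proof -
    have "f' y h = f' y (\<Sum>c\<in>Basis. (h \<bullet> c) *\<^sub>R c)" by (simp add: euclidean_representation)
    also have "\<dots> = (\<Sum>c\<in>Basis. (h \<bullet> c) * f' y c)"
      using lin by (simp add: linear_sum linear_cmul)
    finally show ?thesis .
  qed
  show ?case
  proof (rule Ck_on_UNIV_SucI[where f' = "\<lambda>x h. f' (L x) (L h)"])
    show "((\<lambda>x. f (L x)) has_derivative (\<lambda>h. f' (L x) (L h))) (at x)" for x
      by (rule has_derivative_compose[OF bounded_linear_imp_has_derivative[OF assms(1)] f(1)])
    show "Ck_on k UNIV (\<lambda>x. f' (L x) (L b))" for b
      unfolding *[of "L _" "L b"]
      by (intro Ck_on_sum Ck_on_mult Ck_on_const Suc.IH f)
  qed
qed

lemma Ck_on_compose: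
  fixes f :: "real \<Rightarrow> real" and g :: "'a::euclidean_space \<Rightarrow> real"
  assumes "Ck_on k UNIV g" "Ck_on k UNIV f" shows "Ck_on k UNIV (\<lambda>x. f (g x))"
  using assms
proof (induction k arbitrary: f)
  case 0
  then have "continuous_on (range g) f" by (auto intro: continuous_on_subset)
  then show ?case using 0 continuous_on_compose[of UNIV g f] by (simp add: o_def)
next
  case (Suc k)
  from Suc.prems(1) obtain g' where g: "\<And>x. (g has_derivative g' x) (at x)"
    "\<And>b. b \<in> Basis \<Longrightarrow> Ck_on k UNIV (\<lambda>x. g' x b)" by (rule Ck_on_UNIV_SucE) blast
  from Suc.prems(2) obtain f' where f: "\<And>x. (f has_derivative f' x) (at x)"
    "\<And>b. b \<in> Basis \<Longrightarrow> Ck_on k UNIV (\<lambda>x. f' x b)" by (rule Ck_on_UNIV_SucE) blast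
  have lin: "f' y h = h * f' y 1" for y h
  proof -
    have "f' y (h *\<^sub>R 1) = h *\<^sub>R f' y 1"
      by (rule linear_cmul[OF has_derivative_linear[OF f(1)]])
    then show ?thesis by simp
  qed
  show ?case
  proof (rule Ck_on_UNIV_SucI[where f' = "\<lambda>x h. f' (g x) (g' x h)"])
    show "((\<lambda>x. f (g x)) has_derivative (\<lambda>h. f' (g x) (g' x h))) (at x)" for x
      by (rule has_derivative_compose[OF g(1) f(1)])
    show "Ck_on k UNIV (\<lambda>x. f' (g x) (g' x b))" if "b \<in> Basis" for b
      unfolding lin[of "g _" "g' _ b"]
      by (rule Ck_on_mult[OF g(2)[OF that] Suc.IH[OF Ck_on_UNIV_Suc_D[OF Suc.prems(1)] f(2)]]) simp
  qed
qed

lemma Ck_on_real_SucI: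
  fixes f :: "real \<Rightarrow> real"
  assumes "\<And>x. (f has_real_derivative f' x) (at x)" "Ck_on k UNIV f'"
  shows "Ck_on (Suc k) UNIV f"
  by (rule Ck_on_UNIV_SucI[where f' = "\<lambda>x h. f' x * h"])
     (use assms in \<open>auto simp: has_field_derivative_def\<close>)

lemma Ck_on_sin_cos: "Ck_on k UNIV (sin :: real \<Rightarrow> real) \<and> Ck_on k UNIV (cos :: real \<Rightarrow> real)"
proof (induction k)
  case 0 show ?case by (auto intro: continuous_intros)
next
  case (Suc k)
  have "Ck_on k UNIV (\<lambda>x::real. - sin x)"
    using Ck_on_mult[OF Ck_on_const[of k "-1"] conjunct1[OF Suc]] by simp
  then have "Ck_on (Suc k) UNIV (cos :: real \<Rightarrow> real)"
    by (rule Ck_on_real_SucI[rotated]) (auto intro!: derivative_eq_intros)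
  moreover have "Ck_on (Suc k) UNIV (sin :: real \<Rightarrow> real)"
    by (rule Ck_on_real_SucI[OF _ conjunct2[OF Suc]]) (auto intro!: derivative_eq_intros)
  ultimately show ?case by blast
qed

section \<open>Flat functions, a smooth step and a smooth bump\<close>

definition flat :: "real poly \<Rightarrow> real \<Rightarrow> real" where
  "flat p x = (if x > 0 then poly p (1 / x) * exp (- (1 / x)) else 0)"

lemma tendsto_poly_times_exp_minus: "((\<lambda>y::real. poly p y * exp (- y)) \<longlongrightarrow> 0) at_top"
proof -
  have "((\<lambda>y::real. coeff p i * y ^ i * exp (- y)) \<longlongrightarrow> 0) at_top" for i
    using tendsto_mult[OF tendsto_const[of "coeff p i" at_top] tendsto_power_div_exp_0[of i]]
    by (simp add: exp_minus divide_simps)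
  then have "((\<lambda>y::real. \<Sum>i\<le>degree p. coeff p i * y ^ i * exp (- y)) \<longlongrightarrow> 0) at_top"
    by (intro tendsto_null_sum) auto
  then show ?thesis by (simp add: poly_altdef sum_distrib_right)
qed

lemma tendsto_flat: "((\<lambda>x. flat p x) \<longlongrightarrow> 0) (at_right 0)"
proof -
  have "((\<lambda>x. poly p (inverse x) * exp (- inverse x)) \<longlongrightarrow> 0) (at_right (0::real))"
    by (rule filterlim_compose[OF tendsto_poly_times_exp_minus filterlim_inverse_at_top_right])
  then show ?thesis
    by (rule Lim_transform_eventually)
       (auto simp: eventually_at_right_less flat_def divide_simps eventually_at_filter)
qed

text \<open>With y = 1/x, differentiation in x acts on p(y) exp(-y) as y^2 (p - p'), which is the
  polynomial factor seen here. The family is thus closed under differentiation, and a single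
  induction over all polynomials gives smoothness.\<close>

lemma DERIV_flat:
  "(flat p has_real_derivative flat ([:0, 0, 1:] * (p - pderiv p)) x) (at x)"
proof -
  consider "x > 0" | "x < 0" | "x = 0" by linarith
  then show ?thesis
  proof cases
    case 1
    have "((\<lambda>x. poly p (1 / x) * exp (- (1 / x))) has_real_derivative
        flat ([:0, 0, 1:] * (p - pderiv p)) x) (at x)" (is ?D)
      using 1 by (auto intro!: derivative_eq_intros simp: flat_def field_simps power2_eq_square)
    moreover have "\<forall>\<^sub>F y in nhds x. (0::real) < y"
      using eventually_nhds_in_open[of "{0<..}" x] 1 by simp
    then have "\<forall>\<^sub>F y in nhds x. poly p (1 / y) * exp (- (1 / y)) = flat p y"
      by eventually_elim (simp add: flat_def)
    from DERIV_cong_ev[OF refl this refl] have "?D \<longleftrightarrow> ?thesis" .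
    ultimately show ?thesis by (rule rev_iffD1)
  next
    case 2
    have "\<forall>\<^sub>F y in nhds x. y < 0"
      using eventually_nhds_in_open[of "{..<0}" x] 2 by simp
    then have "\<forall>\<^sub>F y in nhds x. 0 = flat p y"
      by eventually_elim (simp add: flat_def)
    then show ?thesis
      using DERIV_cong_ev[of x x "\<lambda>_. 0" "flat p" 0 0] 2 by (simp add: flat_def)
  next
    case 3
    \<comment> \<open>Division by y > 0 multiplies the polynomial by its variable, so the right
      difference quotient at 0 is again a function of the family and tends to 0.\<close>
    have "((\<lambda>y. flat ([:0,1:] * p) y) \<longlongrightarrow> 0) (at_right 0)" by (rule tendsto_flat)
    then have r: "((\<lambda>y. (flat p y - flat p 0) / (y - 0)) \<longlongrightarrow> 0) (at_right 0)"
      by (rule Lim_transform_eventually) (auto simp: flat_def eventually_at_filter)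
    have l: "((\<lambda>y. (flat p y - flat p 0) / (y - 0)) \<longlongrightarrow> 0) (at_left 0)"
      by (rule Lim_transform_eventually[OF tendsto_const])
        (auto simp: flat_def eventually_at_filter)
    from l r have "((\<lambda>y. (flat p y - flat p 0) / (y - 0)) \<longlongrightarrow> 0) (at 0)"
      by (simp add: filterlim_at_split)
    then show ?thesis using 3 by (simp add: has_field_derivative_iff flat_def)
  qed
qed

lemma Ck_on_flat: "Ck_on k UNIV (flat p)"
proof (induction k arbitrary: p)
  case 0
  show ?case using DERIV_isCont[OF DERIV_flat] by (simp add: continuous_at_imp_continuous_on)
next
  case (Suc k)
  show ?case by (rule Ck_on_real_SucI[OF DERIV_flat Suc])
qed

text \<open>\<open>H\<close> is the normalized primitive of a bump supported in the unit interval.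
  Rescaled, \<open>H\<close> approximates the indicator of a half line and \<open>b\<close> is an
  approximate identity; both roles occur when the weak equation in time is integrated.\<close>

lemma smooth_step_exists:
  obtains H b :: "real \<Rightarrow> real" where
    "\<And>k. Ck_on k UNIV H" "\<And>x. (H has_real_derivative b x) (at x)" "continuous_on UNIV b"
    "\<And>x. x \<notin> {0..1} \<Longrightarrow> b x = 0" "\<And>x. x \<le> 0 \<Longrightarrow> H x = 0" "\<And>x. x \<ge> 1 \<Longrightarrow> H x = 1"
    "\<And>x. 0 \<le> H x" "\<And>x. H x \<le> 1" "\<And>x. 0 \<le> b x"
proof -
  define b where "b x = flat 1 x * flat 1 (1 - x)" for x
  have Ckb: "Ck_on k UNIV b" for k
  proof -
    have "Ck_on k UNIV (\<lambda>x::real. 1 + (- x))"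
      by (intro Ck_on_add Ck_on_const Ck_on_linear) (simp add: bounded_linear_minus bounded_linear_ident)
    then have "Ck_on k UNIV (\<lambda>x::real. flat 1 (1 + (- x)))"
      by (rule Ck_on_compose[OF _ Ck_on_flat])
    then have "Ck_on k UNIV (\<lambda>x. flat 1 x * flat 1 (1 + (- x)))"
      by (rule Ck_on_mult[OF Ck_on_flat])
    then show ?thesis by (simp add: b_def[abs_def])
  qed
  have b0: "b x \<ge> 0" for x by (simp add: b_def flat_def)
  have b_out: "b x = 0" if "x \<notin> {0<..<1}" for x using that by (auto simp: b_def flat_def)
  have b_in: "b x > 0" if "x \<in> {0<..<1}" for x using that by (auto simp: b_def flat_def)
  have cont: "continuous_on UNIV b" using Ckb[of 0] by simp
  then have isc: "isCont b x" for x by (simp add: continuous_on_eq_continuous_at)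
  have "\<exists>F. \<forall>x::real. -\<infinity> < ereal x \<longrightarrow> ereal x < \<infinity> \<longrightarrow> (F has_vector_derivative b x) (at x)"
    by (rule einterval_antiderivative) (auto simp: isc)
  then obtain F where "\<And>x. (F has_vector_derivative b x) (at x)" by auto
  then have F: "(F has_real_derivative b x) (at x)" for x
    by (simp add: has_real_derivative_iff_has_vector_derivative)
  have mono: "F x \<le> F y" if "x \<le> y" for x y
    using that F b0 DERIV_nonneg_imp_nondecreasing by blast
  have left: "F x = F 0" if "x \<le> 0" for x
  proof (cases "x = 0")
    case False
    have "\<exists>z>x. z < 0 \<and> F 0 - F x = (0 - x) * b z" 
      by (rule MVT2) (use False that F in auto)
    then show ?thesis using b_out by auto
  qed auto
  have right: "F x = F 1" if "x \<ge> 1" for x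
  proof (cases "x = 1")
    case False
    have "\<exists>z>1. z < x \<and> F x - F 1 = (x - 1) * b z" 
      by (rule MVT2) (use False that F in auto)
    then show ?thesis using b_out by auto
  qed auto
  have "\<exists>z>0. z < 1 \<and> F 1 - F 0 = (1 - 0) * b z" 
    by (rule MVT2) (use F in auto)
  then have pos: "F 1 - F 0 > 0" using b_in by (metis greaterThanLessThan_iff mult_1 diff_zero)
  define c where "c = F 1 - F 0"
  define H where "H x = (F x - F 0) / c" for x
  have cpos: "c > 0" using pos by (simp add: c_def)
  have DH: "(H has_real_derivative (1 / c) * b x) (at x)" for x
    unfolding H_def using cpos by (auto intro!: derivative_eq_intros F)
  show ?thesis
  proof (rule that[of H "\<lambda>x. (1 / c) * b x"])
    show "Ck_on k UNIV H" for k
    proof -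
      have "Ck_on (Suc k) UNIV H"
        by (rule Ck_on_real_SucI[OF DH Ck_on_mult[OF Ck_on_const Ckb]])
      then show ?thesis by (rule Ck_on_UNIV_Suc_D)
    qed
    show "H x = 0" if "x \<le> 0" for x using left[OF that] by (simp add: H_def)
    show "H x = 1" if "x \<ge> 1" for x using right[OF that] cpos by (simp add: H_def c_def)
    show "0 \<le> H x" for x
      using mono[of 0 x] left[of x] cpos by (cases "x \<le> 0") (auto simp: H_def)
    show "H x \<le> 1" for x
      using mono[of x 1] right[of x] cpos by (cases "x \<le> 1") (auto simp: H_def c_def)
  qed (use DH b0 b_out cont cpos in \<open>auto intro!: continuous_intros\<close>)
qed

text \<open>The window of the wave packets. Positivity at the origin ensures a nonzero L2 norm, by
  which the final estimate is divided.\<close>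

lemma smooth_bump_exists:
  obtains \<phi> :: "'a::euclidean_space \<Rightarrow> real" where
    "\<And>k. Ck_on k UNIV \<phi>" "\<And>x. x \<notin> cball 0 1 \<Longrightarrow> \<phi> x = 0" "\<phi> 0 > 0"
proof -
  define \<phi> :: "'a \<Rightarrow> real" where "\<phi> x = flat 1 (1 + (-1) * (\<Sum>b\<in>Basis. (x \<bullet> b) * (x \<bullet> b)))" for x
  have eq: "\<phi> x = flat 1 (1 - x \<bullet> x)" for x
    by (simp add: \<phi>_def euclidean_inner[of x x])
  show ?thesis
  proof (rule that[of \<phi>])
    show "Ck_on k UNIV \<phi>" for k
      unfolding \<phi>_def
      by (intro Ck_on_compose[OF _ Ck_on_flat] Ck_on_add Ck_on_const Ck_on_sum Ck_on_mult Ck_on_linear bounded_linear_inner_left)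
    show "\<phi> x = 0" if "x \<notin> cball 0 1" for x
    proof -
      have "norm x > 1" using that by auto
      then have "(norm x)\<^sup>2 > 1" by (simp add: one_less_power)
      then show ?thesis by (simp add: eq flat_def power2_norm_eq_inner)
    qed
    show "\<phi> 0 > 0" by (simp add: eq flat_def)
  qed
qed

subsection \<open>Weak solutions paired with weights\<close>

lemma Cauchy_Schwarz_integral:
  fixes u v :: "'a \<Rightarrow> real"
  assumes [measurable]: "u \<in> borel_measurable M" "v \<in> borel_measurable M"
    and u: "integrable M (\<lambda>x. (u x)\<^sup>2)" and v: "integrable M (\<lambda>x. (v x)\<^sup>2)"
  shows "integrable M (\<lambda>x. u x * v x)"
    and "(\<integral>x. \<bar>u x * v x\<bar> \<partial>M) \<le> sqrt (\<integral>x. (u x)\<^sup>2 \<partial>M) * sqrt (\<integral>x. (v x)\<^sup>2 \<partial>M)"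
proof -
  show uv: "integrable M (\<lambda>x. u x * v x)"
  proof (rule Bochner_Integration.integrable_bound)
    show "integrable M (\<lambda>x. (u x)\<^sup>2 + (v x)\<^sup>2)" using u v by simp
    have "\<bar>u x * v x\<bar> \<le> (u x)\<^sup>2 + (v x)\<^sup>2" for x
    proof -
      have "0 \<le> (\<bar>u x\<bar> - \<bar>v x\<bar>)\<^sup>2" by simp
      then have "2 * \<bar>u x * v x\<bar> \<le> (u x)\<^sup>2 + (v x)\<^sup>2"
        by (simp add: power2_diff abs_mult)
      then show ?thesis by linarith
    qed
    then show "AE x in M. norm (u x * v x) \<le> norm ((u x)\<^sup>2 + (v x)\<^sup>2)" by simp
  qed measurable
  have "(\<integral>\<^sup>+x. ennreal \<bar>u x\<bar> * ennreal \<bar>v x\<bar> \<partial>M)\<^sup>2 \<le>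
      (\<integral>\<^sup>+x. (ennreal \<bar>u x\<bar>)\<^sup>2 \<partial>M) * (\<integral>\<^sup>+x. (ennreal \<bar>v x\<bar>)\<^sup>2 \<partial>M)"
    by (rule Cauchy_Schwarz_nn_integral) measurable
  also have "(\<integral>\<^sup>+x. (ennreal \<bar>u x\<bar>)\<^sup>2 \<partial>M) = ennreal (\<integral>x. (u x)\<^sup>2 \<partial>M)"
    using nn_integral_eq_integral[OF u] by (simp add: ennreal_power)
  also have "(\<integral>\<^sup>+x. (ennreal \<bar>v x\<bar>)\<^sup>2 \<partial>M) = ennreal (\<integral>x. (v x)\<^sup>2 \<partial>M)"
    using nn_integral_eq_integral[OF v] by (simp add: ennreal_power)
  also have "(\<integral>\<^sup>+x. ennreal \<bar>u x\<bar> * ennreal \<bar>v x\<bar> \<partial>M) = ennreal (\<integral>x. \<bar>u x * v x\<bar> \<partial>M)"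
    using nn_integral_eq_integral[OF integrable_abs[OF uv]] by (simp add: abs_mult ennreal_mult)
  finally have "ennreal ((\<integral>x. \<bar>u x * v x\<bar> \<partial>M)\<^sup>2) \<le> ennreal ((\<integral>x. (u x)\<^sup>2 \<partial>M) * (\<integral>x. (v x)\<^sup>2 \<partial>M))"
    by (subst ennreal_mult'') (simp_all add: ennreal_power)
  then have "(\<integral>x. \<bar>u x * v x\<bar> \<partial>M)\<^sup>2 \<le> (\<integral>x. (u x)\<^sup>2 \<partial>M) * (\<integral>x. (v x)\<^sup>2 \<partial>M)"
    by (subst (asm) ennreal_le_iff) simp_all
  then show "(\<integral>x. \<bar>u x * v x\<bar> \<partial>M) \<le> sqrt (\<integral>x. (u x)\<^sup>2 \<partial>M) * sqrt (\<integral>x. (v x)\<^sup>2 \<partial>M)"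
    unfolding real_sqrt_mult[symmetric] by (rule real_le_rsqrt)
qed

text \<open>This class contains the window and is stable under multiplication by cosines and sines
  and, for smooth members, under partial derivatives. Its members are square integrable, so they
  pair with every L2 function.\<close>

definition weight :: "('a::euclidean_space \<Rightarrow> real) \<Rightarrow> bool" where
  "weight \<rho> \<longleftrightarrow> continuous_on UNIV \<rho> \<and> (\<forall>x. x \<notin> cball 0 1 \<longrightarrow> \<rho> x = 0)"

definition pairing :: "(real ^ 'd \<Rightarrow> real) \<Rightarrow> (real ^ 'd \<Rightarrow> complex ^ 'n) \<Rightarrow> complex ^ 'n" where
  "pairing \<rho> f = (\<integral>x. \<rho> x *\<^sub>R f x \<partial>lborel)"

lemma integrable_continuous_unit_ball:
  fixes f :: "'a::euclidean_space \<Rightarrow> 'b::{banach, second_countable_topology}"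
  assumes "continuous_on UNIV f" "\<And>x. x \<notin> cball 0 1 \<Longrightarrow> f x = 0"
  shows "integrable lborel f"
proof -
  have "integrable lborel (\<lambda>x. indicator (cball 0 1) x *\<^sub>R f x)"
    using assms(1) by (intro borel_integrable_compact) (auto intro: continuous_on_subset)
  moreover have "(\<lambda>x. indicator (cball 0 1) x *\<^sub>R f x) = f"
    using assms(2) by (fastforce simp: indicator_def)
  ultimately show ?thesis by simp
qed

lemma weight_square_integrable: "weight \<rho> \<Longrightarrow> integrable lborel (\<lambda>x. (\<rho> x)\<^sup>2)"
  unfolding weight_def by (rule integrable_continuous_unit_ball) (auto intro: continuous_intros)

lemma weight_measurable: "weight \<rho> \<Longrightarrow> \<rho> \<in> borel_measurable lborel"
  by (simp add: weight_def borel_measurable_continuous_onI)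

lemma weight_mult: "weight \<rho> \<Longrightarrow> continuous_on UNIV g \<Longrightarrow> weight (\<lambda>x. \<rho> x * g x)"
  by (auto simp: weight_def intro: continuous_intros)

lemma pairing_bound:
  assumes "weight \<rho>" "f \<in> L2"
  shows "integrable lborel (\<lambda>x. \<rho> x *\<^sub>R f x)"
    and "norm (pairing \<rho> f) \<le> sqrt (\<integral>x. (\<rho> x)\<^sup>2 \<partial>lborel) * L2_norm f"
proof -
  have [measurable]: "\<rho> \<in> borel_measurable lborel" "f \<in> borel_measurable lborel"
    using assms weight_measurable by (auto simp: L2_def)
  have f: "integrable lborel (\<lambda>x. (norm (f x))\<^sup>2)" using assms by (simp add: L2_def)
  note CS = Cauchy_Schwarz_integral[OF _ _ weight_square_integrable[OF assms(1)] f]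
  have 1: "integrable lborel (\<lambda>x. \<rho> x * norm (f x))" by (rule CS) measurable
  have 2: "(\<integral>x. \<bar>\<rho> x * norm (f x)\<bar> \<partial>lborel) \<le> sqrt (\<integral>x. (\<rho> x)\<^sup>2 \<partial>lborel) * L2_norm f"
    unfolding L2_norm_def by (rule CS) measurable
  show "integrable lborel (\<lambda>x. \<rho> x *\<^sub>R f x)"
    by (rule Bochner_Integration.integrable_bound[OF 1]) (auto simp: abs_mult)
  have "norm (pairing \<rho> f) \<le> (\<integral>x. norm (\<rho> x *\<^sub>R f x) \<partial>lborel)"
    unfolding pairing_def by (rule integral_norm_bound)
  with 2 show "norm (pairing \<rho> f) \<le> sqrt (\<integral>x. (\<rho> x)\<^sup>2 \<partial>lborel) * L2_norm f"
    by (simp add: abs_mult)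
qed

lemma L2_diff:
  assumes "f \<in> L2" "g \<in> L2" shows "(\<lambda>x. f x - g x) \<in> L2"
proof -
  have [measurable]: "f \<in> borel_measurable lborel" "g \<in> borel_measurable lborel"
    using assms by (auto simp: L2_def)
  have "integrable lborel (\<lambda>x. (norm (f x - g x))\<^sup>2)"
  proof (rule Bochner_Integration.integrable_bound)
    show "integrable lborel (\<lambda>x. 2 * (norm (f x))\<^sup>2 + 2 * (norm (g x))\<^sup>2)"
      using assms by (auto simp: L2_def)
    have "(norm (f x - g x))\<^sup>2 \<le> 2 * (norm (f x))\<^sup>2 + 2 * (norm (g x))\<^sup>2" for x
    proof -
      have "(norm (f x - g x))\<^sup>2 \<le> (norm (f x) + norm (g x))\<^sup>2"
        by (intro power_mono norm_triangle_ineq4) simp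
      also have "\<dots> \<le> 2 * (norm (f x))\<^sup>2 + 2 * (norm (g x))\<^sup>2"
        using zero_le_power2[of "norm (f x) - norm (g x)"]
        by (simp add: power2_sum power2_diff)
      finally show ?thesis .
    qed
    then show "AE x in lborel. norm ((norm (f x - g x))\<^sup>2) \<le> norm (2 * (norm (f x))\<^sup>2 + 2 * (norm (g x))\<^sup>2)"
      by simp
  qed measurable
  then show ?thesis by (simp add: L2_def)
qed

lemma pairing_diff:
  assumes "weight \<rho>" "f \<in> L2" "g \<in> L2"
  shows "pairing \<rho> (\<lambda>x. f x - g x) = pairing \<rho> f - pairing \<rho> g"
  using pairing_bound(1)[OF assms(1,2)] pairing_bound(1)[OF assms(1,3)]
  by (simp add: pairing_def scaleR_diff_right)

lemma continuous_on_pairing: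
  assumes "weight \<rho>" "continuous_into_L2 U"
  shows "continuous_on {0..} (\<lambda>t. pairing \<rho> (U t))"
  unfolding continuous_on_def
proof
  fix t :: real assume t: "t \<in> {0..}"
  have U: "U s \<in> L2" if "s \<ge> 0" for s
    using assms(2) that unfolding continuous_into_L2_def by blast
  have lim: "((\<lambda>s. L2_norm (\<lambda>x. U s x - U t x)) \<longlongrightarrow> 0) (at t within {0..})"
    using assms(2) t unfolding continuous_into_L2_def by auto
  have "((\<lambda>s. pairing \<rho> (U s) - pairing \<rho> (U t)) \<longlongrightarrow> 0) (at t within {0..})"
  proof (rule Lim_null_comparison)
    show "\<forall>\<^sub>F s in at t within {0..}. norm (pairing \<rho> (U s) - pairing \<rho> (U t)) \<le>
        sqrt (\<integral>x. (\<rho> x)\<^sup>2 \<partial>lborel) * L2_norm (\<lambda>x. U s x - U t x)"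
      using t by (auto simp: eventually_at_filter pairing_diff[OF assms(1) U U, symmetric] 
          intro!: pairing_bound(2) assms L2_diff U always_eventually)
    show "((\<lambda>s. sqrt (\<integral>x. (\<rho> x)\<^sup>2 \<partial>lborel) * L2_norm (\<lambda>x. U s x - U t x)) \<longlongrightarrow> 0) (at t within {0..})"
      using tendsto_mult_right_zero[OF lim] .
  qed
  then show "((\<lambda>t. pairing \<rho> (U t)) \<longlongrightarrow> pairing \<rho> (U t)) (at t within {0..})"
    by (simp add: LIM_zero_iff)
qed

section \<open>The weak equation tested with products of a time factor and a space factor\<close>

definition partial_deriv :: "'d \<Rightarrow> (real ^ 'd \<Rightarrow> real) \<Rightarrow> real ^ 'd \<Rightarrow> real" where
  "partial_deriv l \<rho> x = frechet_derivative \<rho> (at x) (axis l 1)"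

lemma frechet_derivative_zero_outside:
  assumes "\<And>x. x \<notin> S \<Longrightarrow> f x = 0" "closed S" "x \<notin> S"
  shows "frechet_derivative f (at x) = (\<lambda>_. 0)"
proof -
  have "((\<lambda>_. 0) has_derivative (\<lambda>_. 0)) (at x)" by simp
  then have "(f has_derivative (\<lambda>_. 0)) (at x)"
    by (rule has_derivative_transform_within_open[where s = "- S"]) (use assms in auto)
  then show ?thesis by (metis frechet_derivative_at)
qed

lemma weight_partial_deriv:
  assumes "\<And>k. Ck_on k UNIV \<rho>" "weight \<rho>"
  shows "weight (partial_deriv l \<rho>)"
proof -
  have "continuous_on UNIV (\<lambda>x. frechet_derivative \<rho> (at x) (axis l 1))"
    using assms(1)[of "Suc 0"] by (auto simp: axis_in_Basis_iff)
  then show ?thesis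
    using frechet_derivative_zero_outside[of "cball 0 1" \<rho>] assms(2)
    by (auto simp: weight_def partial_deriv_def[abs_def])
qed

lemma test_function_product:
  fixes \<rho> :: "real ^ 'd \<Rightarrow> real"
  assumes "\<And>k. Ck_on k UNIV \<theta>" "\<And>t. t \<notin> {a..b} \<Longrightarrow> \<theta> t = 0" "0 < a"
    and "\<And>k. Ck_on k UNIV \<rho>" "weight \<rho>"
  shows "test_function (\<lambda>p. \<theta> (fst p) * \<rho> (snd p))"
proof -
  have "smooth_on UNIV (\<lambda>p. \<theta> (fst p) * \<rho> (snd p))"
    unfolding smooth_on_def
    by (intro allI Ck_on_mult Ck_on_compose_linear[OF bounded_linear_fst assms(1)]
        Ck_on_compose_linear[OF bounded_linear_snd assms(4)])
  moreover have sub: "{p. \<theta> (fst p) * \<rho> (snd p) \<noteq> 0} \<subseteq> {a..b} \<times> cball 0 1"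
    using assms(2,5) by (auto simp: weight_def)
  have "compact ({a..b} \<times> cball (0 :: real ^ 'd) 1)" by (intro compact_Times) auto
  then have cl: "closure {p. \<theta> (fst p) * \<rho> (snd p) \<noteq> 0} \<subseteq> {a..b} \<times> cball 0 1"
    using sub by (simp add: closure_minimal compact_imp_closed)
  then have "compact (closure {p. \<theta> (fst p) * \<rho> (snd p) \<noteq> 0})"
    using bounded_subset[OF compact_imp_bounded[OF \<open>compact ({a..b} \<times> cball 0 1)\<close>] sub] by simp
  moreover have "{a..b} \<times> cball 0 1 \<subseteq> {0<..} \<times> (UNIV :: (real ^ 'd) set)" using assms(3) by auto
  ultimately show ?thesis using cl unfolding test_function_def by blast
qed

lemma deriv_product:
  fixes \<rho> :: "real ^ 'd \<Rightarrow> real"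
  assumes "\<And>t. (\<theta> has_real_derivative \<theta>' t) (at t)" "\<And>k. Ck_on k UNIV \<rho>"
  shows "deriv_t (\<lambda>p. \<theta> (fst p) * \<rho> (snd p)) (t, x) = \<theta>' t * \<rho> x"
    and "deriv_x l (\<lambda>p. \<theta> (fst p) * \<rho> (snd p)) (t, x) = \<theta> t * partial_deriv l \<rho> x"
proof -
  have "\<rho> differentiable at x" using assms(2)[of "Suc 0"] by auto
  then have \<rho>: "(\<rho> has_derivative frechet_derivative \<rho> (at x)) (at (snd (t, x)))"
    by (simp add: frechet_derivative_works)
  have \<theta>: "(\<theta> has_derivative (\<lambda>h. \<theta>' t * h)) (at (fst (t, x)))"
    using assms(1) by (simp add: has_field_derivative_def)
  have "((\<lambda>p. \<rho> (snd p)) has_derivative (\<lambda>h. frechet_derivative \<rho> (at x) (snd h))) (at (t, x))"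
    by (rule has_derivative_compose[where g = \<rho>, OF has_derivative_snd[OF has_derivative_ident] \<rho>])
  moreover have "((\<lambda>p. \<theta> (fst p)) has_derivative (\<lambda>h. \<theta>' t * fst h)) (at (t, x))"
    by (rule has_derivative_compose[where g = \<theta>, OF has_derivative_fst[OF has_derivative_ident] \<theta>])
  ultimately have "((\<lambda>p. \<theta> (fst p) * \<rho> (snd p)) has_derivative
      (\<lambda>h. \<theta> (fst (t, x)) * frechet_derivative \<rho> (at x) (snd h) + \<theta>' t * fst h * \<rho> (snd (t, x)))) (at (t, x))"
    by (intro has_derivative_mult)
  from frechet_derivative_at[OF this]
  have eq: "frechet_derivative (\<lambda>p. \<theta> (fst p) * \<rho> (snd p)) (at (t, x)) =
      (\<lambda>h. \<theta> t * frechet_derivative \<rho> (at x) (snd h) + \<theta>' t * fst h * \<rho> x)"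
    by simp
  have "linear (frechet_derivative \<rho> (at x))" using \<rho> has_derivative_linear by blast
  then show "deriv_t (\<lambda>p. \<theta> (fst p) * \<rho> (snd p)) (t, x) = \<theta>' t * \<rho> x"
    by (simp add: deriv_t_def eq linear_0)
  show "deriv_x l (\<lambda>p. \<theta> (fst p) * \<rho> (snd p)) (t, x) = \<theta> t * partial_deriv l \<rho> x"
    by (simp add: deriv_x_def eq partial_deriv_def)
qed

lemma bounded_linear_matrix_vector_complex: "bounded_linear ((*v) (B :: complex ^ 'n ^ 'm))"
  by (rule linear_conv_bounded_linear[THEN iffD1], rule linearI)
     (auto simp: matrix_vector_mult_def vec_eq_iff scaleR_sum_right distrib_left sum.distrib)

text \<open>With w the pairing against \<rho> and y the sum of the \<open>A l\<close> applied to
  pairings against the derivatives of \<rho>, this is the weak form of w' = y: both integrations by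
  parts are already absorbed in the distributional formulation, so their minus signs cancel.\<close>

lemma weak_solution_product:
  fixes \<rho> :: "real ^ 'd \<Rightarrow> real" and A :: "'d::finite \<Rightarrow> complex ^ 'n ^ 'n"
  assumes "weak_solution A U" "continuous_into_L2 U"
    and "\<And>k. Ck_on k UNIV \<theta>" "\<And>t. t \<notin> {a..b} \<Longrightarrow> \<theta> t = 0" "0 < a"
    and "\<And>t. (\<theta> has_real_derivative \<theta>' t) (at t)"
    and \<rho>: "\<And>k. Ck_on k UNIV \<rho>" "weight \<rho>"
  shows "(LBINT t:{0<..}. \<theta>' t *\<^sub>R pairing \<rho> (U t) +
     \<theta> t *\<^sub>R (\<Sum>l\<in>UNIV. A l *v pairing (partial_deriv l \<rho>) (U t))) = 0"
proof -
  let ?\<psi> = "\<lambda>p. \<theta> (fst p) * \<rho> (snd p)"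
  have *: "(\<integral>x. deriv_t ?\<psi> (t, x) *\<^sub>R U t x + (\<Sum>l\<in>UNIV. deriv_x l ?\<psi> (t, x) *\<^sub>R (A l *v U t x)) \<partial>lborel) =
    \<theta>' t *\<^sub>R pairing \<rho> (U t) + \<theta> t *\<^sub>R (\<Sum>l\<in>UNIV. A l *v pairing (partial_deriv l \<rho>) (U t))"
    if "t > 0" for t
  proof -
    have U: "U t \<in> L2" using assms(2) that by (simp add: continuous_into_L2_def)
    note int = pairing_bound(1)[OF \<rho>(2) U] pairing_bound(1)[OF weight_partial_deriv[OF \<rho>] U]
    have A: "A l *v (r *\<^sub>R y) = r *\<^sub>R (A l *v y)" for l r y
      using bounded_linear_matrix_vector_complex[of "A l"] linear_cmul bounded_linear.linear by blast
    have i2: "integrable lborel (\<lambda>x. partial_deriv l \<rho> x *\<^sub>R (A l *v U t x))" for l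
      using integrable_bounded_linear[OF bounded_linear_matrix_vector_complex[of "A l"] int(2)[of l]]
      by (simp add: A)
    have e2: "(\<integral>x. partial_deriv l \<rho> x *\<^sub>R (A l *v U t x) \<partial>lborel) = A l *v pairing (partial_deriv l \<rho>) (U t)" for l
      using integral_bounded_linear[OF bounded_linear_matrix_vector_complex[of "A l"] int(2)[of l]]
      by (simp add: A pairing_def)
    have "(\<integral>x. deriv_t ?\<psi> (t, x) *\<^sub>R U t x + (\<Sum>l\<in>UNIV. deriv_x l ?\<psi> (t, x) *\<^sub>R (A l *v U t x)) \<partial>lborel) =
      (\<integral>x. \<theta>' t *\<^sub>R (\<rho> x *\<^sub>R U t x) + \<theta> t *\<^sub>R (\<Sum>l\<in>UNIV. partial_deriv l \<rho> x *\<^sub>R (A l *v U t x)) \<partial>lborel)"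
      by (simp add: deriv_product[OF assms(6) \<rho>(1)] scaleR_sum_right)
    also have "\<dots> = \<theta>' t *\<^sub>R pairing \<rho> (U t) + \<theta> t *\<^sub>R (\<Sum>l\<in>UNIV. A l *v pairing (partial_deriv l \<rho>) (U t))"
      using int(1) i2 by (simp add: e2 pairing_def[of \<rho>] del: scaleR_scaleR)
    finally show ?thesis .
  qed
  have "(LBINT t:{0<..}. (\<integral>x. deriv_t ?\<psi> (t, x) *\<^sub>R U t x +
        (\<Sum>l\<in>UNIV. deriv_x l ?\<psi> (t, x) *\<^sub>R (A l *v U t x)) \<partial>lborel)) = 0"
    using assms(1) test_function_product[OF assms(3,4,5) \<rho>] unfolding weak_solution_def by blast
  then show ?thesis
    by (subst (asm) set_lebesgue_integral_cong[OF _ allI[OF impI[OF *]]]) auto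
qed

text \<open>The test functions are smoothed indicators of the interval. Their derivatives
  concentrate at the two end points and give w(a) - w(b) in the limit, while the other term tends to
  the integral of y.\<close>

lemma du_bois_reymond_increment:
  fixes w y :: "real \<Rightarrow> 'b::euclidean_space"
  assumes w: "continuous_on {0..} w" and y: "continuous_on {0..} y"
    and weak: "\<And>\<theta> \<theta>' a b. 0 < a \<Longrightarrow> (\<And>k. Ck_on k UNIV \<theta>) \<Longrightarrow> (\<And>t. (\<theta> has_real_derivative \<theta>' t) (at t)) \<Longrightarrow>
      (\<And>t. t \<notin> {a..b} \<Longrightarrow> \<theta> t = 0) \<Longrightarrow> (LBINT t:{0<..}. \<theta>' t *\<^sub>R w t + \<theta> t *\<^sub>R y t) = 0"
    and ab: "0 < a" "a < b"
  shows "w b - w a = integral {a..b} y"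
proof -
  obtain H h :: "real \<Rightarrow> real" where
    Ck: "\<And>k. Ck_on k UNIV H" and DH: "\<And>x. (H has_real_derivative h x) (at x)" and h: "continuous_on UNIV h"
    and hout: "\<And>x. x \<notin> {0..1} \<Longrightarrow> h x = 0" and H0: "\<And>x. x \<le> 0 \<Longrightarrow> H x = 0" and H1: "\<And>x. x \<ge> 1 \<Longrightarrow> H x = 1"
    and H01: "\<And>x. 0 \<le> H x" "\<And>x. H x \<le> 1" and hpos: "\<And>x. 0 \<le> h x"
    by (rule smooth_step_exists) blast
  \<comment> \<open>Nothing is known about \<open>w\<close> at negative times; the constant
    extension makes it continuous on the whole line without changing its values on the supports
    below.\<close>
  define W where "W t = w (max t 0)" for t
  define Y where "Y t = y (max t 0)" for t
  have "continuous_on UNIV W" unfolding W_def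
    by (rule continuous_on_compose2[OF w]) (auto intro: continuous_intros)
  note contW = continuous_on_subset[OF this subset_UNIV]
  have "continuous_on UNIV Y" unfolding Y_def
    by (rule continuous_on_compose2[OF y]) (auto intro: continuous_intros)
  note contY = continuous_on_subset[OF this subset_UNIV]
  have inth: "integrable lborel h"
  proof -
    have "integrable lborel (\<lambda>x. indicator {0..1} x *\<^sub>R h x)"
      by (rule borel_integrable_compact) (use h in \<open>auto intro: continuous_on_subset\<close>)
    moreover have "(\<lambda>x. indicator {0..1} x *\<^sub>R h x) = h" using hout by (fastforce simp: indicator_def)
    ultimately show ?thesis by simp
  qed
  have h1: "(\<integral>x. h x \<partial>lborel) = 1"
  proof -
    have "(\<integral>x. h x * indicator {0..1} x \<partial>lborel) = H 1 - H 0"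
      by (rule integral_FTC_Icc_real)
         (use DH h in \<open>auto simp: continuous_on_eq_continuous_at\<close>)
    moreover have "(\<lambda>x. h x * indicator {0..1} x) = h" using hout by (fastforce simp: indicator_def)
    ultimately show ?thesis using H0[of 0] H1[of 1] by simp
  qed
  define n where "n k = real (Suc k)" for k
  have n1: "n k \<ge> 1" for k by (simp add: n_def)
  have ninf: "filterlim n at_top sequentially" unfolding n_def
    by (simp add: filterlim_tendsto_add_at_top[OF tendsto_const filterlim_real_sequentially])
  \<comment> \<open>Both ramps rise to the right of their base points and have width 1/n \<le> 1.
    The support therefore stays in positive time and inside the interval from a to b + 1.\<close>
  define \<theta> where "\<theta> k t = H (n k * (t - a)) - H (n k * (t - b))" for k t
  define \<theta>' where "\<theta>' k t = n k * h (n k * (t - a)) - n k * h (n k * (t - b))" for k t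
  have Ck\<theta>: "Ck_on j UNIV (\<theta> k)" for j k
  proof -
    have *: "Ck_on j UNIV (\<lambda>t. H (n k * (t + (- c))))" for c
      by (intro Ck_on_compose[OF _ Ck] Ck_on_mult[OF Ck_on_const] Ck_on_add[OF _ Ck_on_const] Ck_on_linear bounded_linear_ident)
    have "Ck_on j UNIV (\<lambda>t. H (n k * (t + (- a))) + (- 1) * H (n k * (t + (- b))))"
      by (rule Ck_on_add[OF * Ck_on_mult[OF Ck_on_const *]])
    then show ?thesis by (simp add: \<theta>_def[abs_def])
  qed
  have D\<theta>: "(\<theta> k has_real_derivative \<theta>' k t) (at t)" for k t
    unfolding \<theta>_def \<theta>'_def
    by (intro DERIV_diff DERIV_cong[OF DERIV_chain2[OF DH]]) (auto intro!: derivative_eq_intros)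
  have out: "\<theta> k t = 0 \<and> \<theta>' k t = 0" if "t \<notin> {a..b+1}" for k t
  proof (cases "t < a")
    case True
    then have "n k * (t - a) < 0" "n k * (t - b) < 0" using n1[of k] ab by (auto simp: mult_less_0_iff)
    then show ?thesis using H0 hout by (simp add: \<theta>_def \<theta>'_def)
  next
    case False
    then have "1 < t - a" "1 < t - b" using that ab by auto
    then have "1 < n k * (t - a)" "1 < n k * (t - b)"
      using n1[of k] less_1_mult' by (metis dual_order.strict_trans1 mult_le_cancel_right1 mult.commute linorder_not_less order_less_imp_le order_less_trans zero_less_one)+
    then show ?thesis using H1 hout by (simp add: \<theta>_def \<theta>'_def)
  qed
  have cont\<theta>: "continuous_on UNIV (\<theta> k)" for k using Ck\<theta>[of 0 k] by simp
  have cont\<theta>': "continuous_on UNIV (\<theta>' k)" for k unfolding \<theta>'_def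
    by (intro continuous_intros continuous_on_compose2[OF h]) auto
  have supp: "integrable lborel f" if "continuous_on UNIV f" "\<And>t. t \<notin> {a..b+1} \<Longrightarrow> f t = 0" for f :: "real \<Rightarrow> 'b"
  proof -
    have "integrable lborel (\<lambda>x. indicator {a..b+1} x *\<^sub>R f x)"
      by (rule borel_integrable_compact) (use that in \<open>auto intro: continuous_on_subset\<close>)
    moreover have "(\<lambda>x. indicator {a..b+1} x *\<^sub>R f x) = f" using that(2) by (fastforce simp: indicator_def)
    ultimately show ?thesis by simp
  qed
  have i1: "integrable lborel (\<lambda>t. \<theta>' k t *\<^sub>R W t)" for k
    by (intro supp continuous_intros cont\<theta>' contW) (simp add: out)
  have i2: "integrable lborel (\<lambda>t. \<theta> k t *\<^sub>R Y t)" for k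
    by (intro supp continuous_intros cont\<theta> contY) (simp add: out)
  have eq0: "(\<integral>t. \<theta>' k t *\<^sub>R W t \<partial>lborel) + (\<integral>t. \<theta> k t *\<^sub>R Y t \<partial>lborel) = 0" for k
  proof -
    have "(LBINT t:{0<..}. \<theta>' k t *\<^sub>R w t + \<theta> k t *\<^sub>R y t) = 0"
      by (rule weak[OF ab(1) Ck\<theta> D\<theta>, of "b + 1"]) (use out in auto)
    moreover have "indicator {0<..} t *\<^sub>R (\<theta>' k t *\<^sub>R w t + \<theta> k t *\<^sub>R y t) = \<theta>' k t *\<^sub>R W t + \<theta> k t *\<^sub>R Y t" for t
      using out[of t k] ab by (cases "t > 0") (auto simp: W_def Y_def max_def)
    ultimately have "(\<integral>t. \<theta>' k t *\<^sub>R W t + \<theta> k t *\<^sub>R Y t \<partial>lborel) = 0"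
      by (simp add: set_lebesgue_integral_def)
    then show ?thesis using i1 i2 by simp
  qed
  have sub: "(\<integral>t. (n k * h (n k * (t - c))) *\<^sub>R W t \<partial>lborel) = (\<integral>s. h s *\<^sub>R W (c + (1 / n k) * s) \<partial>lborel)" for k c
  proof -
    have "n k \<noteq> 0" using n1[of k] by simp
    then show ?thesis
      by (subst lborel_integral_real_affine[where c = "1 / n k" and t = c])
         (use n1[of k] in \<open>simp_all flip: integral_scaleR_right add: scaleR_scaleR\<close>)
  qed
  have i3: "integrable lborel (\<lambda>t. (n k * h (n k * (t - c))) *\<^sub>R W t)" if c: "c \<in> {a..b}" for k c
  proof (rule supp)
    show "continuous_on UNIV (\<lambda>t. (n k * h (n k * (t - c))) *\<^sub>R W t)"
      by (intro continuous_intros continuous_on_compose2[OF h] contW) auto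
    show "(n k * h (n k * (t - c))) *\<^sub>R W t = 0" if t: "t \<notin> {a..b+1}" for t
    proof -
      have "n k * (t - c) \<notin> {0..1}"
      proof
        assume *: "n k * (t - c) \<in> {0..1}"
        then have "t - c \<ge> 0" using n1[of k] by (auto simp: zero_le_mult_iff)
        then have "1 * (t - c) \<le> n k * (t - c)" using n1[of k] by (intro mult_right_mono) auto
        then have "t - c \<le> 1" using * by simp
        with \<open>t - c \<ge> 0\<close> show False using t c by auto
      qed
      then show ?thesis using hout by simp
    qed
  qed
  \<comment> \<open>Since \<open>h\<close> lives on the unit interval and 1/n \<le> 1, only the
    values of \<open>W\<close> between c and c + 1 enter, and their maximum provides the dominating
    function.\<close>
  have lim: "(\<lambda>k. \<integral>s. h s *\<^sub>R W (c + (1 / n k) * s) \<partial>lborel) \<longlonglongrightarrow> W c" for c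
  proof -
    have "compact (W ` {c..c+1})" by (intro compact_continuous_image contW) auto
    then obtain M where M: "\<And>t. t \<in> {c..c+1} \<Longrightarrow> norm (W t) \<le> M"
      by (meson compact_imp_bounded bounded_iff imageI)
    have "(\<lambda>k. \<integral>s. h s *\<^sub>R W (c + (1 / n k) * s) \<partial>lborel) \<longlonglongrightarrow> (\<integral>s. h s *\<^sub>R W c \<partial>lborel)"
    proof (rule integral_dominated_convergence[where w = "\<lambda>s. h s * M"])
      have cts: "continuous_on UNIV (\<lambda>s. h s *\<^sub>R W (c + (1 / n k) * s))" for k
        by (intro continuous_intros h continuous_on_compose2[OF contW[of UNIV]]) auto
      show "(\<lambda>s. h s *\<^sub>R W (c + (1 / n k) * s)) \<in> borel_measurable lborel" for k
        using borel_measurable_continuous_onI[OF cts] by simp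
      show "(\<lambda>s. h s *\<^sub>R W c) \<in> borel_measurable lborel"
        using inth by auto
      show "integrable lborel (\<lambda>s. h s * M)" using inth by simp
      show "AE s in lborel. (\<lambda>k. h s *\<^sub>R W (c + (1 / n k) * s)) \<longlonglongrightarrow> h s *\<^sub>R W c"
      proof (rule AE_I2)
        fix s
        have "(\<lambda>k. 1 / n k) \<longlonglongrightarrow> 0" using tendsto_divide_0[OF tendsto_const filterlim_at_top_imp_at_infinity[OF ninf]] .
        then have "(\<lambda>k. c + (1 / n k) * s) \<longlonglongrightarrow> c + 0 * s" by (intro tendsto_intros)
        moreover have "isCont W c" using contW[of UNIV] by (simp add: continuous_on_eq_continuous_at)
        ultimately have "(\<lambda>k. W (c + (1 / n k) * s)) \<longlonglongrightarrow> W c"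
          using isCont_tendsto_compose by fastforce
        then show "(\<lambda>k. h s *\<^sub>R W (c + (1 / n k) * s)) \<longlonglongrightarrow> h s *\<^sub>R W c" by (intro tendsto_intros)
      qed
      show "AE s in lborel. norm (h s *\<^sub>R W (c + (1 / n k) * s)) \<le> h s * M" for k
      proof (rule AE_I2)
        fix s
        show "norm (h s *\<^sub>R W (c + (1 / n k) * s)) \<le> h s * M"
        proof (cases "s \<in> {0..1}")
          case True
          have "1 / n k * s \<le> 1 * 1" using n1[of k] True by (intro mult_mono) auto
          moreover have "0 \<le> 1 / n k * s" using n1[of k] True by auto
          ultimately have "norm (W (c + (1 / n k) * s)) \<le> M" by (intro M) auto
          then show ?thesis using hpos[of s] by (simp add: mult_left_mono)
        qed (simp add: hout)
      qed
    qed
    then show ?thesis using inth h1 by simp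
  qed
  have L1: "(\<lambda>k. \<integral>t. \<theta>' k t *\<^sub>R W t \<partial>lborel) \<longlonglongrightarrow> W a - W b"
  proof -
    have "(\<integral>t. \<theta>' k t *\<^sub>R W t \<partial>lborel) = (\<integral>s. h s *\<^sub>R W (a + (1 / n k) * s) \<partial>lborel) - (\<integral>s. h s *\<^sub>R W (b + (1 / n k) * s) \<partial>lborel)" for k
      unfolding sub[symmetric] \<theta>'_def scaleR_diff_left
      by (rule Bochner_Integration.integral_diff) (use i3 ab in auto)
    then show ?thesis using tendsto_diff[OF lim[of a] lim[of b]] by simp
  qed
  have L2: "(\<lambda>k. \<integral>t. \<theta> k t *\<^sub>R Y t \<partial>lborel) \<longlonglongrightarrow> (\<integral>t. indicator {a..b} t *\<^sub>R Y t \<partial>lborel)"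
  proof (rule integral_dominated_convergence[where w = "\<lambda>t. indicator {a..b+1} t *\<^sub>R norm (Y t)"])
    show "(\<lambda>t. \<theta> k t *\<^sub>R Y t) \<in> borel_measurable lborel" for k using i2 by auto
    show "integrable lborel (\<lambda>t. indicator {a..b+1} t *\<^sub>R norm (Y t))"
      by (rule borel_integrable_compact) (auto intro!: continuous_intros contY)
    have "integrable lborel (\<lambda>t. indicator {a..b} t *\<^sub>R Y t)"
      by (rule borel_integrable_compact) (auto intro!: contY)
    then show "(\<lambda>t. indicator {a..b} t *\<^sub>R Y t) \<in> borel_measurable lborel" by auto
    show "AE t in lborel. norm (\<theta> k t *\<^sub>R Y t) \<le> indicator {a..b+1} t *\<^sub>R norm (Y t)" for k
    proof (rule AE_I2)
      fix t
      have "\<bar>\<theta> k t\<bar> \<le> 1" using H01(1)[of "n k * (t - a)"] H01(1)[of "n k * (t - b)"]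
          H01(2)[of "n k * (t - a)"] H01(2)[of "n k * (t - b)"] unfolding \<theta>_def by linarith
      then show "norm (\<theta> k t *\<^sub>R Y t) \<le> indicator {a..b+1} t *\<^sub>R norm (Y t)"
        using out[of t k] by (cases "t \<in> {a..b+1}") (auto intro: mult_left_le_one_le)
    qed
    \<comment> \<open>At t = a every \<theta> vanishes while the indicator equals 1: the pointwise
      limit is the indicator of the half-open interval, which differs at this one point.\<close>
    have "AE t in lborel. t \<noteq> a" by (rule AE_lborel_singleton)
    then show "AE t in lborel. (\<lambda>k. \<theta> k t *\<^sub>R Y t) \<longlonglongrightarrow> indicator {a..b} t *\<^sub>R Y t"
    proof eventually_elim
      case (elim t)
      have step: "(\<lambda>k. H (n k * (t - c))) \<longlonglongrightarrow> (if c < t then 1 else 0)" for c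
      proof (cases "c < t")
        case True
        then have "filterlim (\<lambda>k. n k * (t - c)) at_top sequentially"
          using filterlim_at_top_mult_tendsto_pos[OF tendsto_const _ ninf, of "t - c"] by simp
        then have "\<forall>\<^sub>F k in sequentially. 1 \<le> n k * (t - c)" by (simp add: filterlim_at_top)
        then have "\<forall>\<^sub>F k in sequentially. H (n k * (t - c)) = 1" by eventually_elim (rule H1)
        then show ?thesis using True by (simp add: tendsto_eventually)
      next
        case False
        then have "n k * (t - c) \<le> 0" for k using n1[of k] by (simp add: mult_le_0_iff)
        then show ?thesis using False by (simp add: H0)
      qed
      have "(\<lambda>k. \<theta> k t) \<longlonglongrightarrow> indicator {a..b} t"
        using tendsto_diff[OF step[of a] step[of b]] ab elim
        by (auto simp: \<theta>_def indicator_def split: if_splits)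
      then show ?case by (intro tendsto_intros)
    qed
  qed
  have "W a - W b + (\<integral>t. indicator {a..b} t *\<^sub>R Y t \<partial>lborel) = 0"
    using tendsto_add[OF L1 L2] eq0 by (simp add: LIMSEQ_const_iff)
  moreover have "(\<integral>t. indicator {a..b} t *\<^sub>R Y t \<partial>lborel) = integral {a..b} Y"
  proof -
    have "set_integrable lborel {a..b} Y" unfolding set_integrable_def
      by (rule borel_integrable_compact) (auto intro!: contY)
    from set_borel_integral_eq_integral(2)[OF this] show ?thesis
      by (simp add: set_lebesgue_integral_def)
  qed
  moreover have "integral {a..b} Y = integral {a..b} y"
    by (rule Henstock_Kurzweil_Integration.integral_cong) (use ab in \<open>auto simp: Y_def max_def\<close>)
  ultimately show ?thesis using ab by (simp add: W_def max_def algebra_simps)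
qed

text \<open>The derivative is one-sided at 0, where the initial datum enters. The increment formula
  holds for positive times, and continuity of \<open>w\<close> extends it to the closed
  interval.\<close>

lemma du_bois_reymond:
  fixes w y :: "real \<Rightarrow> 'b::euclidean_space"
  assumes w: "continuous_on {0..} w" and y: "continuous_on {0..} y"
    and weak: "\<And>\<theta> \<theta>' a b. 0 < a \<Longrightarrow> (\<And>k. Ck_on k UNIV \<theta>) \<Longrightarrow> (\<And>t. (\<theta> has_real_derivative \<theta>' t) (at t)) \<Longrightarrow>
      (\<And>t. t \<notin> {a..b} \<Longrightarrow> \<theta> t = 0) \<Longrightarrow> (LBINT t:{0<..}. \<theta>' t *\<^sub>R w t + \<theta> t *\<^sub>R y t) = 0"
    and t: "t \<in> {0..T}"
  shows "(w has_vector_derivative y t) (at t within {0..T})"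
proof -
  define F where "F t = w t - integral {0..t} y" for t
  have yT: "continuous_on {0..T} y" using y by (auto intro: continuous_on_subset)
  have contF: "continuous_on {0..T} F" unfolding F_def
    by (intro continuous_intros indefinite_integral_continuous_1 integrable_continuous_interval yT continuous_on_subset[OF w]) auto
  have const: "F s = F r" if "0 < r" "r \<le> s" "s \<le> T" for r s
  proof (cases "r = s")
    case False
    have "integral {0..r} y + integral {r..s} y = integral {0..s} y"
      by (intro Henstock_Kurzweil_Integration.integral_combine integrable_continuous_interval continuous_on_subset[OF y])
         (use that in auto)
    moreover have "w s - w r = integral {r..s} y"
    proof (rule du_bois_reymond_increment[OF w y])
      show "0 < r" "r < s" using that False by auto
    qed (rule weak; assumption)
    ultimately show ?thesis by (simp add: F_def algebra_simps)
  qed simp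
  \<comment> \<open>Test functions vanish near t = 0, so \<open>F\<close> is known to be constant
    only for positive times; its limit at 0 settles the remaining point.\<close>
  have F0: "F s = F 0" if s: "s \<in> {0..T}" for s
  proof (cases "s = 0")
    case False
    have "(F \<longlongrightarrow> F 0) (at 0 within {0..T})" using contF s by (simp add: continuous_on_def)
    moreover have "\<forall>\<^sub>F r in at 0 within {0..T}. F r = F s"
      unfolding eventually_at using const s False
      by (intro exI[of _ s]) (use s in \<open>auto simp: dist_real_def intro: const[symmetric]\<close>)
    ultimately have "((\<lambda>_. F s) \<longlongrightarrow> F 0) (at 0 within {0..T})"
      by (rule Lim_transform_eventually)
    moreover have "at 0 within {0..T} \<noteq> bot" using s False by (simp add: trivial_limit_within islimpt_Icc)
    ultimately show ?thesis using tendsto_const_iff by metis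
  qed simp
  have "((\<lambda>t. F 0 + integral {0..t} y) has_vector_derivative y t) (at t within {0..T})"
    using has_vector_derivative_add[OF has_vector_derivative_const integral_has_vector_derivative[OF yT t]] by simp
  then show ?thesis
  proof (rule has_vector_derivative_transform[OF t, rotated])
    show "w s = F 0 + integral {0..s} y" if "s \<in> {0..T}" for s
      using F0[OF that] by (simp add: F_def algebra_simps)
  qed
qed

subsection \<open>Resolvent bound from strong well-posedness\<close>

text \<open>Integrating the derivative of exp(-\<zeta> t) W(t) over all positive times gives W(0) =
  - \<integral> exp(-\<zeta> t) (W' - \<zeta> W) dt, the boundary term at infinity being killed by
  Re \<zeta> > \<alpha>. Only the defect bound \<open>G\<close> survives; the growth constant
  \<open>Q\<close> disappears in the limit.\<close>

lemma laplace_bound: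
  fixes W W' :: "real \<Rightarrow> complex"
  assumes der: "\<And>t T. t \<in> {0..T} \<Longrightarrow> (W has_vector_derivative W' t) (at t within {0..T})"
    and Q: "\<And>t. t \<ge> 0 \<Longrightarrow> norm (W t) \<le> Q * exp (\<alpha> * t)"
    and G: "\<And>t. t \<ge> 0 \<Longrightarrow> norm (W' t - \<zeta> * W t) \<le> G * exp (\<alpha> * t)"
    and \<zeta>: "Re \<zeta> > \<alpha>"
  shows "norm (W 0) \<le> G / (Re \<zeta> - \<alpha>)"
proof -
  define d where "d = Re \<zeta> - \<alpha>"
  have d: "d > 0" using \<zeta> by (simp add: d_def)
  have e: "norm (exp (- (\<zeta> * of_real t))) * exp (\<alpha> * t) = exp (- (d * t))" for t
    by (simp add: d_def exp_add[symmetric] algebra_simps)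
  have G0: "G \<ge> 0" using order_trans[OF norm_ge_zero G[of 0]] by simp
  have bound: "norm (W 0) \<le> Q * exp (- (d * T)) + G / d" if T: "T \<ge> 0" for T
  proof -
    let ?F = "\<lambda>t. exp (- (\<zeta> * of_real t)) * W t"
    let ?F' = "\<lambda>t. exp (- (\<zeta> * of_real t)) * (W' t - \<zeta> * W t)"
    let ?g = "\<lambda>t. G * exp (- (d * t))"
    have "(?F has_vector_derivative ?F' t) (at t within {0..T})" if "t \<in> {0..T}" for t
    proof -
      have "((\<lambda>t. exp (- (\<zeta> * of_real t))) has_vector_derivative (- \<zeta> * exp (- (\<zeta> * of_real t)))) (at t within {0..T})"
        by (rule has_vector_derivative_real_field) (auto intro!: derivative_eq_intros)
      from has_vector_derivative_mult[OF this der[OF that]] show ?thesis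
        by (simp add: algebra_simps)
    qed
    then have F: "(?F' has_integral (?F T - ?F 0)) {0..T}"
      by (rule fundamental_theorem_of_calculus[OF T])
    have "((\<lambda>t. - (G / d) * exp (- (d * t))) has_vector_derivative ?g t) (at t within {0..T})" for t
      unfolding has_real_derivative_iff_has_vector_derivative[symmetric]
      using d by (auto intro!: derivative_eq_intros)
    then have g: "(?g has_integral (- (G / d) * exp (- (d * T)) - (- (G / d) * exp (- (d * 0))))) {0..T}"
      by (intro fundamental_theorem_of_calculus[OF T])
    have "norm (?F T - ?F 0) \<le> - (G / d) * exp (- (d * T)) - (- (G / d) * exp (- (d * 0)))"
    proof -
      have "norm (?F' t) \<le> ?g t" if "t \<in> {0..T}" for t
      proof -
        have "norm (?F' t) \<le> norm (exp (- (\<zeta> * of_real t))) * (G * exp (\<alpha> * t))"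
          unfolding norm_mult by (rule mult_left_mono[OF G]) (use that in auto)
        then show ?thesis using e[of t] by (simp add: mult.left_commute)
      qed
      then have "norm (integral {0..T} ?F') \<le> integral {0..T} ?g"
        using F g by (intro integral_norm_bound_integral) auto
      then show ?thesis using integral_unique[OF F] integral_unique[OF g] by simp
    qed
    also have "\<dots> \<le> G / d" using G0 d by simp
    finally have "norm (?F T - ?F 0) \<le> G / d" .
    moreover have "norm (?F T) \<le> Q * exp (- (d * T))"
    proof -
      have "norm (?F T) \<le> norm (exp (- (\<zeta> * of_real T))) * (Q * exp (\<alpha> * T))"
        unfolding norm_mult by (rule mult_left_mono[OF Q]) (use T in auto)
      then show ?thesis using e[of T] by (simp add: mult.left_commute)
    qed
    moreover have "norm (?F 0) \<le> norm (?F T) + norm (?F T - ?F 0)"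
      by (metis norm_minus_commute norm_triangle_sub)
    ultimately show ?thesis by simp
  qed
  have "((\<lambda>T. Q * exp (- (d * T)) + G / d) \<longlongrightarrow> Q * 0 + G / d) at_top"
  proof (intro tendsto_intros)
    have "filterlim (\<lambda>T. d * T) at_top at_top"
      using filterlim_tendsto_pos_mult_at_top[OF tendsto_const d filterlim_ident] .
    then show "((\<lambda>T. exp (- (d * T))) \<longlongrightarrow> 0) at_top"
      by (intro filterlim_compose[OF exp_at_bot] filterlim_compose[OF filterlim_uminus_at_bot_at_top])
  qed
  then have "norm (W 0) \<le> Q * 0 + G / d"
    by (rule tendsto_lowerbound) (use eventually_mono[OF eventually_ge_at_top[of 0] bound] in auto)
  then show ?thesis by (simp add: d_def)
qed

section \<open>The bilinear form on complex vectors\<close>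

definition cdot :: "complex ^ 'n \<Rightarrow> complex ^ 'n \<Rightarrow> complex" where
  "cdot q v = (\<Sum>i\<in>UNIV. q $ i * v $ i)"

lemma norm_cdot_le: "norm (cdot q v) \<le> norm q * norm v"
proof -
  have "norm (cdot q v) \<le> (\<Sum>i\<in>UNIV. \<bar>norm (q $ i)\<bar> * \<bar>norm (v $ i)\<bar>)"
    unfolding cdot_def by (rule sum_norm_le) (simp add: norm_mult)
  also have "\<dots> \<le> norm q * norm v"
    unfolding norm_vec_def by (rule L2_set_mult_ineq)
  finally show ?thesis .
qed

lemma cdot_add: "cdot q (u + v) = cdot q u + cdot q v"
  and cdot_smult: "cdot q (c *s v) = c * cdot q v"
  and cdot_scaleR: "cdot q (r *\<^sub>R v) = r *\<^sub>R cdot q v"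
  by (simp_all add: cdot_def distrib_left sum.distrib sum_distrib_left scaleR_sum_right mult.left_commute)

lemma bounded_linear_cdot: "bounded_linear (cdot q)"
  by (rule bounded_linear_intro[of _ "norm q"])
     (use norm_cdot_le[of q] in \<open>auto simp: cdot_add cdot_scaleR mult.commute\<close>)

lemma cdot_sum: "cdot q (\<Sum>i\<in>I. f i) = (\<Sum>i\<in>I. cdot q (f i))"
  using linear_sum[OF bounded_linear.linear[OF bounded_linear_cdot]] .

text \<open>The form carries no conjugation, so a matrix moves to the other side as it stands and
  complex factors come out unchanged on both sides. Conjugation is introduced only where a norm is
  to be recovered.\<close>

lemma cdot_vector_matrix_mult: "cdot (q v* B) v = cdot q (B *v v)"
proof -
  have "cdot (q v* B) v = (\<Sum>i\<in>UNIV. \<Sum>j\<in>UNIV. q $ j * (B $ j $ i * v $ i))"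
    by (simp add: cdot_def vector_matrix_mult_def sum_distrib_right sum_distrib_left algebra_simps)
  also have "\<dots> = (\<Sum>j\<in>UNIV. \<Sum>i\<in>UNIV. q $ j * (B $ j $ i * v $ i))" by (rule sum.swap)
  also have "\<dots> = cdot q (B *v v)"
    by (simp add: cdot_def matrix_vector_mult_def sum_distrib_left)
  finally show ?thesis .
qed

definition vec_cnj :: "complex ^ 'n \<Rightarrow> complex ^ 'n" where "vec_cnj v = (\<chi> i. cnj (v $ i))"

lemma norm_vec_cnj: "norm (vec_cnj v) = norm v"
  by (simp add: vec_cnj_def norm_vec_def)

lemma cdot_vec_cnj: "cdot v (vec_cnj v) = of_real ((norm v)\<^sup>2)" "cdot (vec_cnj v) v = of_real ((norm v)\<^sup>2)"
proof -
  have "(norm v)\<^sup>2 = (\<Sum>i\<in>UNIV. (cmod (v $ i))\<^sup>2)"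
    by (simp add: norm_vec_def L2_set_def sum_nonneg)
  then show "cdot v (vec_cnj v) = of_real ((norm v)\<^sup>2)"
    by (simp add: cdot_def vec_cnj_def complex_norm_square[symmetric] del: of_real_power)
  then show "cdot (vec_cnj v) v = of_real ((norm v)\<^sup>2)"
    by (simp add: cdot_def mult.commute)
qed

lemma norm_vector_smult: "norm (c *s v) = norm c * norm (v :: complex ^ 'n)"
proof -
  have "(norm (c *s v))\<^sup>2 = (norm c * norm v)\<^sup>2"
    by (simp add: norm_vec_def L2_set_def sum_nonneg norm_mult power_mult_distrib sum_distrib_left)
  then show ?thesis by (simp add: power2_eq_iff_nonneg)
qed

lemma pairing_has_vector_derivative:
  fixes \<rho> :: "real ^ 'd \<Rightarrow> real" and A :: "'d::finite \<Rightarrow> complex ^ 'n ^ 'n"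
  assumes "weak_solution A U" and U: "continuous_into_L2 U"
    and \<rho>: "\<And>k. Ck_on k UNIV \<rho>" "weight \<rho>" and t: "t \<in> {0..T}"
  shows "((\<lambda>t. pairing \<rho> (U t)) has_vector_derivative
    (\<Sum>l\<in>UNIV. A l *v pairing (partial_deriv l \<rho>) (U t))) (at t within {0..T})"
proof (rule du_bois_reymond[OF continuous_on_pairing[OF \<rho>(2) U] _ _ t])
  show "continuous_on {0..} (\<lambda>t. \<Sum>l\<in>UNIV. A l *v pairing (partial_deriv l \<rho>) (U t))"
    by (intro continuous_on_sum bounded_linear.continuous_on[OF bounded_linear_matrix_vector_complex]
        continuous_on_pairing weight_partial_deriv \<rho> U)
qed (rule weak_solution_product[OF assms(1,2) _ _ _ _ \<rho>]; assumption)

section \<open>Windowed Fourier coefficients of a solution\<close>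

lemma partial_deriv_mult:
  assumes "Ck_on (Suc 0) UNIV f" "(g has_derivative g') (at x)"
  shows "partial_deriv l (\<lambda>x. f x * g x) x = partial_deriv l f x * g x + g' (axis l 1) * f x"
proof -
  have "(f has_derivative frechet_derivative f (at x)) (at x)"
    using assms(1) by (simp add: frechet_derivative_works)
  from frechet_derivative_at[OF has_derivative_mult[OF this assms(2)]]
  show ?thesis unfolding partial_deriv_def by (metis (no_types, lifting) add.commute mult.commute)
qed

lemma pairing_add:
  assumes "weight \<rho>" "weight \<rho>'" "f \<in> L2"
  shows "pairing (\<lambda>x. \<rho> x + c * \<rho>' x) f = pairing \<rho> f + c *\<^sub>R pairing \<rho>' f"
  using pairing_bound(1)[OF assms(1,3)] pairing_bound(1)[OF assms(2,3)]
  by (simp add: pairing_def scaleR_add_left scaleR_scaleR[symmetric] del: scaleR_scaleR)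

definition weight_norm :: "('a::euclidean_space \<Rightarrow> real) \<Rightarrow> real" where
  "weight_norm \<rho> = sqrt (\<integral>x. (\<rho> x)\<^sup>2 \<partial>lborel)"

lemma weight_norm_mult_le:
  assumes "weight \<rho>" "continuous_on UNIV g" "\<And>x. \<bar>g x\<bar> \<le> 1"
  shows "weight_norm (\<lambda>x. \<rho> x * g x) \<le> weight_norm \<rho>"
  unfolding weight_norm_def real_sqrt_le_iff
proof (rule integral_mono)
  show "(\<rho> x * g x)\<^sup>2 \<le> (\<rho> x)\<^sup>2" for x
    using assms(3)[of x] by (simp add: power_mult_distrib mult_left_le abs_square_le_1)
qed (use weight_square_integrable weight_mult assms in blast)+

lemma partial_deriv_cos_sin:
  fixes \<phi> :: "real ^ 'd \<Rightarrow> real"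
  assumes "Ck_on (Suc 0) UNIV \<phi>"
  shows "partial_deriv l (\<lambda>x. \<phi> x * cos (\<eta> \<bullet> x)) =
      (\<lambda>x. partial_deriv l \<phi> x * cos (\<eta> \<bullet> x) + (- (\<eta> $ l)) * (\<phi> x * sin (\<eta> \<bullet> x)))"
    and "partial_deriv l (\<lambda>x. \<phi> x * sin (\<eta> \<bullet> x)) =
      (\<lambda>x. partial_deriv l \<phi> x * sin (\<eta> \<bullet> x) + \<eta> $ l * (\<phi> x * cos (\<eta> \<bullet> x)))"
proof -
  have c: "((\<lambda>x. cos (\<eta> \<bullet> x)) has_derivative (\<lambda>h. - sin (\<eta> \<bullet> x) * (\<eta> \<bullet> h))) (at x)"
    and s: "((\<lambda>x. sin (\<eta> \<bullet> x)) has_derivative (\<lambda>h. cos (\<eta> \<bullet> x) * (\<eta> \<bullet> h))) (at x)" for x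
    by (auto intro!: derivative_eq_intros simp: fun_eq_iff)
  show "partial_deriv l (\<lambda>x. \<phi> x * cos (\<eta> \<bullet> x)) =
      (\<lambda>x. partial_deriv l \<phi> x * cos (\<eta> \<bullet> x) + (- (\<eta> $ l)) * (\<phi> x * sin (\<eta> \<bullet> x)))"
    using partial_deriv_mult[OF assms c] by (simp add: fun_eq_iff inner_axis)
  show "partial_deriv l (\<lambda>x. \<phi> x * sin (\<eta> \<bullet> x)) =
      (\<lambda>x. partial_deriv l \<phi> x * sin (\<eta> \<bullet> x) + \<eta> $ l * (\<phi> x * cos (\<eta> \<bullet> x)))"
    using partial_deriv_mult[OF assms s] by (simp add: fun_eq_iff inner_axis)
qed

text \<open>The windowed Fourier coefficient of \<open>f\<close> at frequency \<eta>. Cosine and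
  sine appear separately because weights and test functions are real valued.\<close>

definition mode_amplitude ::
  "(real ^ 'd \<Rightarrow> real) \<Rightarrow> real ^ 'd \<Rightarrow> (real ^ 'd \<Rightarrow> complex ^ 'n) \<Rightarrow> complex ^ 'n" where
  "mode_amplitude \<phi> \<eta> f = pairing (\<lambda>x. \<phi> x * cos (\<eta> \<bullet> x)) f - \<i> *s pairing (\<lambda>x. \<phi> x * sin (\<eta> \<bullet> x)) f"

lemma weight_trig:
  assumes "weight \<phi>"
  shows "weight (\<lambda>x. \<phi> x * cos (\<eta> \<bullet> x))" "weight (\<lambda>x. \<phi> x * sin (\<eta> \<bullet> x))"
  by (rule weight_mult[OF assms]; auto intro!: continuous_intros)+

text \<open>Cosine and sine parts are estimated separately, whence the factor 2. The point is that
  the bound does not depend on the frequency.\<close>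

lemma norm_mode_amplitude_le:
  assumes "weight \<phi>" "f \<in> L2"
  shows "norm (mode_amplitude \<phi> \<eta> f) \<le> 2 * weight_norm \<phi> * L2_norm f"
proof -
  have L: "L2_norm f \<ge> 0" by (simp add: L2_norm_def)
  have "norm (pairing (\<lambda>x. \<phi> x * cos (\<eta> \<bullet> x)) f) \<le> weight_norm (\<lambda>x. \<phi> x * cos (\<eta> \<bullet> x)) * L2_norm f"
    "norm (pairing (\<lambda>x. \<phi> x * sin (\<eta> \<bullet> x)) f) \<le> weight_norm (\<lambda>x. \<phi> x * sin (\<eta> \<bullet> x)) * L2_norm f"
    unfolding weight_norm_def by (intro pairing_bound weight_trig assms)+
  moreover have "weight_norm (\<lambda>x. \<phi> x * cos (\<eta> \<bullet> x)) * L2_norm f \<le> weight_norm \<phi> * L2_norm f"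
    by (intro mult_right_mono weight_norm_mult_le assms L) (auto intro!: continuous_intros)
  moreover have "weight_norm (\<lambda>x. \<phi> x * sin (\<eta> \<bullet> x)) * L2_norm f \<le> weight_norm \<phi> * L2_norm f"
    by (intro mult_right_mono weight_norm_mult_le assms L) (auto intro!: continuous_intros)
  moreover have "norm (mode_amplitude \<phi> \<eta> f) \<le>
      norm (pairing (\<lambda>x. \<phi> x * cos (\<eta> \<bullet> x)) f) + norm (pairing (\<lambda>x. \<phi> x * sin (\<eta> \<bullet> x)) f)"
    unfolding mode_amplitude_def by (rule norm_triangle_ineq4[THEN order_trans]) (simp add: norm_vector_smult)
  ultimately show ?thesis by linarith
qed

lemma matrix_vector_smult: "B *v (c *s v) = c *s (B *v (v :: complex ^ 'n))"
  by (simp add: matrix_vector_mult_def vec_eq_iff sum_distrib_left mult.left_commute)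

lemma bounded_linear_vector_smult: "bounded_linear (\<lambda>v :: complex ^ 'n. c *s v)"
  by (rule bounded_linear_intro[of _ "norm c"])
     (auto simp: norm_vector_smult vec_eq_iff distrib_left mult.commute)

text \<open>A space derivative falls either on the oscillation, which yields the factor -i \<eta>_l,
  or on the window, which yields a coefficient of the same kind with another window and hence a
  bound free of \<eta>.\<close>

lemma mode_amplitude_has_vector_derivative:
  fixes \<phi> :: "real ^ 'd \<Rightarrow> real" and A :: "'d::finite \<Rightarrow> complex ^ 'n ^ 'n"
  assumes "weak_solution A U" and U: "continuous_into_L2 U"
    and \<phi>: "\<And>k. Ck_on k UNIV \<phi>" "weight \<phi>" and t: "t \<in> {0..T}"
  shows "((\<lambda>t. mode_amplitude \<phi> \<eta> (U t)) has_vector_derivative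
    (\<Sum>l\<in>UNIV. A l *v (mode_amplitude (partial_deriv l \<phi>) \<eta> (U t) -
       (\<i> * of_real (\<eta> $ l)) *s mode_amplitude \<phi> \<eta> (U t)))) (at t within {0..T})"
proof -
  let ?c = "\<lambda>x. \<phi> x * cos (\<eta> \<bullet> x)" and ?s = "\<lambda>x. \<phi> x * sin (\<eta> \<bullet> x)"
  have C: "Ck_on k UNIV (\<lambda>x. cos (\<eta> \<bullet> x))" and S: "Ck_on k UNIV (\<lambda>x. sin (\<eta> \<bullet> x))" for k
    using Ck_on_sin_cos[of k]
    by (auto intro: Ck_on_compose_linear[OF bounded_linear_inner_right])
  have Ut: "U t \<in> L2" using U t by (simp add: continuous_into_L2_def)
  note d = pairing_has_vector_derivative[OF assms(1,2) _ _ t]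
  have "((\<lambda>t. mode_amplitude \<phi> \<eta> (U t)) has_vector_derivative
      ((\<Sum>l\<in>UNIV. A l *v pairing (partial_deriv l ?c) (U t)) -
       \<i> *s (\<Sum>l\<in>UNIV. A l *v pairing (partial_deriv l ?s) (U t)))) (at t within {0..T})"
    unfolding mode_amplitude_def
    by (intro has_vector_derivative_diff bounded_linear.has_vector_derivative[OF bounded_linear_vector_smult]
        d Ck_on_mult \<phi> C S weight_trig)
  moreover have "A l *v pairing (partial_deriv l ?c) (U t) - \<i> *s (A l *v pairing (partial_deriv l ?s) (U t)) =
     A l *v (mode_amplitude (partial_deriv l \<phi>) \<eta> (U t) - (\<i> * of_real (\<eta> $ l)) *s mode_amplitude \<phi> \<eta> (U t))" for l
  proof -
    have Ck1: "Ck_on (Suc 0) UNIV \<phi>" by (rule \<phi>)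
    have eq: "pairing (partial_deriv l ?c) (U t) - \<i> *s pairing (partial_deriv l ?s) (U t) =
      mode_amplitude (partial_deriv l \<phi>) \<eta> (U t) - (\<i> * of_real (\<eta> $ l)) *s mode_amplitude \<phi> \<eta> (U t)"
      unfolding partial_deriv_cos_sin[OF Ck1] mode_amplitude_def
        pairing_add[OF weight_trig(1)[OF weight_partial_deriv[OF \<phi>]] weight_trig(2)[OF \<phi>(2)] Ut]
        pairing_add[OF weight_trig(2)[OF weight_partial_deriv[OF \<phi>]] weight_trig(1)[OF \<phi>(2)] Ut]
      by (simp add: vec_eq_iff algebra_simps complex_eq_iff)
    show ?thesis unfolding eq[symmetric]
      by (simp add: matrix_vector_mult_diff_distrib matrix_vector_smult)
  qed
  ultimately show ?thesis
    by (simp add: sum_subtractf[symmetric] bounded_linear.linear[OF bounded_linear_vector_smult, THEN linear_sum])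
qed

definition wave_packet ::
  "(real ^ 'd \<Rightarrow> real) \<Rightarrow> real ^ 'd \<Rightarrow> complex ^ 'n \<Rightarrow> real ^ 'd \<Rightarrow> complex ^ 'n" where
  "wave_packet \<phi> \<eta> r x = \<phi> x *\<^sub>R (cis (\<eta> \<bullet> x) *s r)"

lemma wave_packet_L2:
  assumes "weight \<phi>"
  shows "wave_packet \<phi> \<eta> r \<in> L2" "L2_norm (wave_packet \<phi> \<eta> r) = weight_norm \<phi> * norm r"
proof -
  have n: "(norm (wave_packet \<phi> \<eta> r x))\<^sup>2 = (norm r)\<^sup>2 * (\<phi> x)\<^sup>2" for x
    by (simp add: wave_packet_def norm_vector_smult power_mult_distrib)
  have "continuous_on UNIV (\<lambda>x. cis (\<eta> \<bullet> x))"
    by (simp add: cis_conv_exp) (intro continuous_intros)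
  then have "continuous_on UNIV (\<lambda>x. cis (\<eta> \<bullet> x) *s r)"
    unfolding vector_scalar_mult_def by (intro continuous_intros)
  then have "continuous_on UNIV (wave_packet \<phi> \<eta> r)"
    using assms unfolding wave_packet_def[abs_def] weight_def by (intro continuous_intros) auto
  then show "wave_packet \<phi> \<eta> r \<in> L2"
    using weight_square_integrable[OF assms] by (simp add: L2_def n borel_measurable_continuous_onI)
  show "L2_norm (wave_packet \<phi> \<eta> r) = weight_norm \<phi> * norm r"
    by (simp add: L2_norm_def n weight_norm_def real_sqrt_mult)
qed

text \<open>The oscillation of the packet and that of the weight are conjugate and cancel, so the
  initial amplitude is the same at every frequency and survives the limit of large
  frequencies.\<close>

lemma cdot_mode_amplitude_wave_packet:
  assumes "weight \<phi>"
  shows "cdot q (mode_amplitude \<phi> \<eta> (wave_packet \<phi> \<eta> r)) = of_real ((weight_norm \<phi>)\<^sup>2) * cdot q r"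
proof -
  let ?f = "wave_packet \<phi> \<eta> r"
  have p: "cdot q (pairing \<rho> ?f) = (\<integral>x. of_real (\<rho> x * \<phi> x) * (cis (\<eta> \<bullet> x) * cdot q r) \<partial>lborel)"
    and i: "integrable lborel (\<lambda>x. of_real (\<rho> x * \<phi> x) * (cis (\<eta> \<bullet> x) * cdot q r))" if "weight \<rho>" for \<rho>
  proof -
    note int = pairing_bound(1)[OF that wave_packet_L2(1)[OF assms, of \<eta> r]]
    have eq: "cdot q (\<rho> x *\<^sub>R ?f x) = of_real (\<rho> x * \<phi> x) * (cis (\<eta> \<bullet> x) * cdot q r)" for x
      unfolding wave_packet_def cdot_scaleR cdot_smult by (simp add: scaleR_conv_of_real)
    show "cdot q (pairing \<rho> ?f) = (\<integral>x. of_real (\<rho> x * \<phi> x) * (cis (\<eta> \<bullet> x) * cdot q r) \<partial>lborel)"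
      unfolding pairing_def using integral_bounded_linear[OF bounded_linear_cdot int, of q] unfolding eq by simp
    show "integrable lborel (\<lambda>x. of_real (\<rho> x * \<phi> x) * (cis (\<eta> \<bullet> x) * cdot q r))"
      using integrable_bounded_linear[OF bounded_linear_cdot int, of q] unfolding eq .
  qed
  let ?c = "\<lambda>x. \<phi> x * cos (\<eta> \<bullet> x)" and ?s = "\<lambda>x. \<phi> x * sin (\<eta> \<bullet> x)"
  have *: "of_real (?c x * \<phi> x) * (cis (\<eta> \<bullet> x) * cdot q r) - \<i> * (of_real (?s x * \<phi> x) * (cis (\<eta> \<bullet> x) * cdot q r)) =
     of_real ((\<phi> x)\<^sup>2) * cdot q r" for x
  proof -
    have "of_real (?c x * \<phi> x) * (cis (\<eta> \<bullet> x) * cdot q r) - \<i> * (of_real (?s x * \<phi> x) * (cis (\<eta> \<bullet> x) * cdot q r)) =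
      of_real ((\<phi> x)\<^sup>2) * (cis (- (\<eta> \<bullet> x)) * cis (\<eta> \<bullet> x)) * cdot q r"
      by (simp add: cis.ctr Complex_eq algebra_simps power2_eq_square)
    then show ?thesis by (simp add: cis_mult)
  qed
  have "cdot q (mode_amplitude \<phi> \<eta> ?f) = cdot q (pairing ?c ?f) - \<i> * cdot q (pairing ?s ?f)"
    unfolding mode_amplitude_def
      linear_diff[OF bounded_linear.linear[OF bounded_linear_cdot]] cdot_smult ..
  also have "\<dots> = (\<integral>x. of_real ((\<phi> x)\<^sup>2) * cdot q r \<partial>lborel)"
    unfolding p[OF weight_trig(1)[OF assms]] p[OF weight_trig(2)[OF assms]] *[symmetric]
    using i[OF weight_trig(1)[OF assms]] i[OF weight_trig(2)[OF assms]]
    by (subst Bochner_Integration.integral_diff) auto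
  also have "\<dots> = of_real (\<integral>x. (\<phi> x)\<^sup>2 \<partial>lborel) * cdot q r"
    by (simp del: of_real_power)
  also have "(\<integral>x. (\<phi> x)\<^sup>2 \<partial>lborel) = (weight_norm \<phi>)\<^sup>2"
    by (simp add: weight_norm_def)
  finally show ?thesis .
qed

text \<open>The initial datum is attained only almost everywhere; this transfers its norm and its
  pairings to \<open>U 0\<close>.\<close>

lemma L2_AE_cong:
  assumes "f \<in> L2" "g \<in> L2" "AE x in lborel. f x = g x" "weight \<rho>"
  shows "L2_norm f = L2_norm g" "pairing \<rho> f = pairing \<rho> g"
proof -
  have [measurable]: "f \<in> borel_measurable lborel" "g \<in> borel_measurable lborel"
    using assms by (auto simp: L2_def)
  have "(\<integral>x. (norm (f x))\<^sup>2 \<partial>lborel) = (\<integral>x. (norm (g x))\<^sup>2 \<partial>lborel)"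
    by (rule integral_cong_AE) (use assms(3) in \<open>auto elim: eventually_mono\<close>)
  then show "L2_norm f = L2_norm g" by (simp add: L2_norm_def)
  have [measurable]: "\<rho> \<in> borel_measurable lborel" using weight_measurable[OF assms(4)] .
  show "pairing \<rho> f = pairing \<rho> g"
    unfolding pairing_def by (rule integral_cong_AE) (use assms(3) in \<open>auto elim: eventually_mono\<close>)
qed

lemma cdot_diff: "cdot q (u - v) = cdot q u - cdot q v"
  using linear_diff[OF bounded_linear.linear[OF bounded_linear_cdot]] .

lemma cdot_left:
  "cdot (c *s p + (\<Sum>l\<in>I. d l *s s l)) v = c * cdot p v + (\<Sum>l\<in>I. d l * cdot (s l) v)"
  by (simp add: cdot_def distrib_right sum.distrib sum_distrib_left sum_distrib_right mult.assoc sum.swap[of _ I])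

text \<open>The constant \<open>C\<close> collects the terms with derivatives of \<open>\<phi>\<close>; that it depends neither on \<open>\<eta>\<close> nor
  on \<open>\<zeta>\<close> is what the scaling argument below needs.\<close>

lemma left_resolvent_bound_scaled:
  fixes A :: "'d::finite \<Rightarrow> complex ^ 'n ^ 'n" and \<phi> :: "real ^ 'd \<Rightarrow> real"
  assumes \<phi>: "\<And>k. Ck_on k UNIV \<phi>" "weight \<phi>" "weight_norm \<phi> > 0"
  and sol: "\<And>f. f \<in> L2 \<Longrightarrow> \<exists>U. cauchy_solution A f U \<and> (\<forall>t\<ge>0. L2_norm (U t) \<le> K * exp (\<alpha> * t) * L2_norm (U 0))"
  shows "\<exists>C. \<forall>\<eta> \<zeta>. Re \<zeta> > \<alpha> \<longrightarrow>
    (weight_norm \<phi>)\<^sup>2 * (norm q)\<^sup>2 \<le>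
     (norm (\<zeta> *s q + (\<Sum>l\<in>UNIV. (\<i> * of_real (\<eta> $ l)) *s (q v* A l))) * (2 * (weight_norm \<phi>)\<^sup>2 * \<bar>K\<bar> * norm q) + C) / (Re \<zeta> - \<alpha>)"
proof -
  have "\<exists>B. \<forall>v. norm (A l *v v) \<le> norm v * B" for l
    using bounded_linear.bounded[OF bounded_linear_matrix_vector_complex[of "A l"]] .
  then obtain B where B: "\<And>l v. norm (A l *v v) \<le> norm v * B l" by metis
  define N where "N = weight_norm \<phi>"
  define C where "C = (\<Sum>l\<in>UNIV. norm q * (2 * weight_norm (partial_deriv l \<phi>) * (\<bar>K\<bar> * (N * norm q)) * \<bar>B l\<bar>))"
  show ?thesis
  proof (intro exI allI impI)
    fix \<eta> :: "real ^ 'd" and \<zeta> assume \<zeta>: "Re \<zeta> > \<alpha>"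
    \<comment> \<open>The polarization of the packet is conjugate to \<open>q\<close>, so that
      \<open>cdot q r\<close> is the squared norm of \<open>q\<close> and no smallness can occur at
      t = 0.\<close>
    define r where "r = vec_cnj q"
    let ?f = "wave_packet \<phi> \<eta> r"
    have f: "?f \<in> L2" and nf: "L2_norm ?f = N * norm q"
      using wave_packet_L2[OF \<phi>(2), of \<eta> r] by (simp_all add: r_def norm_vec_cnj N_def)
    obtain U where U: "continuous_into_L2 U" and weak: "weak_solution A U" and U0: "AE x in lborel. U 0 x = ?f x"
      and est: "\<And>t. t \<ge> 0 \<Longrightarrow> L2_norm (U t) \<le> K * exp (\<alpha> * t) * L2_norm (U 0)"
      using sol[OF f] unfolding cauchy_solution_def by blast
    have UL: "U t \<in> L2" if "t \<ge> 0" for t using U that by (simp add: continuous_into_L2_def)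
    \<comment> \<open>The sign of \<open>K\<close> is not part of strong well-posedness, hence the
      absolute value here and below.\<close>
    have nU: "L2_norm (U t) \<le> \<bar>K\<bar> * (N * norm q) * exp (\<alpha> * t)" if "t \<ge> 0" for t
    proof -
      have "L2_norm (U 0) = N * norm q"
        using L2_AE_cong(1)[OF UL f U0 \<phi>(2)] nf by simp
      moreover have "N \<ge> 0" using \<phi>(3) by (simp add: N_def)
      ultimately have "K * exp (\<alpha> * t) * L2_norm (U 0) \<le> \<bar>K\<bar> * exp (\<alpha> * t) * (N * norm q)"
        by (intro mult_mono) auto
      from order_trans[OF est[OF that] this] show ?thesis by (simp add: mult_ac)
    qed
    define V where "V t = mode_amplitude \<phi> \<eta> (U t)" for t
    define e where "e t = (\<Sum>l\<in>UNIV. cdot q (A l *v mode_amplitude (partial_deriv l \<phi>) \<eta> (U t)))" for t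
    define m where "m = \<zeta> *s q + (\<Sum>l\<in>UNIV. (\<i> * of_real (\<eta> $ l)) *s (q v* A l))"
    define W where "W t = cdot q (V t)" for t
    define W' where "W' t = (\<Sum>l\<in>UNIV. cdot q (A l *v (mode_amplitude (partial_deriv l \<phi>) \<eta> (U t) -
       (\<i> * of_real (\<eta> $ l)) *s V t)))" for t
    have der: "(W has_vector_derivative W' t) (at t within {0..T})" if "t \<in> {0..T}" for t T
      using bounded_linear.has_vector_derivative[OF bounded_linear_cdot
          mode_amplitude_has_vector_derivative[OF weak U \<phi>(1,2) that], of q \<eta>]
      unfolding W_def W'_def V_def cdot_sum .
    have nV: "norm (V t) \<le> 2 * N * (\<bar>K\<bar> * (N * norm q)) * exp (\<alpha> * t)" if "t \<ge> 0" for t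
    proof -
      have "norm (V t) \<le> 2 * N * L2_norm (U t)"
        unfolding V_def N_def by (rule norm_mode_amplitude_le[OF \<phi>(2) UL[OF that]])
      also have "\<dots> \<le> 2 * N * (\<bar>K\<bar> * (N * norm q) * exp (\<alpha> * t))"
        by (rule mult_left_mono[OF nU[OF that]]) (use \<phi>(3) in \<open>simp add: N_def\<close>)
      finally show ?thesis by (simp add: mult_ac)
    qed
    have ne: "norm (e t) \<le> C * exp (\<alpha> * t)" if "t \<ge> 0" for t
    proof -
      have "norm (cdot q (A l *v mode_amplitude (partial_deriv l \<phi>) \<eta> (U t))) \<le>
         norm q * (2 * weight_norm (partial_deriv l \<phi>) * (\<bar>K\<bar> * (N * norm q)) * \<bar>B l\<bar>) * exp (\<alpha> * t)" for l
      proof -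
        let ?M = "mode_amplitude (partial_deriv l \<phi>) \<eta> (U t)"
        have "norm ?M \<le> 2 * weight_norm (partial_deriv l \<phi>) * L2_norm (U t)"
          by (rule norm_mode_amplitude_le[OF weight_partial_deriv[OF \<phi>(1,2)] UL[OF that]])
        also have "\<dots> \<le> 2 * weight_norm (partial_deriv l \<phi>) * (\<bar>K\<bar> * (N * norm q) * exp (\<alpha> * t))"
          by (rule mult_left_mono[OF nU[OF that]]) (simp add: weight_norm_def)
        finally have M: "norm ?M \<le> 2 * weight_norm (partial_deriv l \<phi>) * (\<bar>K\<bar> * (N * norm q) * exp (\<alpha> * t))" .
        have "norm (cdot q (A l *v ?M)) \<le> norm q * norm (A l *v ?M)" by (rule norm_cdot_le)
        also have "\<dots> \<le> norm q * (norm ?M * \<bar>B l\<bar>)"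
          by (intro mult_left_mono order_trans[OF B]) auto
        also have "\<dots> \<le> norm q * (2 * weight_norm (partial_deriv l \<phi>) * (\<bar>K\<bar> * (N * norm q) * exp (\<alpha> * t)) * \<bar>B l\<bar>)"
          by (intro mult_left_mono mult_right_mono M) auto
        finally show ?thesis by (simp add: mult_ac)
      qed
      then show ?thesis unfolding e_def C_def sum_distrib_right by (rule sum_norm_le)
    qed
    \<comment> \<open>Pairing with \<open>q\<close> moves the symbol onto \<open>q\<close>: the
      oscillating terms together with the shift by \<zeta> form \<open>m\<close>, and what is left
      are the window terms \<open>e\<close>.\<close>
    have W'eq: "W' t - \<zeta> * W t = e t - cdot m (V t)" for t
    proof -
      have "cdot m (V t) = \<zeta> * W t + (\<Sum>l\<in>UNIV. (\<i> * of_real (\<eta> $ l)) * cdot q (A l *v V t))"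
        unfolding m_def cdot_left W_def cdot_vector_matrix_mult ..
      moreover have "W' t = e t - (\<Sum>l\<in>UNIV. (\<i> * of_real (\<eta> $ l)) * cdot q (A l *v V t))"
        unfolding W'_def e_def matrix_vector_mult_diff_distrib matrix_vector_smult cdot_diff cdot_smult
        by (rule sum_subtractf)
      ultimately show ?thesis by simp
    qed
    have "norm (W 0) \<le> (norm m * (2 * N\<^sup>2 * \<bar>K\<bar> * norm q) + C) / (Re \<zeta> - \<alpha>)"
    proof (rule laplace_bound[OF der])
      show "norm (W t) \<le> (norm q * (2 * N * (\<bar>K\<bar> * (N * norm q)))) * exp (\<alpha> * t)" if "t \<ge> 0" for t
        using order_trans[OF norm_cdot_le mult_left_mono[OF nV[OF that] norm_ge_zero]]
        by (simp add: W_def mult_ac)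
      show "norm (W' t - \<zeta> * W t) \<le> (norm m * (2 * N\<^sup>2 * \<bar>K\<bar> * norm q) + C) * exp (\<alpha> * t)" if "t \<ge> 0" for t
      proof -
        have "norm (W' t - \<zeta> * W t) \<le> norm (e t) + norm (cdot m (V t))"
          unfolding W'eq by (rule norm_triangle_ineq4)
        also have "\<dots> \<le> C * exp (\<alpha> * t) + norm m * (2 * N * (\<bar>K\<bar> * (N * norm q)) * exp (\<alpha> * t))"
          by (intro add_mono ne that order_trans[OF norm_cdot_le] mult_left_mono nV) simp
        finally show ?thesis by (simp add: algebra_simps power2_eq_square)
      qed
    qed (use \<zeta> in auto)
    moreover have "W 0 = of_real (N\<^sup>2 * (norm q)\<^sup>2)"
    proof -
      have "V 0 = mode_amplitude \<phi> \<eta> ?f"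
        unfolding V_def mode_amplitude_def
        using L2_AE_cong(2)[OF UL f U0] weight_trig[OF \<phi>(2)] by simp
      then show ?thesis
        by (simp add: W_def cdot_mode_amplitude_wave_packet[OF \<phi>(2)] r_def cdot_vec_cnj N_def)
    qed
    ultimately show "(weight_norm \<phi>)\<^sup>2 * (norm q)\<^sup>2 \<le>
     (norm (\<zeta> *s q + (\<Sum>l\<in>UNIV. (\<i> * of_real (\<eta> $ l)) *s (q v* A l))) * (2 * (weight_norm \<phi>)\<^sup>2 * \<bar>K\<bar> * norm q) + C) / (Re \<zeta> - \<alpha>)"
      by (simp add: m_def N_def norm_mult norm_power del: of_real_mult of_real_power)
  qed
qed

text \<open>The bound comes out for row vectors, because a component along \<open>q\<close> of the
  amplitude is estimated and the matrices have been moved onto \<open>q\<close>.\<close>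

lemma strongly_well_posed_left_resolvent_bound:
  fixes A :: "'d::finite \<Rightarrow> complex ^ 'n ^ 'n"
  assumes "strongly_well_posed A"
  obtains K where "K \<ge> 0" "\<And>\<xi> z q. Re z > 0 \<Longrightarrow>
    Re z * norm q \<le> K * norm (z *s q + (\<Sum>l\<in>UNIV. (\<i> * of_real (\<xi> $ l)) *s (q v* A l)))"
proof -
  obtain K \<alpha> where sol: "\<And>f. f \<in> L2 \<Longrightarrow>
      \<exists>U. cauchy_solution A f U \<and> (\<forall>t\<ge>0. L2_norm (U t) \<le> K * exp (\<alpha> * t) * L2_norm (U 0))"
    using assms unfolding strongly_well_posed_def by blast
  obtain \<phi> :: "real ^ 'd \<Rightarrow> real" where Ck: "\<And>k. Ck_on k UNIV \<phi>"
    and out: "\<And>x. x \<notin> cball 0 1 \<Longrightarrow> \<phi> x = 0" and \<phi>0: "\<phi> 0 > 0"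
    by (rule smooth_bump_exists) blast
  have w: "weight \<phi>" using Ck[of 0] out by (simp add: weight_def)
  have pos: "weight_norm \<phi> > 0"
  proof -
    have int: "integrable lborel (\<lambda>x. (\<phi> x)\<^sup>2)" by (rule weight_square_integrable[OF w])
    have "(\<integral>x. (\<phi> x)\<^sup>2 \<partial>lborel) \<noteq> 0"
    proof
      assume "(\<integral>x. (\<phi> x)\<^sup>2 \<partial>lborel) = 0"
      then have ae: "AE x in lborel. x \<notin> {x. \<phi> x > 0}"
        using integral_nonneg_eq_0_iff_AE[OF int] by (auto elim: eventually_mono)
      have op: "open {x. \<phi> x > 0}"
        using Ck[of 0] by (intro open_Collect_less) auto
      then have "{x. \<phi> x > 0} \<in> null_sets lborel" using ae by (subst AE_iff_null_sets) auto
      then have "negligible {x. \<phi> x > 0}" by (simp add: negligible_iff_null_sets null_sets_completionI)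
      then show False using \<phi>0 open_not_negligible[OF op] by auto
    qed
    moreover have "(\<integral>x. (\<phi> x)\<^sup>2 \<partial>lborel) \<ge> 0" by simp
    ultimately have "(\<integral>x. (\<phi> x)\<^sup>2 \<partial>lborel) > 0" by linarith
    then show ?thesis by (simp add: weight_norm_def)
  qed
  show ?thesis
  proof (rule that[of "2 * \<bar>K\<bar>"])
    fix \<xi> :: "real ^ 'd" and z q assume z: "Re z > 0"
    define N where "N = (weight_norm \<phi>)\<^sup>2"
    have N: "N > 0" using pos by (simp add: N_def)
    define m where "m = z *s q + (\<Sum>l\<in>UNIV. (\<i> * of_real (\<xi> $ l)) *s (q v* A l))"
    \<comment> \<open>\<open>C\<close> depends on \<open>q\<close>, which is fixed at this point; it
      stays constant while s tends to infinity.\<close>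
    have "\<exists>C. \<forall>\<eta> \<zeta>. Re \<zeta> > \<alpha> \<longrightarrow> N * (norm q)\<^sup>2 \<le>
     (norm (\<zeta> *s q + (\<Sum>l\<in>UNIV. (\<i> * of_real (\<eta> $ l)) *s (q v* A l))) * (2 * N * \<bar>K\<bar> * norm q) + C) / (Re \<zeta> - \<alpha>)"
      unfolding N_def by (rule left_resolvent_bound_scaled[OF Ck w pos], erule sol)
    then obtain C where C: "\<And>\<eta> \<zeta>. Re \<zeta> > \<alpha> \<Longrightarrow> N * (norm q)\<^sup>2 \<le>
     (norm (\<zeta> *s q + (\<Sum>l\<in>UNIV. (\<i> * of_real (\<eta> $ l)) *s (q v* A l))) * (2 * N * \<bar>K\<bar> * norm q) + C) / (Re \<zeta> - \<alpha>)"
      by blast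
    have "N * (norm q)\<^sup>2 \<le> (s * norm m * (2 * N * \<bar>K\<bar> * norm q) + C) / (s * Re z - \<alpha>)"
      if "s > 0" "s * Re z > \<alpha>" for s
    proof -
      have "(of_real s * z) *s q + (\<Sum>l\<in>UNIV. (\<i> * of_real ((s *\<^sub>R \<xi>) $ l)) *s (q v* A l)) = of_real s *s m"
        by (simp add: m_def vec_eq_iff sum_distrib_left algebra_simps)
      then show ?thesis using C[of "of_real s * z" "s *\<^sub>R \<xi>"] that by (simp add: norm_vector_smult)
    qed
    then have "\<forall>\<^sub>F s in at_top. N * (norm q)\<^sup>2 \<le> (s * norm m * (2 * N * \<bar>K\<bar> * norm q) + C) / (s * Re z - \<alpha>)"
      by (intro eventually_mono[OF eventually_conj[OF eventually_gt_at_top[of 0] eventually_gt_at_top[of "\<alpha> / Re z"]]])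
         (simp add: pos_divide_less_eq[OF z])
    moreover have "((\<lambda>s. (s * norm m * (2 * N * \<bar>K\<bar> * norm q) + C) / (s * Re z - \<alpha>)) \<longlongrightarrow>
       norm m * (2 * N * \<bar>K\<bar> * norm q) / Re z) at_top"
    proof -
      have "((\<lambda>s. (norm m * (2 * N * \<bar>K\<bar> * norm q) + C * inverse s) / (Re z - \<alpha> * inverse s)) \<longlongrightarrow>
       (norm m * (2 * N * \<bar>K\<bar> * norm q) + C * 0) / (Re z - \<alpha> * 0)) at_top"
        using z by (intro tendsto_intros tendsto_inverse_0_at_top filterlim_ident) auto
      moreover have "\<forall>\<^sub>F s in at_top. (norm m * (2 * N * \<bar>K\<bar> * norm q) + C * inverse s) / (Re z - \<alpha> * inverse s) =
          (s * norm m * (2 * N * \<bar>K\<bar> * norm q) + C) / (s * Re z - \<alpha>)"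
      proof (rule eventually_mono[OF eventually_gt_at_top[of 0]])
        fix s :: real assume "s > 0"
        then have "(norm m * (2 * N * \<bar>K\<bar> * norm q) + C * inverse s) / (Re z - \<alpha> * inverse s) =
          (s * (norm m * (2 * N * \<bar>K\<bar> * norm q) + C * inverse s)) / (s * (Re z - \<alpha> * inverse s))" by simp
        also have "\<dots> = (s * norm m * (2 * N * \<bar>K\<bar> * norm q) + C) / (s * Re z - \<alpha>)"
          using \<open>s > 0\<close> by (simp add: algebra_simps)
        finally show "(norm m * (2 * N * \<bar>K\<bar> * norm q) + C * inverse s) / (Re z - \<alpha> * inverse s) =
          (s * norm m * (2 * N * \<bar>K\<bar> * norm q) + C) / (s * Re z - \<alpha>)" .
      qed
      ultimately show ?thesis by (auto intro: Lim_transform_eventually)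
    qed
    ultimately have "N * (norm q)\<^sup>2 \<le> norm m * (2 * N * \<bar>K\<bar> * norm q) / Re z"
      by (intro tendsto_lowerbound) auto
    \<comment> \<open>One factor of the norm of \<open>q\<close> is common to both sides, as is
      \<open>N\<close>; cancelling them removes every trace of the window from the constant.\<close>
    then have "(N * norm q) * (Re z * norm q) \<le> (N * norm q) * (2 * \<bar>K\<bar> * norm m)"
      using z by (simp add: field_simps power2_eq_square)
    then show "Re z * norm q \<le> 2 * \<bar>K\<bar> * norm (z *s q + (\<Sum>l\<in>UNIV. (\<i> * of_real (\<xi> $ l)) *s (q v* A l)))"
      using N unfolding m_def[symmetric] by (cases "q = 0") auto
  qed simp
qed

text \<open>Duality turns the row estimate into a column estimate with the same constant: the row
  operator is injective by the estimate, hence onto in finite dimension, and the row vector that it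
  sends to the conjugate of \<open>v\<close> tests \<open>v\<close>.\<close>

lemma strongly_well_posed_resolvent_bound:
  fixes A :: "'d::finite \<Rightarrow> complex ^ 'n ^ 'n"
  assumes "strongly_well_posed A"
  obtains K where "K \<ge> 0" "\<And>\<xi> \<mu> v.
    \<bar>Im \<mu>\<bar> * norm v \<le> K * norm ((\<Sum>l\<in>UNIV. (\<xi> $ l) *\<^sub>R A l) *v v - \<mu> *s v)"
proof -
  obtain K where K: "K \<ge> 0" and left: "\<And>\<xi> z q. Re z > 0 \<Longrightarrow>
    Re z * norm q \<le> K * norm (z *s q + (\<Sum>l\<in>UNIV. (\<i> * of_real (\<xi> $ l)) *s (q v* A l)))"
    by (rule strongly_well_posed_left_resolvent_bound[OF assms]) blast
  let ?M = "\<lambda>\<xi>. \<Sum>l\<in>UNIV. (\<xi> $ l) *\<^sub>R A l"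
  have M: "?M \<xi> *v v = (\<Sum>l\<in>UNIV. of_real (\<xi> $ l) *s (A l *v v))" for \<xi> :: "real ^ 'd" and v
    by (simp add: vec_eq_iff matrix_vector_mult_def sum_component sum_distrib_left sum_distrib_right scaleR_conv_of_real[of _ "_ :: complex"] mult.assoc)
       (intro allI sum.swap)
  have pos: "Im \<mu> * norm v \<le> K * norm (?M \<xi> *v v - \<mu> *s v)" if \<mu>: "Im \<mu> > 0" for \<xi> \<mu> v
  proof -
    define z where "z = - \<i> * \<mu>"
    define T where "T q = z *s q + (\<Sum>l\<in>UNIV. (\<i> * of_real (\<xi> $ l)) *s (q v* A l))" for q
    have z: "Re z = Im \<mu>" by (simp add: z_def)
    have T: "Im \<mu> * norm q \<le> K * norm (T q)" for q
      using left[of z q \<xi>] z \<mu> by (simp add: T_def)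
    have lin: "linear T"
      by (rule linearI) (simp_all add: T_def vec_eq_iff vector_matrix_mult_def sum_component sum.distrib
          sum_distrib_left scaleR_conv_of_real[of _ "_ :: complex"] algebra_simps)
    have "inj T"
    proof (rule linear_injective_0[OF lin, THEN iffD2], intro allI impI)
      fix q assume "T q = 0"
      then have "norm q \<le> 0" using T[of q] \<mu> by (simp add: mult_le_0_iff)
      then show "q = 0" by simp
    qed
    then obtain q where q: "T q = vec_cnj v"
      using linear_injective_imp_surjective[OF lin] by (metis surjD)
    let ?R = "?M \<xi> *v v - \<mu> *s v"
    have "cdot (T q) v = cdot q (\<i> *s ?R)"
      unfolding T_def cdot_left cdot_vector_matrix_mult M
      by (simp add: cdot_smult cdot_diff cdot_sum z_def sum_distrib_left algebra_simps)
    then have "(norm v)\<^sup>2 = norm (cdot q (\<i> *s ?R))"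
      unfolding q cdot_vec_cnj by (metis norm_of_real abs_power2)
    also have "\<dots> \<le> norm q * norm ?R"
      using norm_cdot_le[of q "\<i> *s ?R"] unfolding norm_vector_smult[of \<i> ?R] by simp
    finally have "Im \<mu> * (norm v)\<^sup>2 \<le> (Im \<mu> * norm q) * norm ?R"
      using \<mu> by simp
    also have "\<dots> \<le> (K * norm v) * norm ?R"
      using T[of q] by (intro mult_right_mono) (simp_all add: q norm_vec_cnj)
    finally show ?thesis by (cases "v = 0") (auto simp: power2_eq_square mult_ac)
  qed
  show ?thesis
  proof (rule that[OF K])
    fix \<xi> :: "real ^ 'd" and \<mu> v
    consider "Im \<mu> > 0" | "Im \<mu> = 0" | "Im (- \<mu>) > 0" by fastforce
    then show "\<bar>Im \<mu>\<bar> * norm v \<le> K * norm (?M \<xi> *v v - \<mu> *s v)"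
    proof cases
      case 3
      \<comment> \<open>The symbol is odd in \<xi>, so reversing the signs of \<xi> and \<mu>
        together exchanges the two half planes.\<close>
      have "?M (- \<xi>) *v v - (- \<mu>) *s v = - (?M \<xi> *v v - \<mu> *s v)"
        unfolding M by (simp add: vec_eq_iff sum_negf)
      then show ?thesis using pos[OF 3, of v "- \<xi>"] 3 by (simp add: norm_minus_commute)
    qed (use pos[of \<mu> v \<xi>] K in auto)
  qed
qed

subsection \<open>Semisimple matrices with a uniform resolvent bound\<close>

lemma bounded_linear_smult_left: "bounded_linear (\<lambda>c. c *s (v :: complex ^ 'n))"
  by (rule bounded_linear_intro[of _ "norm v"]) (auto simp: norm_vector_smult vec_eq_iff distrib_right)

lemma smult_smult_diff: "c *s (a *s v) - b *s (c *s v) = (c * (a - b)) *s (v :: complex ^ 'n)"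
  by (simp add: vec_eq_iff algebra_simps)

text \<open>Multiplied out, so that no invertibility of M - \<mu> is presupposed; at real \<mu> the
  inequality is void, which leaves room for real eigenvalues.\<close>

definition resolvent_bound :: "real \<Rightarrow> complex ^ 'n ^ 'n \<Rightarrow> bool" where
  "resolvent_bound K M \<longleftrightarrow> K \<ge> 0 \<and> (\<forall>\<mu> v. \<bar>Im \<mu>\<bar> * norm v \<le> K * norm (M *v v - \<mu> *s v))"

lemma smult_of_real: "complex_of_real d *s v = d *\<^sub>R (v :: complex ^ 'n)"
  by (simp add: vec_eq_iff scaleR_conv_of_real[of _ "_ :: complex"])

lemma resolvent_boundD: "resolvent_bound K M \<Longrightarrow> \<bar>Im \<mu>\<bar> * norm v \<le> K * norm (M *v v - \<mu> *s v)"
  by (simp add: resolvent_bound_def)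

lemma resolvent_bound_real_eigenvalue:
  assumes "resolvent_bound K M" "M *v v = \<mu> *s v" "v \<noteq> 0"
  shows "Im \<mu> = 0"
  using resolvent_boundD[OF assms(1), of \<mu> v] assms(2,3) by (simp add: mult_le_0_iff)

lemma resolvent_bound_semisimple:
  assumes rb: "resolvent_bound K M" and u: "M *v u - \<mu> *s u = s" and s: "M *v s = \<mu> *s s"
  shows "s = 0"
proof (rule ccontr)
  assume "s \<noteq> 0"
  then have im: "Im \<mu> = 0" by (rule resolvent_bound_real_eigenvalue[OF rb s])
  have "norm (complex_of_real d *s u + \<i> *s s) \<le> K * d * norm u" if d: "d > 0" for d
  proof -
    \<comment> \<open>At \<mu> - i d the two contributions of \<open>s\<close> cancel: the residual
      of this vector is i d u, while its own norm is of order 1/d unless s = 0.\<close>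
    define v where "v = u + (\<i> / of_real d) *s s"
    define \<mu>' where "\<mu>' = \<mu> - \<i> * of_real d"
    have "M *v v - \<mu>' *s v = (\<i> * of_real d) *s u"
    proof -
      have "M *v v - \<mu>' *s v = (M *v u - \<mu> *s u) + (\<i> / of_real d) *s (M *v s - \<mu> *s s) + (\<i> * of_real d) *s v"
        by (simp add: v_def \<mu>'_def matrix_vector_right_distrib matrix_vector_smult vec_eq_iff algebra_simps)
      also have "\<dots> = (\<i> * of_real d) *s u"
        unfolding u s using d by (simp add: v_def vec_eq_iff algebra_simps)
      finally show ?thesis .
    qed
    moreover have "\<bar>Im \<mu>'\<bar> = d" using im d by (simp add: \<mu>'_def)
    ultimately have "d * norm v \<le> K * (d * norm u)"
      using resolvent_boundD[OF rb, of \<mu>' v] d by (simp add: norm_vector_smult norm_mult)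
    moreover have "norm (complex_of_real d *s u + \<i> *s s) = d * norm v"
    proof -
      have "complex_of_real d *s u + \<i> *s s = of_real d *s v"
        using d by (simp add: v_def vec_eq_iff algebra_simps)
      then show ?thesis using d by (simp add: norm_vector_smult)
    qed
    ultimately show ?thesis by simp
  qed
  then have ev: "\<forall>\<^sub>F d in at_right 0. norm (d *\<^sub>R u + \<i> *s s) \<le> K * d * norm u"
    by (auto simp: eventually_at_filter vec_eq_iff smult_of_real)
  have "((\<lambda>d. norm (d *\<^sub>R u + \<i> *s s)) \<longlongrightarrow> norm (0 *\<^sub>R u + \<i> *s s)) (at_right 0)"
    by (intro tendsto_intros)
  moreover have "((\<lambda>d. K * d * norm u) \<longlongrightarrow> K * 0 * norm u) (at_right 0)"
    by (intro tendsto_intros)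
  ultimately have "norm (\<i> *s s) \<le> 0"
    using tendsto_le[OF trivial_limit_at_right_real _ _ ev] by fastforce
  then show False using \<open>s \<noteq> 0\<close> by (simp add: norm_vector_smult)
qed

text \<open>After one factor is removed, the image of \<open>s\<close> is a sum of eigenvectors.
  Each component at an eigenvalue other than \<open>z\<close> is divided by \<mu> - z to find a
  preimage, and semisimplicity forces the component at \<open>z\<close> to vanish. Repeated roots in
  the list are allowed.\<close>

lemma sum_of_eigenvectors_of_annihilated:
  assumes rb: "resolvent_bound K M" and "foldl (\<lambda>v \<mu>. M *v v - \<mu> *s v) s zs = 0"
  shows "\<exists>S u. finite S \<and> card S \<le> length zs \<and> s = (\<Sum>\<mu>\<in>S. u \<mu>) \<and> (\<forall>\<mu>\<in>S. M *v u \<mu> = \<mu> *s u \<mu>)"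
  using assms(2)
proof (induction zs arbitrary: s)
  case Nil
  show ?case by (rule exI[of _ "{}"]) (use Nil in auto)
next
  case (Cons z zs)
  define t where "t = M *v s - z *s s"
  have "foldl (\<lambda>v \<mu>. M *v v - \<mu> *s v) t zs = 0" using Cons.prems by (simp add: t_def)
  from Cons.IH[OF this] obtain S u where S: "finite S" "card S \<le> length zs"
    and t: "t = (\<Sum>\<mu>\<in>S. u \<mu>)" and u: "\<And>\<mu>. \<mu> \<in> S \<Longrightarrow> M *v u \<mu> = \<mu> *s u \<mu>" by blast
  define R where "R = S - {z}"
  define r where "r = (\<Sum>\<mu>\<in>R. (1 / (\<mu> - z)) *s u \<mu>)"
  define u' where "u' \<mu> = (if \<mu> = z then s - r else (1 / (\<mu> - z)) *s u \<mu>)" for \<mu>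
  have Msum: "M *v (\<Sum>\<mu>\<in>I. f \<mu>) = (\<Sum>\<mu>\<in>I. M *v f \<mu>)" for I and f :: "complex \<Rightarrow> _"
    using linear_sum[OF bounded_linear.linear[OF bounded_linear_matrix_vector_complex]] .
  have ssum: "c *s (\<Sum>\<mu>\<in>I. f \<mu>) = (\<Sum>\<mu>\<in>I. c *s f \<mu>)" for I c and f :: "complex \<Rightarrow> complex ^ 'a"
    by (simp add: vec_eq_iff sum_component sum_distrib_left)
  have Mr: "M *v r - z *s r = (\<Sum>\<mu>\<in>R. u \<mu>)"
  proof -
    have "M *v r - z *s r = (\<Sum>\<mu>\<in>R. M *v ((1 / (\<mu> - z)) *s u \<mu>) - z *s ((1 / (\<mu> - z)) *s u \<mu>))"
      unfolding r_def Msum ssum by (rule sum_subtractf[symmetric])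
    also have "\<dots> = (\<Sum>\<mu>\<in>R. u \<mu>)"
    proof (rule sum.cong[OF refl])
      fix \<mu> assume "\<mu> \<in> R"
      then have "\<mu> - z \<noteq> 0" and M: "M *v u \<mu> = \<mu> *s u \<mu>" using u by (auto simp: R_def)
      then show "M *v ((1 / (\<mu> - z)) *s u \<mu>) - z *s ((1 / (\<mu> - z)) *s u \<mu>) = u \<mu>"
        unfolding matrix_vector_smult M smult_smult_diff by simp
    qed
    finally show ?thesis .
  qed
  \<comment> \<open>\<open>k\<close> is the component of \<open>t\<close> at \<open>z\<close>. A
    nonzero value would make \<open>s - r\<close> and \<open>k\<close> a Jordan chain.\<close>
  define k where "k = t - (\<Sum>\<mu>\<in>R. u \<mu>)"
  have k: "M *v (s - r) - z *s (s - r) = k"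
  proof -
    have "M *v (s - r) - z *s (s - r) = (M *v s - z *s s) - (M *v r - z *s r)"
      unfolding matrix_vector_mult_diff_distrib vec_eq_iff by (simp add: algebra_simps)
    then show ?thesis unfolding Mr k_def t_def .
  qed
  have "M *v k = z *s k"
  proof (cases "z \<in> S")
    case True
    then have "k = u z" using S(1) by (simp add: k_def t R_def sum.remove)
    then show ?thesis using u[OF True] by simp
  next
    case False
    then have "k = 0" by (simp add: k_def t R_def)
    then show ?thesis by simp
  qed
  then have "k = 0" by (rule resolvent_bound_semisimple[OF rb k])
  then have eig: "M *v (s - r) = z *s (s - r)" using k by simp
  show ?case
  proof (intro exI conjI ballI)
    show "finite (insert z R)" using S by (simp add: R_def)
    show "card (insert z R) \<le> length (z # zs)"
      using S card_Diff1_le[of S z] by (simp add: R_def card_insert_if)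
    have "(\<Sum>\<mu>\<in>R. u' \<mu>) = r" unfolding r_def
      by (rule sum.cong) (auto simp: u'_def R_def)
    then show "s = (\<Sum>\<mu>\<in>insert z R. u' \<mu>)"
      using sum.insert[of R z u'] S by (simp add: R_def u'_def[of z])
    show "M *v u' \<mu> = \<mu> *s u' \<mu>" if "\<mu> \<in> insert z R" for \<mu>
    proof (cases "\<mu> = z")
      case True
      then show ?thesis using eig by (simp add: u'_def)
    next
      case False
      then have "M *v u \<mu> = \<mu> *s u \<mu>" using that u by (simp add: R_def)
      then show ?thesis using False
        by (simp add: u'_def matrix_vector_smult vec_eq_iff mult.left_commute)
    qed
  qed
qed

section \<open>Annihilating polynomials and spectral decomposition\<close>

definition poly_apply :: "complex poly \<Rightarrow> complex ^ 'n ^ 'n \<Rightarrow> complex ^ 'n \<Rightarrow> complex ^ 'n" where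
  "poly_apply p M v = (\<Sum>i\<le>degree p. coeff p i *s (((*v) M ^^ i) v))"

lemma poly_apply_altdef:
  assumes "degree p \<le> n" shows "poly_apply p M v = (\<Sum>i\<le>n. coeff p i *s (((*v) M ^^ i) v))"
  unfolding poly_apply_def
  by (rule sum.mono_neutral_left) (use assms in \<open>auto simp: coeff_eq_0\<close>)

lemma matrix_power_linear:
  fixes M :: "complex ^ 'n ^ 'n"
  shows "((*v) M ^^ i) (u - c *s v) = ((*v) M ^^ i) u - c *s ((*v) M ^^ i) (v :: complex ^ 'n)"
  by (induction i arbitrary: u v) (simp_all add: matrix_vector_mult_diff_distrib matrix_vector_smult)

lemma poly_apply_linear_factor:
  "poly_apply ([:- a, 1:] * q) M v = poly_apply q M (M *v v - a *s v)"
proof -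
  let ?n = "degree q"
  have deg: "degree ([:- a, 1:] * q) \<le> Suc ?n"
    using degree_mult_le[of "[:- a, 1:]" q] by simp
  have c: "coeff ([:- a, 1:] * q) i = (case i of 0 \<Rightarrow> 0 | Suc j \<Rightarrow> coeff q j) - a * coeff q i" for i
    by (simp add: coeff_pCons)
  have "poly_apply ([:- a, 1:] * q) M v =
    (\<Sum>i\<le>Suc ?n. (case i of 0 \<Rightarrow> 0 | Suc j \<Rightarrow> coeff q j) *s (((*v) M ^^ i) v)) - (\<Sum>i\<le>Suc ?n. (a * coeff q i) *s (((*v) M ^^ i) v))"
    unfolding poly_apply_altdef[OF deg] c sum_subtractf[symmetric]
    by (rule sum.cong) (auto simp: vec_eq_iff algebra_simps)
  also have "(\<Sum>i\<le>Suc ?n. (case i of 0 \<Rightarrow> 0 | Suc j \<Rightarrow> coeff q j) *s (((*v) M ^^ i) v)) =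
      (\<Sum>i\<le>?n. coeff q i *s (((*v) M ^^ i) (M *v v)))"
    by (simp add: sum.atMost_Suc_shift funpow_swap1 del: sum.atMost_Suc)
  also have "(\<Sum>i\<le>Suc ?n. (a * coeff q i) *s (((*v) M ^^ i) v)) = (\<Sum>i\<le>?n. (a * coeff q i) *s (((*v) M ^^ i) v))"
    by (simp add: coeff_eq_0)
  also have "(\<Sum>i\<le>?n. coeff q i *s (((*v) M ^^ i) (M *v v))) - (\<Sum>i\<le>?n. (a * coeff q i) *s (((*v) M ^^ i) v)) =
      poly_apply q M (M *v v - a *s v)"
    unfolding poly_apply_def sum_subtractf[symmetric] matrix_power_linear
    by (rule sum.cong) (auto simp: vec_eq_iff algebra_simps)
  finally show ?thesis .
qed

lemma annihilating_roots:
  assumes "p \<noteq> 0" "poly_apply p M s = 0"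
  shows "\<exists>zs. length zs = degree p \<and> foldl (\<lambda>v \<mu>. M *v v - \<mu> *s v) s zs = 0"
  using assms
proof (induction "degree p" arbitrary: p s)
  case 0
  then obtain c where "p = [:c:]" by (metis degree_eq_zeroE)
  then have "s = 0" using 0 by (simp add: poly_apply_def)
  then show ?case using 0 by (intro exI[of _ "[]"]) simp
next
  case (Suc n)
  have "\<not> constant (poly p)" using Suc.hyps(2) by (simp add: constant_degree)
  then obtain a where "poly p a = 0" using fundamental_theorem_of_algebra by blast
  then obtain q where p: "p = [:- a, 1:] * q" by (metis dvdE poly_eq_0_iff_dvd)
  then have q0: "q \<noteq> 0" using Suc.prems by auto
  have "degree p = degree [:- a, 1:] + degree q" unfolding p by (rule degree_mult_eq) (use q0 in auto)
  then have dq: "degree q = n" using Suc.hyps(2) by simp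
  have "poly_apply q M (M *v s - a *s s) = 0"
    using Suc.prems(2) unfolding p poly_apply_linear_factor .
  from Suc.hyps(1)[OF dq[symmetric] q0 this] obtain zs where
    "length zs = n" "foldl (\<lambda>v \<mu>. M *v v - \<mu> *s v) (M *v s - a *s s) zs = 0" using dq by auto
  then show ?case using Suc.hyps(2) by (intro exI[of _ "a # zs"]) simp
qed

text \<open>One vector at a time suffices, so linear dependence of its first n + 1 iterates replaces
  the Cayley-Hamilton theorem.\<close>

lemma annihilating_polynomial:
  fixes M :: "complex ^ 'n ^ 'n"
  shows "\<exists>p. p \<noteq> 0 \<and> degree p \<le> CARD('n) \<and> poly_apply p M s = 0"
proof -
  let ?f = "\<lambda>i. ((*v) M ^^ i) s"
  let ?N = "CARD('n)"
  obtain c where c: "\<exists>i\<le>?N. c i \<noteq> 0" and sum: "(\<Sum>i\<le>?N. c i *s ?f i) = 0"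
  proof (cases "inj_on ?f {..?N}")
    case True
    have "card (?f ` {..?N}) = Suc ?N" using True by (simp add: card_image)
    then have "vec.dependent (?f ` {..?N})"
      using vec.independent_card_le_dim[of "?f ` {..?N}" UNIV] unfolding vec_dim_card by fastforce
    then obtain u where u: "\<exists>v\<in>?f ` {..?N}. u v \<noteq> 0" "(\<Sum>v\<in>?f ` {..?N}. u v *s v) = 0"
      using vec.dependent_finite[of "?f ` {..?N}"] by auto
    show ?thesis
      by (rule that[of "\<lambda>i. u (?f i)"]) (use u True in \<open>auto simp: sum.reindex\<close>)
  next
    case False
    \<comment> \<open>When two iterates coincide, the set of iterates is too small for the dimension
      count, but their difference is already a nontrivial relation.\<close>
    then obtain i j where ij: "i \<le> ?N" "j \<le> ?N" "i \<noteq> j" "?f i = ?f j" unfolding inj_on_def by auto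
    let ?c = "\<lambda>k. if k = i then 1 else if k = j then -1 else 0 :: complex"
    have "(\<Sum>k\<le>?N. ?c k *s ?f k) = (\<Sum>k\<in>{i,j}. ?c k *s ?f k)"
      by (rule sum.mono_neutral_right) (use ij in auto)
    also have "\<dots> = 0" using ij by (simp add: vec_eq_iff)
    finally show ?thesis by (rule that[of ?c, rotated]) (use ij in auto)
  qed
  define p where "p = (\<Sum>i\<le>?N. monom (c i) i)"
  have co: "coeff p i = (if i \<le> ?N then c i else 0)" for i
    by (simp add: p_def coeff_sum coeff_monom)
  have "p \<noteq> 0" using c co by (metis coeff_0)
  moreover have deg: "degree p \<le> ?N" by (rule degree_le) (simp add: co)
  moreover have "poly_apply p M s = 0" unfolding poly_apply_altdef[OF deg] using sum co by simp
  ultimately show ?thesis by blast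
qed

text \<open>The bound on the number of components depends on the dimension only and keeps the later
  projection estimate uniform over all frequencies.\<close>

lemma eigenvector_decomposition:
  fixes M :: "complex ^ 'n ^ 'n"
  assumes "resolvent_bound K M"
  obtains S u where "finite S" "card S \<le> CARD('n)" "s = (\<Sum>\<mu>\<in>S. u \<mu>)" "\<And>\<mu>. \<mu> \<in> S \<Longrightarrow> M *v u \<mu> = \<mu> *s u \<mu>"
proof -
  obtain p where p: "p \<noteq> 0" "degree p \<le> CARD('n)" "poly_apply p M s = 0"
    using annihilating_polynomial by blast
  then obtain zs where zs: "length zs = degree p" "foldl (\<lambda>v \<mu>. M *v v - \<mu> *s v) s zs = 0"
    using annihilating_roots by blast
  from sum_of_eigenvectors_of_annihilated[OF assms zs(2)] obtain S u where
    "finite S" "card S \<le> length zs" "s = (\<Sum>\<mu>\<in>S. u \<mu>)" "\<forall>\<mu>\<in>S. M *v u \<mu> = \<mu> *s u \<mu>" by blast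
  then show ?thesis by (intro that[of S u]) (use p(2) zs(1) in auto)
qed

text \<open>The operators d (M - \<nu> - i d)^{-1} are bounded by \<open>K\<close> for all d > 0,
  and as d tends to 0 they converge to i times the spectral projection at \<nu>.\<close>

lemma norm_eigencomponent_le:
  assumes rb: "resolvent_bound K M" and S: "finite S" "\<nu> \<in> S" and u: "\<And>\<mu>. \<mu> \<in> S \<Longrightarrow> M *v u \<mu> = \<mu> *s u \<mu>"
  shows "norm (u \<nu>) \<le> K * norm (\<Sum>\<mu>\<in>S. u \<mu>)"
proof (cases "u \<nu> = 0")
  case True
  then show ?thesis using rb by (simp add: resolvent_bound_def)
next
  case False
  have im: "Im \<mu> = 0" if "\<mu> \<in> S" "u \<mu> \<noteq> 0" for \<mu>
    using resolvent_bound_real_eigenvalue[OF rb u[OF that(1)] that(2)] .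
  define g where "g d = (\<Sum>\<mu>\<in>S. (of_real d / (\<mu> - (\<nu> + \<i> * of_real d))) *s u \<mu>)" for d
  have ineq: "norm (g d) \<le> K * norm (\<Sum>\<mu>\<in>S. u \<mu>)" if d: "d > 0" for d
  proof -
    define \<mu>' where "\<mu>' = \<nu> + \<i> * of_real d"
    define v where "v = (\<Sum>\<mu>\<in>S. (1 / (\<mu> - \<mu>')) *s u \<mu>)"
    have "M *v v - \<mu>' *s v = (\<Sum>\<mu>\<in>S. M *v ((1 / (\<mu> - \<mu>')) *s u \<mu>) - \<mu>' *s ((1 / (\<mu> - \<mu>')) *s u \<mu>))"
      unfolding v_def linear_sum[OF bounded_linear.linear[OF bounded_linear_matrix_vector_complex]]
        linear_sum[OF bounded_linear.linear[OF bounded_linear_vector_smult]]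
      by (rule sum_subtractf[symmetric])
    also have "\<dots> = (\<Sum>\<mu>\<in>S. u \<mu>)"
    proof (rule sum.cong[OF refl])
      fix \<mu> assume \<mu>: "\<mu> \<in> S"
      \<comment> \<open>The index set may contain numbers that are no eigenvalues. Their components
        are 0, and only for them could the denominator vanish; genuine eigenvalues are real and stay
        off \<mu>'.\<close>
      show "M *v ((1 / (\<mu> - \<mu>')) *s u \<mu>) - \<mu>' *s ((1 / (\<mu> - \<mu>')) *s u \<mu>) = u \<mu>"
      proof (cases "u \<mu> = 0")
        case False
        have "Im (\<mu> - \<mu>') = - d" using im[OF \<mu> False] im[OF S(2) \<open>u \<nu> \<noteq> 0\<close>] by (simp add: \<mu>'_def)
        then have "\<mu> - \<mu>' \<noteq> 0" using d by auto
        then show ?thesis unfolding matrix_vector_smult u[OF \<mu>] smult_smult_diff by simp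
      qed simp
    qed
    finally have "d * norm v \<le> K * norm (\<Sum>\<mu>\<in>S. u \<mu>)"
      using resolvent_boundD[OF rb, of \<mu>' v] im[OF S(2) False] d by (simp add: \<mu>'_def)
    moreover have "g d = of_real d *s v"
      by (simp add: g_def v_def \<mu>'_def vec_eq_iff sum_component sum_distrib_left)
    ultimately show ?thesis using d by (simp add: norm_vector_smult)
  qed
  have "(g \<longlongrightarrow> (\<Sum>\<mu>\<in>S. (if \<mu> = \<nu> then \<i> else 0) *s u \<mu>)) (at_right 0)"
    unfolding g_def
  proof (intro tendsto_sum bounded_linear.tendsto[OF bounded_linear_smult_left])
    fix \<mu> assume "\<mu> \<in> S"
    show "((\<lambda>d. complex_of_real d / (\<mu> - (\<nu> + \<i> * of_real d))) \<longlongrightarrow> (if \<mu> = \<nu> then \<i> else 0)) (at_right 0)"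
    proof (cases "\<mu> = \<nu>")
      case True
      have "((\<lambda>d. \<i>) \<longlongrightarrow> \<i>) (at_right (0::real))" by (rule tendsto_const)
      moreover have "\<forall>\<^sub>F d in at_right 0. \<i> = complex_of_real d / (\<mu> - (\<nu> + \<i> * of_real d))"
        using True by (auto simp: eventually_at_filter field_simps)
      ultimately show ?thesis using True by (auto intro: Lim_transform_eventually)
    next
      case False
      have "((\<lambda>d. complex_of_real d / (\<mu> - (\<nu> + \<i> * of_real d))) \<longlongrightarrow> of_real 0 / (\<mu> - (\<nu> + \<i> * of_real 0))) (at_right 0)"
        using False by (intro tendsto_intros) auto
      then show ?thesis using False by simp
    qed
  qed
  moreover have "(\<Sum>\<mu>\<in>S. (if \<mu> = \<nu> then \<i> else 0) *s u \<mu>) = \<i> *s u \<nu>"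
  proof -
    have "(\<Sum>\<mu>\<in>S. (if \<mu> = \<nu> then \<i> else 0) *s u \<mu>) = (\<Sum>\<mu>\<in>S. if \<nu> = \<mu> then \<i> *s u \<mu> else 0)"
      by (rule sum.cong) auto
    then show ?thesis using S by simp
  qed
  ultimately have "((\<lambda>d. norm (g d)) \<longlongrightarrow> norm (\<i> *s u \<nu>)) (at_right 0)"
    using tendsto_norm by metis
  then have "norm (\<i> *s u \<nu>) \<le> K * norm (\<Sum>\<mu>\<in>S. u \<mu>)"
    by (rule tendsto_upperbound) (auto simp: eventually_at_filter ineq)
  then show ?thesis by (simp add: norm_vector_smult)
qed

text \<open>The constant depends on \<open>M\<close> only through \<open>K\<close> and \<open>\<delta>\<close>.  This replaces a comparison of the
  multiplicities of neighbouring eigenspaces.\<close>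

lemma eigenspace_projection_bound:
  fixes M :: "complex ^ 'n ^ 'n"
  assumes rb: "resolvent_bound K M" and \<delta>: "\<delta> > 0"
    and gap: "\<And>\<mu> v. v \<noteq> 0 \<Longrightarrow> M *v v = of_real \<mu> *s v \<Longrightarrow> \<bar>\<mu> - \<kappa>\<bar> < \<delta> \<Longrightarrow> \<mu> = \<kappa>"
  obtains s' where "M *v s' = of_real \<kappa> *s s'"
    "norm (s - s') \<le> CARD('n) * (K / \<delta>) * norm (M *v s - of_real \<kappa> *s s)"
proof -
  obtain S u where S: "finite S" "card S \<le> CARD('n)" and s: "s = (\<Sum>\<mu>\<in>S. u \<mu>)"
    and u: "\<And>\<mu>. \<mu> \<in> S \<Longrightarrow> M *v u \<mu> = \<mu> *s u \<mu>"
    by (rule eigenvector_decomposition[OF rb]) blast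
  let ?\<kappa> = "complex_of_real \<kappa>"
  \<comment> \<open>The component of \<open>s\<close> in the eigenspace of \<kappa>, with value 0
    when \<kappa> does not occur in the decomposition.\<close>
  define s' where "s' = (if ?\<kappa> \<in> S then u ?\<kappa> else 0)"
  have K: "K \<ge> 0" using rb by (simp add: resolvent_bound_def)
  have B: "M *v s - ?\<kappa> *s s = (\<Sum>\<mu>\<in>S. (\<mu> - ?\<kappa>) *s u \<mu>)"
    unfolding s linear_sum[OF bounded_linear.linear[OF bounded_linear_matrix_vector_complex]]
      linear_sum[OF bounded_linear.linear[OF bounded_linear_vector_smult]] sum_subtractf[symmetric]
    by (rule sum.cong) (auto simp: u vec_eq_iff algebra_simps)
  \<comment> \<open>The component of (M - \<kappa>) s at \<mu> is (\<mu> - \<kappa>) times that of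
    \<open>s\<close>. The gap bounds this factor below by \<delta>, and the projection estimate
    bounds the product by the whole of (M - \<kappa>) s.\<close>
  have comp: "norm (u \<mu>) \<le> (K / \<delta>) * norm (M *v s - ?\<kappa> *s s)" if \<mu>: "\<mu> \<in> S - {?\<kappa>}" for \<mu>
  proof (cases "u \<mu> = 0")
    case True
    then show ?thesis using K \<delta> by simp
  next
    case False
    have M: "M *v u \<mu> = \<mu> *s u \<mu>" using u \<mu> by auto
    have "Im \<mu> = 0" using resolvent_bound_real_eigenvalue[OF rb M False] .
    then have re: "\<mu> = of_real (Re \<mu>)" by (simp add: complex_eq_iff)
    have "\<not> \<bar>Re \<mu> - \<kappa>\<bar> < \<delta>"
    proof
      assume "\<bar>Re \<mu> - \<kappa>\<bar> < \<delta>"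
      then have "Re \<mu> = \<kappa>" using gap[OF False, of "Re \<mu>"] M re by simp
      then show False using \<mu> re by simp
    qed
    moreover have "norm (\<mu> - ?\<kappa>) = \<bar>Re \<mu> - \<kappa>\<bar>" by (subst re) (metis norm_of_real of_real_diff)
    ultimately have "\<delta> * norm (u \<mu>) \<le> norm (\<mu> - ?\<kappa>) * norm (u \<mu>)" by (intro mult_right_mono) auto
    also have "\<dots> = norm ((\<mu> - ?\<kappa>) *s u \<mu>)" by (rule norm_vector_smult[symmetric])
    also have "\<dots> \<le> K * norm (\<Sum>\<mu>\<in>S. (\<mu> - ?\<kappa>) *s u \<mu>)"
    proof (rule norm_eigencomponent_le[OF rb S(1)])
      show "M *v ((\<mu>' - ?\<kappa>) *s u \<mu>') = \<mu>' *s ((\<mu>' - ?\<kappa>) *s u \<mu>')" if "\<mu>' \<in> S" for \<mu>'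
        unfolding matrix_vector_smult u[OF that] vector_smult_assoc by (simp only: mult.commute)
    qed (use \<mu> in auto)
    finally show ?thesis unfolding B using \<delta> by (simp add: field_simps)
  qed
  show ?thesis
  proof (rule that[of s'])
    show "M *v s' = ?\<kappa> *s s'" using u by (simp add: s'_def)
    have "s - s' = (\<Sum>\<mu>\<in>S - {?\<kappa>}. u \<mu>)"
      using S(1) by (simp add: s s'_def sum.remove)
    then have "norm (s - s') \<le> of_nat (card (S - {?\<kappa>})) * ((K / \<delta>) * norm (M *v s - ?\<kappa> *s s))"
      using sum_norm_bound[of "S - {?\<kappa>}" u, OF comp] by simp
    also have "\<dots> \<le> of_nat CARD('n) * ((K / \<delta>) * norm (M *v s - ?\<kappa> *s s))"
      using S card_Diff1_le[of S "?\<kappa>"] K \<delta> by (intro mult_right_mono) auto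
    finally show "norm (s - s') \<le> CARD('n) * (K / \<delta>) * norm (M *v s - ?\<kappa> *s s)" by (simp add: mult.assoc)
  qed
qed

subsection \<open>Characteristic variety\<close>

lemma L_symbol_mult: "L_symbol A \<tau> \<xi> *v v = (\<Sum>l\<in>UNIV. (\<xi> $ l) *\<^sub>R A l) *v v - of_real (- \<tau>) *s v"
proof -
  have "mat (complex_of_real \<tau>) *v v = of_real \<tau> *s v"
    by (simp add: vec_eq_iff matrix_vector_mult_def mat_def if_distrib[of "\<lambda>x. x * _"] cong: if_cong)
  then show ?thesis by (simp add: L_symbol_def matrix_vector_mult_add_rdistrib vec_eq_iff)
qed

lemma L_symbol_mult_sum: "L_symbol A \<tau> \<xi> *v v = \<tau> *\<^sub>R v + (\<Sum>l\<in>UNIV. (\<xi> $ l) *\<^sub>R (A l *v v))"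
proof -
  have "(\<Sum>l\<in>UNIV. (\<xi> $ l) *\<^sub>R A l) *v v = (\<Sum>l\<in>UNIV. (\<xi> $ l) *\<^sub>R (A l *v v))"
    by (simp add: vec_eq_iff matrix_vector_mult_def sum_component sum_distrib_right scaleR_sum_right)
       (intro allI sum.swap)
  then show ?thesis unfolding L_symbol_mult smult_of_real by simp
qed

lemma L_symbol_singular_iff: "det (L_symbol A \<tau> \<xi>) = 0 \<longleftrightarrow> (\<exists>v. v \<noteq> 0 \<and> L_symbol A \<tau> \<xi> *v v = 0)"
  using matrix_left_invertible_ker[of "L_symbol A \<tau> \<xi>"] invertible_left_inverse[of "L_symbol A \<tau> \<xi>"]
    invertible_det_nz[of "L_symbol A \<tau> \<xi>"] by blast

lemma smooth_variety_eq:
  assumes "smooth_variety A \<tau> \<xi> \<tau>f" "(\<tau>, \<xi>) \<in> char_variety A"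
  shows "\<tau>f \<xi> = \<tau>"
  using assms unfolding smooth_variety_def by fastforce

text \<open>With the spectral projection \<open>P\<close> onto the kernel this reads \<open>P A\<^sub>l P = - \<partial>\<^sub>l\<tau> P\<close>.\<close>

lemma symbol_derivative_in_range:
  fixes A :: "'d::finite \<Rightarrow> complex ^ 'n ^ 'n"
  assumes rb: "\<And>\<eta>. resolvent_bound K (\<Sum>l\<in>UNIV. (\<eta> $ l) *\<^sub>R A l)"
    and sv: "smooth_variety A \<tau> \<xi> \<tau>f" and \<tau>: "\<tau>f \<xi> = \<tau>" and s: "L_symbol A \<tau> \<xi> *v s = 0"
  shows "(grad \<tau>f \<xi> $ l) *\<^sub>R s + A l *v s \<in> range ((*v) (L_symbol A \<tau> \<xi>))"
proof -
  obtain V W where V: "smooth_on V \<tau>f" "\<xi> \<in> V" and W: "open W" "(\<tau>, \<xi>) \<in> W"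
    and var: "\<And>\<tau>' \<eta>. (\<tau>', \<eta>) \<in> W \<Longrightarrow> (\<tau>', \<eta>) \<in> char_variety A \<longleftrightarrow> \<tau>' = \<tau>f \<eta>" and \<xi>0: "\<xi> \<noteq> 0"
    using sv unfolding smooth_variety_def by blast
  let ?e = "axis l (1::real)"
  let ?B = "L_symbol A \<tau> \<xi>"
  define x where "x h = \<xi> + h *\<^sub>R ?e" for h
  define T where "T h = \<tau>f (x h)" for h
  let ?F = "at_right (0::real)"
  have "Ck_on (Suc 0) V \<tau>f" using V(1) by (simp add: smooth_on_def)
  then have "\<tau>f differentiable at \<xi>" using V(2) by auto
  then have d: "(\<tau>f has_derivative frechet_derivative \<tau>f (at \<xi>)) (at (x 0))"
    by (simp add: frechet_derivative_works x_def)
  have dx: "(x has_derivative (\<lambda>h. h *\<^sub>R ?e)) (at 0)"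
    unfolding x_def by (auto intro!: derivative_eq_intros)
  have "linear (frechet_derivative \<tau>f (at \<xi>))" using d has_derivative_linear by blast
  then have "(T has_derivative (\<lambda>h. h * grad \<tau>f \<xi> $ l)) (at 0)"
    using has_derivative_compose[OF dx d] by (simp add: T_def[abs_def] grad_def linear_cmul)
  then have DT: "(T has_real_derivative (grad \<tau>f \<xi> $ l)) (at 0)"
    by (simp add: has_field_derivative_def mult_commute_abs)
  have T0: "T 0 = \<tau>" using \<tau> by (simp add: T_def x_def)
  have quot: "((\<lambda>h. (T h - \<tau>) / h) \<longlongrightarrow> grad \<tau>f \<xi> $ l) ?F"
    using DT T0 unfolding has_field_derivative_iff by (auto intro: tendsto_within_subset)
  have Tlim: "(T \<longlongrightarrow> \<tau>) ?F"
    using DERIV_isCont[OF DT] T0 unfolding isCont_def by (auto intro: tendsto_within_subset)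
  have xlim: "(x \<longlongrightarrow> \<xi>) ?F"
  proof -
    have "(x \<longlongrightarrow> \<xi> + 0 *\<^sub>R ?e) ?F" unfolding x_def by (intro tendsto_intros)
    then show ?thesis by simp
  qed
  obtain e where e: "e > 0" "ball (\<tau>, \<xi>) e \<subseteq> W" using W by (meson open_contains_ball)
  \<comment> \<open>The radius is divided by three: one part each for the distance of \<mu> from - T
    h, of T h from \<tau>, and of x h from \<xi>. The resulting constant does not depend on
    h.\<close>
  define C where "C = CARD('n) * (K / (e / 3))"
  have C0: "C \<ge> 0" using rb[of 0] e by (simp add: C_def resolvent_bound_def)
  have "\<forall>\<^sub>F h in ?F. dist (T h) \<tau> < e / 3" using tendstoD[OF Tlim, of "e / 3"] e by simp
  moreover have "\<forall>\<^sub>F h in ?F. dist (x h) \<xi> < e / 3" using tendstoD[OF xlim, of "e / 3"] e by simp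
  moreover have "\<forall>\<^sub>F h in ?F. x h \<noteq> 0" using tendsto_imp_eventually_ne[OF xlim \<xi>0] .
  ultimately have "\<forall>\<^sub>F h in ?F. \<exists>s'. L_symbol A (T h) (x h) *v s' = 0 \<and> norm (s - s') \<le> C * norm (L_symbol A (T h) (x h) *v s)"
  proof eventually_elim
    case (elim h)
    let ?M = "\<Sum>l\<in>UNIV. (x h $ l) *\<^sub>R A l"
    \<comment> \<open>An eigenvalue this close to - T h gives a characteristic point inside
      \<open>W\<close>, and there the variety is the graph of the parametrization. This is where its
      being the only sheet nearby is used.\<close>
    have gap: "\<mu> = - T h" if v: "v \<noteq> 0" "?M *v v = of_real \<mu> *s v" and \<mu>: "\<bar>\<mu> - (- T h)\<bar> < e / 3" for \<mu> v
    proof -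
      have "dist (- \<mu>, x h) (\<tau>, \<xi>) \<le> \<bar>- \<mu> - \<tau>\<bar> + dist (x h) \<xi>"
        unfolding dist_Pair_Pair using sqrt_sum_squares_le_sum_abs[of "dist (- \<mu>) \<tau>" "dist (x h) \<xi>"] by (simp add: dist_real_def)
      also have "\<dots> < e" using elim \<mu> e unfolding dist_real_def by linarith
      finally have W': "(- \<mu>, x h) \<in> W" using e(2) by (auto simp: dist_commute)
      have "L_symbol A (- \<mu>) (x h) *v v = 0" unfolding L_symbol_mult v(2) by simp
      then have "(- \<mu>, x h) \<in> char_variety A"
        using v(1) elim L_symbol_singular_iff[of A "- \<mu>" "x h"] by (auto simp: char_variety_def zero_prod_def)
      then show ?thesis using var[OF W'] by (simp add: T_def)
    qed
    obtain s' where "?M *v s' = of_real (- T h) *s s'"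
      "norm (s - s') \<le> CARD('n) * (K / (e / 3)) * norm (?M *v s - of_real (- T h) *s s)"
      by (rule eigenspace_projection_bound[OF rb, of "e / 3" "x h" "- T h" s]) (use e gap in auto)
    then show ?case by (intro exI[of _ s']) (simp add: L_symbol_mult C_def)
  qed
  then obtain s' where s': "\<forall>\<^sub>F h in ?F. L_symbol A (T h) (x h) *v s' h = 0 \<and>
      norm (s - s' h) \<le> C * norm (L_symbol A (T h) (x h) *v s)"
    unfolding eventually_ex by blast
  have diff: "L_symbol A (T h) (x h) *v v = ?B *v v + ((T h - \<tau>) *\<^sub>R v + h *\<^sub>R (A l *v v))" for h v
  proof -
    have "(\<Sum>k\<in>UNIV. (x h $ k) *\<^sub>R (A k *v v)) = (\<Sum>k\<in>UNIV. (\<xi> $ k) *\<^sub>R (A k *v v)) + (\<Sum>k\<in>UNIV. if k = l then h *\<^sub>R (A k *v v) else 0)"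
      unfolding sum.distrib[symmetric] by (rule sum.cong) (auto simp: x_def axis_def scaleR_add_left)
    then show ?thesis unfolding L_symbol_mult_sum by (simp add: scaleR_diff_left)
  qed
  \<comment> \<open>As \<open>s\<close> is in the kernel at h = 0, the symbol at h maps it to a
    vector tending to 0, and the constant \<open>C\<close> transfers this to the distance from
    \<open>s\<close> to the nearby kernel.\<close>
  have s'lim: "(s' \<longlongrightarrow> s) ?F"
  proof -
    have "((\<lambda>h. C * norm ((T h - \<tau>) *\<^sub>R s + h *\<^sub>R (A l *v s))) \<longlongrightarrow> C * norm ((\<tau> - \<tau>) *\<^sub>R s + 0 *\<^sub>R (A l *v s))) ?F"
      by (intro tendsto_intros Tlim)
    then have "((\<lambda>h. C * norm ((T h - \<tau>) *\<^sub>R s + h *\<^sub>R (A l *v s))) \<longlongrightarrow> 0) ?F" by simp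
    then have "((\<lambda>h. s - s' h) \<longlongrightarrow> 0) ?F"
      by (rule Lim_null_comparison[rotated]) (use s' in eventually_elim, auto simp: diff s)
    then have "((\<lambda>h. s - (s - s' h)) \<longlongrightarrow> s - 0) ?F" by (intro tendsto_intros)
    then show ?thesis by simp
  qed
  have "((\<lambda>h. ((T h - \<tau>) / h) *\<^sub>R s' h + A l *v s' h) \<longlongrightarrow> (grad \<tau>f \<xi> $ l) *\<^sub>R s + A l *v s) ?F"
    by (intro tendsto_intros quot s'lim bounded_linear.tendsto[OF bounded_linear_matrix_vector_complex])
  \<comment> \<open>Expanding the kernel equation at h around h = 0 and dividing by h shows that the
    difference quotient is the image of - s'(h)/h. These preimages need not converge, but the range
    is closed, so the limit of the quotients stays in it.\<close>
  moreover have "\<forall>\<^sub>F h in ?F. ((T h - \<tau>) / h) *\<^sub>R s' h + A l *v s' h \<in> range ((*v) ?B)"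
    using s' eventually_at_right_less[of 0]
  proof eventually_elim
    case (elim h)
    have lin: "?B *v (c *\<^sub>R v) = c *\<^sub>R (?B *v v)" for c v
      using linear_cmul[OF bounded_linear.linear[OF bounded_linear_matrix_vector_complex]] .
    have "(T h - \<tau>) *\<^sub>R s' h + h *\<^sub>R (A l *v s' h) = - (?B *v s' h)"
      using elim diff[of h "s' h"] by (simp add: eq_neg_iff_add_eq_0 add.commute)
    then have "(1 / h) *\<^sub>R ((T h - \<tau>) *\<^sub>R s' h + h *\<^sub>R (A l *v s' h)) = ?B *v ((- 1 / h) *\<^sub>R s' h)"
      unfolding lin by simp
    moreover have "(1 / h) *\<^sub>R ((T h - \<tau>) *\<^sub>R s' h + h *\<^sub>R (A l *v s' h)) = ((T h - \<tau>) / h) *\<^sub>R s' h + A l *v s' h"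
      using elim by (simp add: scaleR_add_right)
    ultimately show ?case by (metis rangeI)
  qed
  moreover have "closed (range ((*v) ?B))"
    by (intro closed_subspace linear_subspace_image subspace_UNIV bounded_linear.linear bounded_linear_matrix_vector_complex)
  ultimately show ?thesis
    by (intro Lim_in_closed_set[where F = ?F]) auto
qed

subsection \<open>Transport of the leading amplitude\<close>

lemma locally_bigo_tendsto_0:
  assumes "locally_bigo \<Omega> (Suc n) F" "p \<in> \<Omega>"
  shows "((\<lambda>\<epsilon>. (1 / \<epsilon> ^ n) *\<^sub>R F \<epsilon> p) \<longlongrightarrow> 0) (at_right 0)"
proof -
  have "compact {p} \<and> {p} \<subseteq> \<Omega>" using assms(2) by simp
  then obtain C where C: "\<forall>\<^sub>F \<epsilon> in at_right 0. \<forall>q\<in>{p}. norm (F \<epsilon> q) \<le> C * \<epsilon> ^ Suc n"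
    using assms(1) unfolding locally_bigo_def by blast
  show ?thesis
  proof (rule Lim_null_comparison)
    show "\<forall>\<^sub>F \<epsilon> in at_right 0. norm ((1 / \<epsilon> ^ n) *\<^sub>R F \<epsilon> p) \<le> C * \<epsilon>"
      using C eventually_at_right_less[of 0]
      by eventually_elim (simp add: field_simps)
    show "((\<lambda>\<epsilon>. C * \<epsilon>) \<longlongrightarrow> 0) (at_right 0)"
      by (rule tendsto_mult_right_zero) (rule tendsto_ident_at)
  qed
qed

text \<open>Derivative and value are separate arguments, on which the row depends linearly. The
  expansion, the remainder and the exact family can then be compared by algebra at a single
  point.\<close>

definition split_row ::
  "('d \<Rightarrow> complex ^ 'n ^ 'n) \<Rightarrow> real \<Rightarrow> 'd::finite \<Rightarrow>
   (real \<times> (real ^ 'd) \<Rightarrow> complex ^ 'n ^ 'd) \<Rightarrow> complex ^ 'n ^ 'd \<Rightarrow> complex ^ 'n" where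
  "split_row A s l D u = D (1, 0) $ l + A l *v (\<Sum>j\<in>UNIV. D (0, axis l 1) $ j) + s *\<^sub>R (u $ l)"

lemma split_op_row:
  fixes U :: "real \<times> (real ^ 'd) \<Rightarrow> complex ^ 'n ^ 'd"
  assumes "(U has_derivative D) (at p)"
  shows "split_op A \<sigma> U p $ l = split_row A (\<sigma> l (snd p $ l)) l D (U p)"
proof -
  have c: "((\<lambda>q. U q $ j) has_derivative (\<lambda>h. D h $ j)) (at p)" for j
    by (rule bounded_linear.has_derivative[OF bounded_linear_vec_nth assms])
  have s: "((\<lambda>q. \<Sum>j\<in>UNIV. U q $ j) has_derivative (\<lambda>h. \<Sum>j\<in>UNIV. D h $ j)) (at p)"
    by (rule has_derivative_sum) (rule c)
  show ?thesis
    unfolding split_op_def split_row_def deriv_t_def deriv_x_def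
      frechet_derivative_at[OF s, symmetric] frechet_derivative_at[OF c, symmetric] by simp
qed

lemma split_row_diff:
  "split_row A s l (\<lambda>h. D h - D' h) (u - u') = split_row A s l D u - split_row A s l D' u'"
  by (simp add: split_row_def sum_subtractf matrix_vector_mult_diff_distrib scaleR_diff_right)

lemma tendsto_split_row:
  assumes "((\<lambda>\<epsilon>. D \<epsilon> (1, 0)) \<longlongrightarrow> 0) F" "((\<lambda>\<epsilon>. D \<epsilon> (0, axis l 1)) \<longlongrightarrow> 0) F" "(u \<longlongrightarrow> 0) F"
  shows "((\<lambda>\<epsilon>. split_row A s l (D \<epsilon>) (u \<epsilon>)) \<longlongrightarrow> 0) F"
proof -
  have S: "((\<lambda>\<epsilon>. \<Sum>j\<in>UNIV. D \<epsilon> (0, axis l 1) $ j) \<longlongrightarrow> (\<Sum>j\<in>UNIV. 0 $ j)) F"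
    using tendsto_sum[of UNIV "\<lambda>j \<epsilon>. D \<epsilon> (0, axis l 1) $ j" "\<lambda>j. 0 $ j" F] tendsto_vec_nth[OF assms(2)] by simp
  have "((\<lambda>\<epsilon>. split_row A s l (D \<epsilon>) (u \<epsilon>)) \<longlongrightarrow> 0 $ l + A l *v (\<Sum>j\<in>UNIV. 0 $ j) + s *\<^sub>R (0 $ l)) F"
    unfolding split_row_def
    by (intro tendsto_add tendsto_vec_nth tendsto_scaleR tendsto_const
        bounded_linear.tendsto[OF bounded_linear_matrix_vector_complex S] assms)
  then show ?thesis by simp
qed

section \<open>Equations for the first two amplitudes\<close>

definition phase :: "real \<Rightarrow> real ^ 'd \<Rightarrow> real \<times> (real ^ 'd) \<Rightarrow> real" where
  "phase \<tau> \<xi> p = fst p * \<tau> + snd p \<bullet> \<xi>"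

lemma has_derivative_componentwise_vec:
  fixes f :: "'a::real_normed_vector \<Rightarrow> 'b::euclidean_space ^ 'm"
  shows "(f has_derivative f') (at x) \<longleftrightarrow> (\<forall>i. ((\<lambda>x. f x $ i) has_derivative (\<lambda>h. f' h $ i)) (at x))"
proof
  assume "(f has_derivative f') (at x)"
  then show "\<forall>i. ((\<lambda>x. f x $ i) has_derivative (\<lambda>h. f' h $ i)) (at x)"
    by (intro allI bounded_linear.has_derivative[OF bounded_linear_vec_nth])
next
  assume *: "\<forall>i. ((\<lambda>x. f x $ i) has_derivative (\<lambda>h. f' h $ i)) (at x)"
  show "(f has_derivative f') (at x)"
  proof (subst has_derivative_componentwise_within, rule ballI)
    fix b :: "'b ^ 'm" assume "b \<in> Basis"
    then obtain i c where b: "b = axis i c" by (auto simp: Basis_vec_def)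
    show "((\<lambda>x. f x \<bullet> b) has_derivative (\<lambda>h. f' h \<bullet> b)) (at x)"
      unfolding b inner_axis using * by (intro has_derivative_inner_left) blast
  qed
qed

lemma has_derivative_componentwise_vec2:
  fixes f :: "'a::real_normed_vector \<Rightarrow> complex ^ 'n ^ 'd"
  shows "(f has_derivative f') (at x) \<longleftrightarrow> (\<forall>l i. ((\<lambda>x. f x $ l $ i) has_derivative (\<lambda>h. f' h $ l $ i)) (at x))"
  by (subst has_derivative_componentwise_vec, subst has_derivative_componentwise_vec) simp

lemma wkb_partial_sum_has_derivative:
  fixes a :: "nat \<Rightarrow> real \<times> (real ^ 'd) \<Rightarrow> complex ^ 'n ^ 'd"
  assumes "(a 0 has_derivative a0') (at p)" "(a 1 has_derivative a1') (at p)"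
  shows "(wkb_partial_sum \<tau> \<xi> a 2 \<epsilon> has_derivative
    (\<lambda>h. \<chi> l. exp (\<i> * of_real (phase \<tau> \<xi> p / \<epsilon>)) *s
      ((\<i> * of_real (phase \<tau> \<xi> h / \<epsilon>)) *s ((a 0 p + \<epsilon> *\<^sub>R a 1 p) $ l) + (a0' h + \<epsilon> *\<^sub>R a1' h) $ l))) (at p)"
proof -
  have ph: "bounded_linear (phase \<tau> \<xi>)"
    unfolding phase_def[abs_def]
    by (intro bounded_linear_add bounded_linear_compose[OF bounded_linear_mult_left bounded_linear_fst]
        bounded_linear_compose[OF bounded_linear_inner_left bounded_linear_snd])
  define P where "P h = \<i> * complex_of_real (phase \<tau> \<xi> h / \<epsilon>)" for h
  have P: "(P has_derivative P) (at p)" unfolding P_def[abs_def]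
    by (rule bounded_linear_imp_has_derivative)
       (intro bounded_linear_compose[OF bounded_linear_mult_right] bounded_linear_compose[OF bounded_linear_of_real]
         bounded_linear_compose[OF bounded_linear_divide] ph)
  have E: "((\<lambda>q. exp (P q)) has_derivative (\<lambda>h. exp (P p) * P h)) (at p)"
    by (rule has_derivative_compose[OF P DERIV_exp[unfolded has_field_derivative_def]])
  have a: "((\<lambda>q. a 0 q + \<epsilon> *\<^sub>R a 1 q) has_derivative (\<lambda>h. a0' h + \<epsilon> *\<^sub>R a1' h)) (at p)"
    by (intro has_derivative_add has_derivative_scaleR_right assms)
  have bl: "bounded_linear (\<lambda>v :: complex ^ 'n ^ 'd. v $ l $ i)" for l i
    by (intro bounded_linear_compose[OF bounded_linear_vec_nth] bounded_linear_vec_nth)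
  have eq: "wkb_partial_sum \<tau> \<xi> a 2 \<epsilon> q $ l $ i = exp (P q) * ((a 0 q + \<epsilon> *\<^sub>R a 1 q) $ l $ i)" for q l i
    unfolding wkb_partial_sum_def phase_def[symmetric] P_def[symmetric] numeral_2_eq_2 by (simp add: distrib_left)
  show ?thesis
    unfolding P_def[symmetric] has_derivative_componentwise_vec2
  proof (intro allI)
    fix l i
    have "((\<lambda>q. exp (P q) * ((a 0 q + \<epsilon> *\<^sub>R a 1 q) $ l $ i)) has_derivative
        (\<lambda>h. exp (P p) * ((a0' h + \<epsilon> *\<^sub>R a1' h) $ l $ i) + exp (P p) * P h * ((a 0 p + \<epsilon> *\<^sub>R a 1 p) $ l $ i))) (at p)"
      by (rule has_derivative_mult[OF E bounded_linear.has_derivative[OF bl a]])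
    then show "((\<lambda>q. wkb_partial_sum \<tau> \<xi> a 2 \<epsilon> q $ l $ i) has_derivative
      (\<lambda>h. (\<chi> l. exp (P p) *s
      (P h *s ((a 0 p + \<epsilon> *\<^sub>R a 1 p) $ l) + (a0' h + \<epsilon> *\<^sub>R a1' h) $ l)) $ l $ i)) (at p)"
      unfolding eq by (rule has_derivative_eq_rhs) (simp add: fun_eq_iff algebra_simps)
  qed
qed

text \<open>Sorted by powers of \<epsilon>: the split symbol on the first amplitude, then the split
  symbol on the second plus the operator on the first, and a remainder of order \<epsilon>. The
  exponential \<open>E\<close> stays a common factor.\<close>

lemma split_row_wkb:
  assumes "\<epsilon> \<noteq> 0"
  shows "split_row A s l (\<lambda>h. \<chi> l. E *s ((\<i> * of_real (phase \<tau> \<xi> h / \<epsilon>)) *s ((u + \<epsilon> *\<^sub>R v) $ l) + (u' h + \<epsilon> *\<^sub>R v' h) $ l))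
      (\<chi> l. E *s ((u + \<epsilon> *\<^sub>R v) $ l)) =
    E *s ((1 / \<epsilon>) *\<^sub>R (\<i> *s (\<tau> *\<^sub>R u $ l + (\<xi> $ l) *\<^sub>R (A l *v (\<Sum>j\<in>UNIV. u $ j)))) +
      (\<i> *s (\<tau> *\<^sub>R v $ l + (\<xi> $ l) *\<^sub>R (A l *v (\<Sum>j\<in>UNIV. v $ j))) + split_row A s l u' u) +
      \<epsilon> *\<^sub>R split_row A s l v' v)"
proof -
  have A: "A l *v (c *\<^sub>R w) = c *\<^sub>R (A l *v w)" for c w
    using linear_cmul[OF bounded_linear.linear[OF bounded_linear_matrix_vector_complex]] .
  have sum: "(\<Sum>j\<in>UNIV. E *s ((\<i> * of_real (\<xi> $ l / \<epsilon>)) *s ((u + \<epsilon> *\<^sub>R v) $ j) + (u' h + \<epsilon> *\<^sub>R v' h) $ j)) =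
    E *s ((\<i> * of_real (\<xi> $ l / \<epsilon>)) *s ((\<Sum>j\<in>UNIV. u $ j) + \<epsilon> *\<^sub>R (\<Sum>j\<in>UNIV. v $ j)) +
     ((\<Sum>j\<in>UNIV. u' h $ j) + \<epsilon> *\<^sub>R (\<Sum>j\<in>UNIV. v' h $ j)))" for h
    by (simp add: vec_eq_iff sum_component sum.distrib sum_distrib_left scaleR_sum_right distrib_left)
  have ph: "phase \<tau> \<xi> (1, 0) = \<tau>" "phase \<tau> \<xi> (0, axis l 1) = \<xi> $ l"
    by (simp_all add: phase_def inner_axis')
  show ?thesis
    unfolding split_row_def ph vec_lambda_beta sum matrix_vector_smult matrix_vector_right_distrib A
    using assms by (simp add: vec_eq_iff scaleR_conv_of_real[of _ "_ :: complex"] field_simps)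
qed

text \<open>Two terms of the expansion are enough, as the orders 1/\<epsilon> and 1 contain only the
  first two amplitudes. The split operator applied to the truncated sum tends to 0 pointwise, so
  both coefficients vanish.\<close>

lemma wkb_leading_equations:
  fixes A :: "'d::finite \<Rightarrow> complex ^ 'n ^ 'n"
  assumes wkb: "wkb_solution \<Omega> A \<sigma> \<tau> \<xi> U a" and p: "p \<in> \<Omega>"
  shows "\<tau> *\<^sub>R a 0 p $ l + (\<xi> $ l) *\<^sub>R (A l *v (\<Sum>j\<in>UNIV. a 0 p $ j)) = 0"
    and "\<i> *s (\<tau> *\<^sub>R a 1 p $ l + (\<xi> $ l) *\<^sub>R (A l *v (\<Sum>j\<in>UNIV. a 1 p $ j))) +
      split_row A (\<sigma> l (snd p $ l)) l (frechet_derivative (a 0) (at p)) (a 0 p) = 0"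
proof -
  let ?F = "at_right (0::real)"
  let ?s = "\<sigma> l (snd p $ l)"
  define S where "S = wkb_partial_sum \<tau> \<xi> a 2"
  define D where "D \<epsilon> q = U \<epsilon> q - S \<epsilon> q" for \<epsilon> q
  define X where "X = \<i> *s (\<tau> *\<^sub>R a 0 p $ l + (\<xi> $ l) *\<^sub>R (A l *v (\<Sum>j\<in>UNIV. a 0 p $ j)))"
  define Y where "Y = \<i> *s (\<tau> *\<^sub>R a 1 p $ l + (\<xi> $ l) *\<^sub>R (A l *v (\<Sum>j\<in>UNIV. a 1 p $ j))) +
      split_row A ?s l (frechet_derivative (a 0) (at p)) (a 0 p)"
  define Z where "Z = split_row A ?s l (frechet_derivative (a 1) (at p)) (a 1 p)"
  define E where "E \<epsilon> = exp (\<i> * complex_of_real (phase \<tau> \<xi> p / \<epsilon>))" for \<epsilon>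
  have da: "(a j has_derivative frechet_derivative (a j) (at p)) (at p)" for j
    using wkb p by (auto simp: wkb_solution_def frechet_derivative_works[symmetric])
  have dU: "(U \<epsilon> has_derivative frechet_derivative (U \<epsilon>) (at p)) (at p)" if "\<epsilon> > 0" for \<epsilon>
    using wkb p that by (auto simp: wkb_solution_def frechet_derivative_works[symmetric])
  define S' where "S' \<epsilon> h = (\<chi> l. E \<epsilon> *s
      ((\<i> * of_real (phase \<tau> \<xi> h / \<epsilon>)) *s ((a 0 p + \<epsilon> *\<^sub>R a 1 p) $ l) +
       (frechet_derivative (a 0) (at p) h + \<epsilon> *\<^sub>R frechet_derivative (a 1) (at p) h) $ l))" for \<epsilon> h
  have dS: "(S \<epsilon> has_derivative S' \<epsilon>) (at p)" for \<epsilon>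
    unfolding S_def S'_def[abs_def] E_def by (rule wkb_partial_sum_has_derivative[OF da da])
  have Sp: "S \<epsilon> p = (\<chi> l. E \<epsilon> *s ((a 0 p + \<epsilon> *\<^sub>R a 1 p) $ l))" for \<epsilon>
    unfolding S_def wkb_partial_sum_def E_def phase_def numeral_2_eq_2 by simp
  \<comment> \<open>The remainder is of order \<epsilon>^2, and so is \<epsilon> times its
    derivative; one power is lost to the factor \<epsilon>, and the derivative itself still tends to
    0.\<close>
  have "((\<lambda>\<epsilon>. split_row A ?s l (frechet_derivative (D \<epsilon>) (at p)) (D \<epsilon> p)) \<longlongrightarrow> 0) ?F"
  proof (rule tendsto_split_row)
    have D1: "locally_bigo \<Omega> 2 D" and D2: "\<And>b. b \<in> Basis \<Longrightarrow>
        locally_bigo \<Omega> 2 (\<lambda>\<epsilon> p. \<epsilon> *\<^sub>R frechet_derivative (D \<epsilon>) (at p) b)"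
      using wkb unfolding wkb_solution_def D_def[abs_def] S_def by auto
    have "((\<lambda>\<epsilon>. frechet_derivative (D \<epsilon>) (at p) b) \<longlongrightarrow> 0) ?F" if "b \<in> Basis" for b
    proof -
      have "((\<lambda>\<epsilon>. (1 / \<epsilon> ^ 1) *\<^sub>R (\<epsilon> *\<^sub>R frechet_derivative (D \<epsilon>) (at p) b)) \<longlongrightarrow> 0) ?F"
        by (rule locally_bigo_tendsto_0[OF _ p]) (use D2[OF that] in \<open>simp add: numeral_2_eq_2\<close>)
      then show ?thesis
        by (rule Lim_transform_eventually) (auto simp: eventually_at_filter)
    qed
    then show "((\<lambda>\<epsilon>. frechet_derivative (D \<epsilon>) (at p) (1, 0)) \<longlongrightarrow> 0) ?F"
      "((\<lambda>\<epsilon>. frechet_derivative (D \<epsilon>) (at p) (0, axis l 1)) \<longlongrightarrow> 0) ?F"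
      by (auto simp: Basis_prod_def axis_in_Basis_iff)
    have "((\<lambda>\<epsilon>. (1 / \<epsilon> ^ 1) *\<^sub>R D \<epsilon> p) \<longlongrightarrow> 0) ?F"
      by (rule locally_bigo_tendsto_0[OF _ p]) (use D1 in \<open>simp add: numeral_2_eq_2\<close>)
    from tendsto_scaleR[OF tendsto_ident_at this]
    have "((\<lambda>\<epsilon>. \<epsilon> *\<^sub>R ((1 / \<epsilon> ^ 1) *\<^sub>R D \<epsilon> p)) \<longlongrightarrow> 0) ?F" by simp
    then show "((\<lambda>\<epsilon>. D \<epsilon> p) \<longlongrightarrow> 0) ?F"
      by (rule Lim_transform_eventually) (auto simp: eventually_at_filter)
  qed
  moreover have "((\<lambda>\<epsilon>. split_op A \<sigma> (U \<epsilon>) p $ l) \<longlongrightarrow> 0 $ l) ?F"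
    using locally_bigo_tendsto_0[OF _ p, of 0 "\<lambda>\<epsilon>. split_op A \<sigma> (U \<epsilon>)"] wkb
    by (intro tendsto_vec_nth) (simp add: wkb_solution_def)
  ultimately have "((\<lambda>\<epsilon>. split_op A \<sigma> (U \<epsilon>) p $ l - split_row A ?s l (frechet_derivative (D \<epsilon>) (at p)) (D \<epsilon> p)) \<longlongrightarrow> 0 $ l - 0) ?F"
    by (intro tendsto_diff)
  \<comment> \<open>Passing to norms removes the exponential, which has modulus 1 but no limit as
    \<epsilon> tends to 0.\<close>
  then have "((\<lambda>\<epsilon>. norm (split_op A \<sigma> (U \<epsilon>) p $ l - split_row A ?s l (frechet_derivative (D \<epsilon>) (at p)) (D \<epsilon> p))) \<longlongrightarrow> 0) ?F"
    using tendsto_norm_zero by fastforce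
  then have "((\<lambda>\<epsilon>. norm ((1 / \<epsilon>) *\<^sub>R X + Y + \<epsilon> *\<^sub>R Z)) \<longlongrightarrow> 0) ?F"
  proof (rule Lim_transform_eventually)
    show "\<forall>\<^sub>F \<epsilon> in ?F. norm (split_op A \<sigma> (U \<epsilon>) p $ l - split_row A ?s l (frechet_derivative (D \<epsilon>) (at p)) (D \<epsilon> p)) =
       norm ((1 / \<epsilon>) *\<^sub>R X + Y + \<epsilon> *\<^sub>R Z)"
      using eventually_at_right_less[of 0]
    proof eventually_elim
      case (elim \<epsilon>)
      have dD: "(D \<epsilon> has_derivative (\<lambda>h. frechet_derivative (U \<epsilon>) (at p) h - S' \<epsilon> h)) (at p)"
        unfolding D_def[abs_def] by (rule has_derivative_diff[OF dU[OF elim] dS])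
      have "split_row A ?s l (frechet_derivative (D \<epsilon>) (at p)) (D \<epsilon> p) =
        split_row A ?s l (frechet_derivative (U \<epsilon>) (at p)) (U \<epsilon> p) - split_row A ?s l (S' \<epsilon>) (S \<epsilon> p)"
        unfolding frechet_derivative_at[OF dD, symmetric] D_def by (rule split_row_diff)
      then have "split_op A \<sigma> (U \<epsilon>) p $ l - split_row A ?s l (frechet_derivative (D \<epsilon>) (at p)) (D \<epsilon> p) =
          split_row A ?s l (S' \<epsilon>) (S \<epsilon> p)"
        unfolding split_op_row[OF dU[OF elim]] by simp
      also have "\<dots> = E \<epsilon> *s ((1 / \<epsilon>) *\<^sub>R X + Y + \<epsilon> *\<^sub>R Z)"
        unfolding S'_def[abs_def] Sp X_def Y_def Z_def by (rule split_row_wkb) (use elim in simp)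
      finally have "split_op A \<sigma> (U \<epsilon>) p $ l - split_row A ?s l (frechet_derivative (D \<epsilon>) (at p)) (D \<epsilon> p) =
        E \<epsilon> *s ((1 / \<epsilon>) *\<^sub>R X + Y + \<epsilon> *\<^sub>R Z)" .
      then show ?case by (simp only: norm_vector_smult) (simp add: E_def)
    qed
  qed
  then have lim: "((\<lambda>\<epsilon>. (1 / \<epsilon>) *\<^sub>R X + Y + \<epsilon> *\<^sub>R Z) \<longlongrightarrow> 0) ?F"
    by (rule tendsto_norm_zero_cancel)
  \<comment> \<open>Multiplication by \<epsilon> isolates the coefficient of 1/\<epsilon>; once it
    is 0, the limit of what remains is \<open>Y\<close>.\<close>
  have X0: "X = 0"
  proof -
    have "((\<lambda>\<epsilon>. \<epsilon> *\<^sub>R ((1 / \<epsilon>) *\<^sub>R X + Y + \<epsilon> *\<^sub>R Z) - \<epsilon> *\<^sub>R (Y + \<epsilon> *\<^sub>R Z)) \<longlongrightarrow> 0 *\<^sub>R 0 - 0 *\<^sub>R (Y + 0 *\<^sub>R Z)) ?F"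
      by (intro tendsto_intros lim)
    then have "((\<lambda>\<epsilon>. X) \<longlongrightarrow> 0 *\<^sub>R 0 - 0 *\<^sub>R (Y + 0 *\<^sub>R Z)) ?F"
      by (rule Lim_transform_eventually) (auto simp: eventually_at_filter scaleR_add_right)
    then show ?thesis by (simp add: tendsto_const_iff)
  qed
  have Y0: "Y = 0"
  proof -
    have "((\<lambda>\<epsilon>. ((1 / \<epsilon>) *\<^sub>R X + Y + \<epsilon> *\<^sub>R Z) - \<epsilon> *\<^sub>R Z) \<longlongrightarrow> 0 - 0 *\<^sub>R Z) ?F"
      by (intro tendsto_intros lim)
    then show ?thesis by (simp add: X0 tendsto_const_iff)
  qed
  show "\<i> *s (\<tau> *\<^sub>R a 1 p $ l + (\<xi> $ l) *\<^sub>R (A l *v (\<Sum>j\<in>UNIV. a 1 p $ j))) +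
      split_row A (\<sigma> l (snd p $ l)) l (frechet_derivative (a 0) (at p)) (a 0 p) = 0"
    using Y0 by (simp add: Y_def)
  have "norm (\<tau> *\<^sub>R a 0 p $ l + (\<xi> $ l) *\<^sub>R (A l *v (\<Sum>j\<in>UNIV. a 0 p $ j))) = norm X"
    unfolding X_def norm_vector_smult by simp
  then show "\<tau> *\<^sub>R a 0 p $ l + (\<xi> $ l) *\<^sub>R (A l *v (\<Sum>j\<in>UNIV. a 0 p $ j)) = 0"
    using X0 by simp
qed

text \<open>The sum of the blocks is treated first, since it takes values in the kernel of L_1. Its
  transport defect is shown to lie in the range and in the kernel of L_1 at once; the equation for
  each block follows by polarization.\<close>

lemma leading_amplitude_transport:
  fixes A :: "'d::finite \<Rightarrow> complex ^ 'n ^ 'n"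
  assumes rb: "\<And>\<eta>. resolvent_bound K (\<Sum>l\<in>UNIV. (\<eta> $ l) *\<^sub>R A l)"
    and sv: "smooth_variety A \<tau> \<xi> \<tau>f" and \<tau>f: "\<tau>f \<xi> = \<tau>" and \<tau>: "\<tau> \<noteq> 0"
    and wkb: "wkb_solution \<Omega> A \<sigma> \<tau> \<xi> U a" and \<Omega>: "open \<Omega>" "p \<in> \<Omega>"
  shows "(a 0 has_derivative frechet_derivative (a 0) (at p)) (at p)"
    and "frechet_derivative (a 0) (at p) (1, group_velocity \<tau>f \<xi>) = - beta \<sigma> \<tau>f \<xi> (snd p) *\<^sub>R a 0 p"
proof -
  let ?B = "L_symbol A \<tau> \<xi>"
  let ?D = "frechet_derivative (a 0) (at p)"
  define g where "g = grad \<tau>f \<xi>"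
  define s where "s q = (\<Sum>j\<in>UNIV. a 0 q $ j)" for q
  define s' where "s' h = (\<Sum>j\<in>UNIV. ?D h $ j)" for h
  define s1 where "s1 = (\<Sum>j\<in>UNIV. a 1 p $ j)"
  define \<sigma>p where "\<sigma>p l = \<sigma> l (snd p $ l)" for l
  have Alin: "linear ((*v) B)" for B :: "complex ^ 'n ^ 'n"
    by (rule bounded_linear.linear[OF bounded_linear_matrix_vector_complex])
  note Ascale = linear_cmul[OF Alin]
  show da: "(a 0 has_derivative ?D) (at p)"
    using wkb \<Omega> by (auto simp: wkb_solution_def frechet_derivative_works[symmetric])
  have ds: "(s has_derivative s') (at p)" unfolding s_def[abs_def] s'_def[abs_def]
    by (intro has_derivative_sum bounded_linear.has_derivative[OF bounded_linear_vec_nth] da)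
  have pol: "a 0 q $ l = (- (\<xi> $ l) / \<tau>) *\<^sub>R (A l *v s q)" if "q \<in> \<Omega>" for q l
  proof -
    have "\<tau> *\<^sub>R a 0 q $ l = - ((\<xi> $ l) *\<^sub>R (A l *v s q))"
      using wkb_leading_equations(1)[OF wkb that, of l] by (simp add: s_def eq_neg_iff_add_eq_0)
    then have "(1 / \<tau>) *\<^sub>R (\<tau> *\<^sub>R a 0 q $ l) = (1 / \<tau>) *\<^sub>R (- ((\<xi> $ l) *\<^sub>R (A l *v s q)))" by simp
    then show ?thesis using \<tau> by simp
  qed
  have Bs: "?B *v s q = 0" if "q \<in> \<Omega>" for q
  proof -
    have "?B *v s q = (\<Sum>l\<in>UNIV. \<tau> *\<^sub>R a 0 q $ l + (\<xi> $ l) *\<^sub>R (A l *v s q))"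
      unfolding L_symbol_mult_sum sum.distrib by (simp add: s_def scaleR_sum_right)
    also have "\<dots> = 0" using wkb_leading_equations(1)[OF wkb that] by (simp add: s_def)
    finally show ?thesis .
  qed
  \<comment> \<open>The algebraic relations hold on the open set \<Omega>, so they may be
    differentiated in every space-time direction, also across the ray.\<close>
  have zero: "f' h = 0" if "(f has_derivative f') (at p)" "\<And>q. q \<in> \<Omega> \<Longrightarrow> f q = 0" for f f' h
  proof -
    have "((\<lambda>_. 0) has_derivative (\<lambda>_. 0)) (at p)" by simp
    then have "(f has_derivative (\<lambda>_. 0)) (at p)"
      by (rule has_derivative_transform_within_open[OF _ \<Omega>]) (simp add: that(2))
    then show ?thesis using has_derivative_unique[OF that(1)] by metis
  qed
  have Bs': "?B *v s' h = 0" for h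
    by (rule zero[OF bounded_linear.has_derivative[OF bounded_linear_matrix_vector_complex ds]]) (rule Bs)
  have pol': "?D h $ l = (- (\<xi> $ l) / \<tau>) *\<^sub>R (A l *v s' h)" for h l
  proof -
    have "((\<lambda>q. a 0 q $ l - (- (\<xi> $ l) / \<tau>) *\<^sub>R (A l *v s q)) has_derivative
        (\<lambda>h. ?D h $ l - (- (\<xi> $ l) / \<tau>) *\<^sub>R (A l *v s' h))) (at p)"
      by (intro has_derivative_diff bounded_linear.has_derivative[OF bounded_linear_vec_nth] da
          has_derivative_scaleR_right bounded_linear.has_derivative[OF bounded_linear_matrix_vector_complex] ds)
    then have "?D h $ l - (- (\<xi> $ l) / \<tau>) *\<^sub>R (A l *v s' h) = 0" by (rule zero) (simp add: pol)
    then show ?thesis by (simp only: right_minus_eq)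
  qed
  have R: "\<exists>w. (g $ l) *\<^sub>R v + A l *v v = ?B *v w" if "?B *v v = 0" for l v
    using symbol_derivative_in_range[OF rb sv \<tau>f that, of l] unfolding g_def by blast
  have "\<forall>l. \<exists>w. (g $ l) *\<^sub>R s' (0, axis l 1) + A l *v s' (0, axis l 1) = ?B *v w"
    by (intro allI R Bs')
  then obtain w where w: "\<And>l. (g $ l) *\<^sub>R s' (0, axis l 1) + A l *v s' (0, axis l 1) = ?B *v w l"
    by metis
  obtain w0 where w0: "\<And>l. (g $ l) *\<^sub>R s p + A l *v s p = ?B *v w0 l"
    using R[OF Bs[OF \<Omega>(2)]] by metis
  \<comment> \<open>The defect of the transport equation for the sum of the blocks. In the summed
    equation each A_l is replaced by -\<partial>_l\<tau> up to the range: \<open>w\<close> collects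
    the corrections for the space derivatives, \<open>w0\<close> those for the absorption terms,
    which become \<beta> with the sign supplied by the polarization.\<close>
  define y where "y = s' (1, 0) - (\<Sum>l\<in>UNIV. (g $ l) *\<^sub>R s' (0, axis l 1)) + beta \<sigma> \<tau>f \<xi> (snd p) *\<^sub>R s p"
  have "y = ?B *v (- (\<i> *s s1) - (\<Sum>l\<in>UNIV. w l) + (\<Sum>l\<in>UNIV. (\<sigma>p l * (\<xi> $ l) / \<tau>) *\<^sub>R w0 l))"
  proof -
    have "0 = (\<Sum>l\<in>UNIV. \<i> *s (\<tau> *\<^sub>R a 1 p $ l + (\<xi> $ l) *\<^sub>R (A l *v s1)) +
        split_row A (\<sigma>p l) l ?D (a 0 p))"
      using wkb_leading_equations(2)[OF wkb \<Omega>(2)] by (simp add: s1_def \<sigma>p_def)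
    also have "\<dots> = \<i> *s (?B *v s1) + (s' (1, 0) + (\<Sum>l\<in>UNIV. A l *v s' (0, axis l 1)) + (\<Sum>l\<in>UNIV. \<sigma>p l *\<^sub>R a 0 p $ l))"
      unfolding L_symbol_mult_sum sum.distrib split_row_def
      by (simp add: s1_def s'_def scaleR_sum_right sum.distrib linear_sum[OF bounded_linear.linear[OF bounded_linear_vector_smult]]
          linear_add[OF bounded_linear.linear[OF bounded_linear_vector_smult]])
    finally have e1: "s' (1, 0) = - (\<i> *s (?B *v s1)) - (\<Sum>l\<in>UNIV. A l *v s' (0, axis l 1)) - (\<Sum>l\<in>UNIV. \<sigma>p l *\<^sub>R a 0 p $ l)"
      by (simp add: algebra_simps eq_neg_iff_add_eq_0)
    have e2: "(\<Sum>l\<in>UNIV. \<sigma>p l *\<^sub>R a 0 p $ l) = - (\<Sum>l\<in>UNIV. (\<sigma>p l * (\<xi> $ l) / \<tau>) *\<^sub>R (A l *v s p))"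
      unfolding sum_negf[symmetric] by (rule sum.cong) (simp_all add: pol[OF \<Omega>(2)])
    have e3: "beta \<sigma> \<tau>f \<xi> (snd p) *\<^sub>R s p = (\<Sum>l\<in>UNIV. (\<sigma>p l * (\<xi> $ l) / \<tau>) *\<^sub>R ((g $ l) *\<^sub>R s p))"
      by (simp add: beta_def scaleR_sum_left \<tau>f g_def \<sigma>p_def)
    have e4: "?B *v (\<Sum>l\<in>UNIV. w l) = (\<Sum>l\<in>UNIV. (g $ l) *\<^sub>R s' (0, axis l 1)) + (\<Sum>l\<in>UNIV. A l *v s' (0, axis l 1))"
      unfolding linear_sum[OF Alin] w[symmetric] by (rule sum.distrib)
    have e5: "?B *v (\<Sum>l\<in>UNIV. (\<sigma>p l * (\<xi> $ l) / \<tau>) *\<^sub>R w0 l) =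
        (\<Sum>l\<in>UNIV. (\<sigma>p l * (\<xi> $ l) / \<tau>) *\<^sub>R ((g $ l) *\<^sub>R s p)) + (\<Sum>l\<in>UNIV. (\<sigma>p l * (\<xi> $ l) / \<tau>) *\<^sub>R (A l *v s p))"
      unfolding linear_sum[OF Alin] Ascale w0[symmetric] scaleR_add_right by (rule sum.distrib)
    show ?thesis
      unfolding matrix_vector_right_distrib matrix_vector_mult_diff_distrib e4 e5 y_def e1 e2 e3
        linear_neg[OF Alin] matrix_vector_smult by simp
  qed
  then obtain u where u: "y = ?B *v u" by blast
  have "?B *v y = 0"
  proof -
    have "?B *v y = ?B *v s' (1, 0) - (\<Sum>l\<in>UNIV. (g $ l) *\<^sub>R (?B *v s' (0, axis l 1))) + beta \<sigma> \<tau>f \<xi> (snd p) *\<^sub>R (?B *v s p)"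
      unfolding y_def matrix_vector_right_distrib matrix_vector_mult_diff_distrib linear_sum[OF Alin] Ascale ..
    then show ?thesis using Bs' Bs[OF \<Omega>(2)] by simp
  qed
  \<comment> \<open>A vector in both the range and the kernel is the end of a Jordan chain for the
    eigenvalue - \<tau>, and such chains are trivial.\<close>
  then have "y = 0"
    using resolvent_bound_semisimple[OF rb[of \<xi>], of u "of_real (- \<tau>)" y] u
    unfolding L_symbol_mult by simp
  moreover have "s' (1, - g) = s' (1, 0) - (\<Sum>l\<in>UNIV. (g $ l) *\<^sub>R s' (0, axis l 1))"
  proof -
    have lin: "linear s'" using ds has_derivative_linear by blast
    have eq: "(1, - g) = (1, 0) + (\<Sum>l\<in>UNIV. (- (g $ l)) *\<^sub>R (0 :: real, axis l (1::real)))"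
      by (simp add: prod_eq_iff fst_sum snd_sum vec_eq_iff sum_component axis_def if_distrib sum_negf cong: if_cong)
    have "s' (1, - g) = s' (1, 0) + (\<Sum>l\<in>UNIV. (- (g $ l)) *\<^sub>R s' (0, axis l 1))"
      unfolding eq linear_add[OF lin] linear_sum[OF lin] linear_cmul[OF lin] ..
    then show ?thesis by (simp add: sum_negf)
  qed
  ultimately have s'v: "s' (1, - g) = - beta \<sigma> \<tau>f \<xi> (snd p) *\<^sub>R s p"
    by (simp add: y_def eq_neg_iff_add_eq_0)
  \<comment> \<open>Every block is a fixed matrix applied to the sum, and so are its derivatives;
    the scalar transport law passes through this matrix.\<close>
  show "?D (1, group_velocity \<tau>f \<xi>) = - beta \<sigma> \<tau>f \<xi> (snd p) *\<^sub>R a 0 p"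
    unfolding vec_eq_iff[of "?D _"]
  proof
    fix l
    show "?D (1, group_velocity \<tau>f \<xi>) $ l = (- beta \<sigma> \<tau>f \<xi> (snd p) *\<^sub>R a 0 p) $ l"
      unfolding group_velocity_def g_def[symmetric] pol' s'v Ascale vector_scaleR_component pol[OF \<Omega>(2)] by simp
  qed
qed

subsection \<open>Growth along the ray\<close>

text \<open>No regularity of \<open>\<beta>\<close> beyond integrability is available, as the absorptions are arbitrary
  functions.  The Henstock-Kurzweil fundamental theorem applied to \<open>- ln (norm (g t))\<close> makes this enough.\<close>

lemma scalar_linear_ode_norm:
  fixes g :: "real \<Rightarrow> 'a::real_inner" and \<beta> :: "real \<Rightarrow> real"
  assumes der: "\<And>t. t \<in> {0..T} \<Longrightarrow> (g has_vector_derivative (- \<beta> t) *\<^sub>R g t) (at t within {0..T})"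
    and int: "\<beta> integrable_on {0..T}" and T: "0 \<le> T" and g0: "g 0 \<noteq> 0"
  shows "norm (g T) = norm (g 0) * exp (- integral {0..T} \<beta>)"
proof -
  \<comment> \<open>The logarithm requires \<open>g\<close> to be free of zeros, so the formula is
    first proved under that proviso; a first zero is then excluded with the formula itself.\<close>
  have step: "norm (g t) = norm (g 0) * exp (- integral {0..t} \<beta>)"
    if t: "0 \<le> t" "t \<le> T" and nz: "\<And>s. s \<in> {0..t} \<Longrightarrow> g s \<noteq> 0" for t
  proof -
    have "((\<lambda>s. - ln (norm (g s))) has_vector_derivative \<beta> s) (at s within {0..t})" if s: "s \<in> {0..t}" for s
    proof -
      have "(g has_vector_derivative (- \<beta> s) *\<^sub>R g s) (at s within {0..t})"
        by (rule has_vector_derivative_within_subset[OF der]) (use s t in auto)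
      then have "(g has_derivative (\<lambda>h. h *\<^sub>R (- \<beta> s) *\<^sub>R g s)) (at s within {0..t})"
        by (simp add: has_vector_derivative_def)
      from has_derivative_compose[OF this has_derivative_norm[OF nz[OF s]]]
      have "((\<lambda>s. norm (g s)) has_derivative (\<lambda>h. sgn (g s) \<bullet> (h *\<^sub>R (- \<beta> s) *\<^sub>R g s))) (at s within {0..t})"
        by (simp add: inner_commute)
      moreover have "sgn (g s) \<bullet> g s = norm (g s)"
        using nz[OF s] by (simp add: sgn_div_norm power2_norm_eq_inner[symmetric] power2_eq_square)
      then have "(\<lambda>h. sgn (g s) \<bullet> (h *\<^sub>R (- \<beta> s) *\<^sub>R g s)) = (*) (- \<beta> s * norm (g s))"
        by (simp add: fun_eq_iff)
      ultimately have "((\<lambda>s. norm (g s)) has_real_derivative (- \<beta> s * norm (g s))) (at s within {0..t})"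
        by (simp add: has_field_derivative_def)
      from DERIV_minus[OF DERIV_chain2[OF DERIV_ln this]] nz[OF s]
      have "((\<lambda>s. - ln (norm (g s))) has_real_derivative \<beta> s) (at s within {0..t})"
        by (simp add: field_simps)
      then show ?thesis
        by (simp add: has_real_derivative_iff_has_vector_derivative)
    qed
    then have "(\<beta> has_integral (- ln (norm (g t)) - - ln (norm (g 0)))) {0..t}"
      by (rule fundamental_theorem_of_calculus[OF t(1)])
    then have "integral {0..t} \<beta> = ln (norm (g 0)) - ln (norm (g t))" by (simp add: integral_unique)
    then have "- integral {0..t} \<beta> = ln (norm (g t) / norm (g 0))"
      using nz[of 0] nz[of t] t by (simp add: ln_div)
    then show ?thesis using nz[of 0] nz[of t] t by simp
  qed
  have contg: "continuous_on {0..T} g"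
    using der by (meson continuous_on_eq_continuous_within has_vector_derivative_continuous)
  have "g t \<noteq> 0" if t: "t \<in> {0..T}" for t
  proof
    assume "g t = 0"
    define Z where "Z = {t \<in> {0..T}. g t = 0}"
    define m where "m = Inf Z"
    have "closed Z" unfolding Z_def
      by (rule continuous_closed_preimage_constant[OF contg]) simp
    moreover have "Z \<noteq> {}" "bdd_below Z" using t \<open>g t = 0\<close> by (auto simp: Z_def bdd_below_def)
    ultimately have "m \<in> Z" unfolding m_def by (intro closed_contains_Inf)
    then have m: "0 \<le> m" "m \<le> T" "g m = 0" by (auto simp: Z_def)
    have m0: "0 < m" using m g0 by (cases "m = 0") auto
    have before: "g s \<noteq> 0" if "s \<in> {0..<m}" for s
    proof
      assume "g s = 0"
      then have "m \<le> s" unfolding m_def using that m \<open>bdd_below Z\<close>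
        by (intro cInf_lower) (auto simp: Z_def)
      then show False using that by simp
    qed
    \<comment> \<open>Up to the first zero \<open>m\<close> the norm equals a positive exponential
      factor times its initial value. By continuity the equality persists at \<open>m\<close>, where
      it contradicts the zero.\<close>
    let ?f = "\<lambda>s. norm (g s) - norm (g 0) * exp (- integral {0..s} \<beta>)"
    have "?f m = 0"
    proof (rule continuous_constant_on_closure[where f = ?f and x = m and S = "{0..<m}"])
      have "\<beta> integrable_on {0..m}" by (rule integrable_on_subinterval[OF int]) (use m in auto)
      then show "continuous_on (closure {0..<m}) ?f"
        using m m0 by (auto intro!: continuous_intros indefinite_integral_continuous_1 continuous_on_subset[OF contg])
      show "?f s = 0" if "s \<in> {0..<m}" for s
        using step[of s] before that m by auto
    qed (use m0 in auto)
    then show False using m g0 by simp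
  qed
  then show ?thesis using step[OF T] by auto
qed

text \<open>The assertion covers every WKB solution on an open neighbourhood of the ray segment.
  Nonvanishing of the leading amplitude at the foot of the ray expresses that an amplitude is
  carried along it; the zero family would satisfy the definition without growing.\<close>

theorem theorem5p2:
  fixes A :: "'d::finite \<Rightarrow> complex ^ 'n::finite ^ 'n"
    and \<sigma> :: "'d \<Rightarrow> real \<Rightarrow> real"
    and \<tau> t\<^sub>0 :: real and \<xi> x :: "real ^ 'd" and \<tau>f :: "real ^ 'd \<Rightarrow> real"
    and \<Omega> :: "(real \<times> (real ^ 'd)) set"
    and U :: "real \<Rightarrow> real \<times> (real ^ 'd) \<Rightarrow> complex ^ 'n ^ 'd"
    and a :: "nat \<Rightarrow> real \<times> (real ^ 'd) \<Rightarrow> complex ^ 'n ^ 'd"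
  assumes "strongly_well_posed A"
    and "(\<tau>, \<xi>) \<in> char_variety A" and "\<tau> \<noteq> 0"
    and "smooth_variety A \<tau> \<xi> \<tau>f"
    and "0 \<le> t\<^sub>0"
    and "integral {0..t\<^sub>0} (\<lambda>t. beta \<sigma> \<tau>f \<xi> (x - t *\<^sub>R grad \<tau>f \<xi>)) < 0"
    and "open \<Omega>" and "ray_segment \<tau>f \<xi> x t\<^sub>0 \<subseteq> \<Omega>"
    and "wkb_solution \<Omega> A \<sigma> \<tau> \<xi> U a"
    and "a 0 (0, x) \<noteq> 0"
  shows "grows_in_layer \<sigma> (group_velocity \<tau>f \<xi>) x t\<^sub>0 (a 0)"
proof -
  let ?v = "group_velocity \<tau>f \<xi>"
  let ?\<beta> = "\<lambda>t. beta \<sigma> \<tau>f \<xi> (x - t *\<^sub>R grad \<tau>f \<xi>)"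
  define c where "c t = (t, x + t *\<^sub>R ?v)" for t
  obtain K where "K \<ge> 0" "\<And>\<eta> \<mu> v. \<bar>Im \<mu>\<bar> * norm v \<le> K * norm ((\<Sum>l\<in>UNIV. (\<eta> $ l) *\<^sub>R A l) *v v - \<mu> *s v)"
    by (rule strongly_well_posed_resolvent_bound[OF assms(1)]) blast
  then have rb: "resolvent_bound K (\<Sum>l\<in>UNIV. (\<eta> $ l) *\<^sub>R A l)" for \<eta>
    by (simp add: resolvent_bound_def)
  note transport = leading_amplitude_transport[OF rb assms(4) smooth_variety_eq[OF assms(4,2)] assms(3,9,7)]
  have "((\<lambda>t. a 0 (c t)) has_vector_derivative (- ?\<beta> t) *\<^sub>R a 0 (c t)) (at t within {0..t\<^sub>0})"
    if t: "t \<in> {0..t\<^sub>0}" for t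
  proof -
    have "c t \<in> ray_segment \<tau>f \<xi> x t\<^sub>0"
      unfolding ray_segment_def c_def using t by (intro image_eqI[of _ _ t]) auto
    then have ct: "c t \<in> \<Omega>" using assms(8) by blast
    have dc: "(c has_derivative (\<lambda>h. h *\<^sub>R (1, ?v))) (at t within {0..t\<^sub>0})"
      unfolding c_def[abs_def] by (auto intro!: derivative_eq_intros)
    note da = transport(1)[OF ct]
    have "linear (frechet_derivative (a 0) (at (c t)))" using da has_derivative_linear by blast
    then have "((\<lambda>t. a 0 (c t)) has_derivative (\<lambda>h. h *\<^sub>R frechet_derivative (a 0) (at (c t)) (1, ?v))) (at t within {0..t\<^sub>0})"
      using has_derivative_compose[OF dc da] by (simp only: linear_cmul)
    then show ?thesis
      unfolding transport(2)[OF ct] has_vector_derivative_def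
      by (simp add: c_def group_velocity_def)
  qed
  \<comment> \<open>A function that is not integrable has integral 0 by convention, so strict
    negativity of the integral contains integrability.\<close>
  moreover have "?\<beta> integrable_on {0..t\<^sub>0}"
    using assms(6) not_integrable_integral by fastforce
  ultimately have "norm (a 0 (c t\<^sub>0)) = norm (a 0 (c 0)) * exp (- integral {0..t\<^sub>0} ?\<beta>)"
    by (rule scalar_linear_ode_norm) (use assms(5,10) in \<open>simp_all add: c_def\<close>)
  moreover have "norm (a 0 (c 0)) > 0" using assms(10) by (simp add: c_def)
  moreover have "exp (- integral {0..t\<^sub>0} ?\<beta>) > 1" using assms(6) by simp
  ultimately have "norm (a 0 (c 0)) < norm (a 0 (c t\<^sub>0))"
    by simp
  \<comment> \<open>Off the layer all absorptions vanish, and \<beta> with them; a segment that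
    avoids the layer would have integral 0.\<close>
  moreover have "\<exists>t\<in>{0..t\<^sub>0}. x + t *\<^sub>R ?v \<in> layer \<sigma>"
  proof (rule ccontr)
    assume "\<not> (\<exists>t\<in>{0..t\<^sub>0}. x + t *\<^sub>R ?v \<in> layer \<sigma>)"
    then have "?\<beta> t = 0" if "t \<in> {0..t\<^sub>0}" for t
      using that by (auto simp: layer_def beta_def group_velocity_def)
    then have "integral {0..t\<^sub>0} ?\<beta> = integral {0..t\<^sub>0} (\<lambda>_. 0)"
      by (rule Henstock_Kurzweil_Integration.integral_cong)
    then show False using assms(6) by simp
  qed
  ultimately show ?thesis by (simp add: grows_in_layer_def c_def)
qed

end
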